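(* Let $n\ge 3$. For $\theta_0\in(0,\pi)$ let $\lambda(\theta_0)=\lambda(\Gamma(\theta_0))$ be the first Dirichlet eigenvalue of the spherical cap $\Gamma(\theta_0)$ of colatitude $\theta_0$ in the unit sphere $\partial B_1\subset\mathbb{R}^n$. Then the function $\lambda:(0,\pi)\to\mathbb{R}$ is twice differentiable, strictly decreasing, and $$\lim_{\theta_0\to 0^+}\lambda(\theta_0)=+\infty.$$ Moreover, if $n\ge 5$, then $\lambda$ is a strictly convex function on $(0,\pi)$.
   Context: $\partial B_1$ is the unit sphere in $\mathbb{R}^n$ with the round metric, $\nabla_\phi$ its Riemannian gradient, $d\sigma$ the $(n-1)$-dimensional Hausdorff measure on it, and $p=(1,0,\dots,0)$. For $\theta_0\in(0,\pi)$, $\Gamma(\theta_0)=\{\phi\in\partial B_1: 0\le\arccos(p\cdot\phi)<\theta_0\}$. For a nonempty open set $\Gamma\subset\partial B_1$, the first Dirichlet eigenvalue is $$\lambda(\Gamma)=\min_{u\in H^1_0(\Gamma),\,u\not\equiv0}\frac{\int_\Gamma|\nabla_\phi u|^2\,d\sigma}{\int_\Gamma u^2\,d\sigma},$$ where $H^1_0(\Gamma)$ is the closure of $C_c^\infty(\Gamma)$ in $H^1(\partial B_1)$. *)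

theory Defs
  imports "HOL-Analysis.Analysis"
begin

subsection \<open>Hausdorff measure\<close>

definition hausdorff_gauge :: "nat \<Rightarrow> 'a::metric_space set \<Rightarrow> ennreal" where
  "hausdorff_gauge s U =
     (if U = {} then 0 else ennreal (unit_ball_vol (real s) * (diameter U / 2) ^ s))"

text \<open>Boundedness has to be required of the covering sets: \<^term>\<open>diameter\<close> is a real number, and
  it is unspecified for unbounded sets.\<close>

definition hausdorff_pre :: "nat \<Rightarrow> real \<Rightarrow> 'a::metric_space set \<Rightarrow> ennreal" where
  "hausdorff_pre s \<delta> A =
     (INF U \<in> {U :: nat \<Rightarrow> 'a set. A \<subseteq> (\<Union>i. U i) \<and> (\<forall>i. bounded (U i) \<and> diameter (U i) \<le> \<delta>)}.
        \<Sum>i. hausdorff_gauge s (U i))"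

definition hausdorff_outer :: "nat \<Rightarrow> 'a::metric_space set \<Rightarrow> ennreal" where
  "hausdorff_outer s A = (SUP \<delta>\<in>{0<..}. hausdorff_pre s \<delta> A)"

definition hausdorff_measure :: "nat \<Rightarrow> 'a::metric_space measure" where
  "hausdorff_measure s = measure_of UNIV (sets borel) (hausdorff_outer s)"

lemma hausdorff_pre_mono: "A \<subseteq> B \<Longrightarrow> hausdorff_pre s \<delta> A \<le> hausdorff_pre s \<delta> B"
  unfolding hausdorff_pre_def by (rule INF_superset_mono) auto

lemma hausdorff_pre_antimono: "d \<le> e \<Longrightarrow> hausdorff_pre s e A \<le> hausdorff_pre s d A"
  unfolding hausdorff_pre_def by (rule INF_superset_mono) (auto intro: order_trans)

lemma hausdorff_pre_empty:
  assumes "\<delta> > 0" shows "hausdorff_pre s \<delta> ({} :: 'a::metric_space set) = 0"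
proof -
  have "hausdorff_pre s \<delta> ({}::'a set) \<le> (\<Sum>i::nat. hausdorff_gauge s ({}::'a set))"
    unfolding hausdorff_pre_def using assms
    by (intro INF_lower2[of "\<lambda>_. {}"]) auto
  then show ?thesis by (simp add: hausdorff_gauge_def)
qed

lemma hausdorff_pre_subadditive:
  "hausdorff_pre s \<delta> (\<Union>i. A i) \<le> (\<Sum>i. hausdorff_pre s \<delta> (A i))"
proof (rule ennreal_le_epsilon)
  fix e :: real assume e: "0 < e" and fin: "(\<Sum>i. hausdorff_pre s \<delta> (A i)) < top"
  have "hausdorff_pre s \<delta> (A n) < hausdorff_pre s \<delta> (A n) + e * (1/2)^Suc n" for n
    using e fin by (auto simp add: less_top dest!: ennreal_suminf_lessD)
  then have "\<exists>U. A n \<subseteq> (\<Union>i. U i) \<and> (\<forall>i::nat. bounded (U i) \<and> diameter (U i) \<le> \<delta>) \<and>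
      (\<Sum>i. hausdorff_gauge s (U i)) \<le> hausdorff_pre s \<delta> (A n) + e * (1/2)^Suc n" for n
    unfolding hausdorff_pre_def INF_less_iff by (blast intro: less_imp_le)
  then obtain U where U: "\<And>n. A n \<subseteq> (\<Union>i. U n i)"
      "\<And>n (i::nat). bounded (U n i)" "\<And>n i. diameter (U n i) \<le> \<delta>"
      "\<And>n. (\<Sum>i. hausdorff_gauge s (U n i)) \<le> hausdorff_pre s \<delta> (A n) + e * (1/2)^Suc n"
    by metis
  define V where "V = (\<lambda>k. case prod_decode k of (n, i) \<Rightarrow> U n i)"
  have cov: "(\<Union>n. A n) \<subseteq> (\<Union>k. V k)"
  proof
    fix x assume "x \<in> (\<Union>n. A n)"
    then obtain n i where "x \<in> U n i" using U(1) by blast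
    then have "x \<in> V (prod_encode (n, i))" by (simp add: V_def)
    then show "x \<in> (\<Union>k. V k)" by blast
  qed
  have "hausdorff_pre s \<delta> (\<Union>n. A n) \<le> (\<Sum>k. hausdorff_gauge s (V k))"
    unfolding hausdorff_pre_def using cov U(2,3)
    by (intro INF_lower) (auto simp: V_def split: prod.split)
  also have "\<dots> = (\<Sum>k. (\<lambda>(n, i). hausdorff_gauge s (U n i)) (prod_decode k))"
    by (intro suminf_cong) (simp add: V_def split: prod.split)
  also have "\<dots> = (\<Sum>n. \<Sum>i. hausdorff_gauge s (U n i))"
    by (rule suminf_ennreal_2dimen) simp
  also have "\<dots> \<le> (\<Sum>n. hausdorff_pre s \<delta> (A n) + e * (1/2)^Suc n)"
    by (intro suminf_le U(4) summableI)
  also have "\<dots> = (\<Sum>n. hausdorff_pre s \<delta> (A n)) + (\<Sum>n. ennreal e * ennreal ((1/2)^Suc n))"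
    using e by (subst suminf_add[symmetric]) (auto simp del: ennreal_suminf_cmult simp add: ennreal_mult[symmetric])
  also have "(\<Sum>n. ennreal e * ennreal ((1/2)^Suc n)) = ennreal e"
    unfolding ennreal_suminf_cmult
    by (subst suminf_ennreal_eq[OF zero_le_power power_half_series]) auto
  finally show "hausdorff_pre s \<delta> (\<Union>i. A i) \<le> (\<Sum>i. hausdorff_pre s \<delta> (A i)) + ennreal e" .
qed

lemma outer_measure_space_hausdorff: "outer_measure_space (Pow UNIV) (hausdorff_outer s)"
  unfolding outer_measure_space_def
proof (intro conjI)
  show "positive (Pow UNIV) (hausdorff_outer s :: 'a set \<Rightarrow> ennreal)"
    by (simp add: positive_def hausdorff_outer_def hausdorff_pre_empty)
  show "increasing (Pow UNIV) (hausdorff_outer s :: 'a set \<Rightarrow> ennreal)"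
    unfolding increasing_def hausdorff_outer_def by (auto intro!: SUP_mono' hausdorff_pre_mono)
  show "countably_subadditive (Pow UNIV) (hausdorff_outer s :: 'a set \<Rightarrow> ennreal)"
    unfolding countably_subadditive_def
  proof (intro allI impI)
    fix A :: "nat \<Rightarrow> 'a set"
    show "hausdorff_outer s (\<Union>i. A i) \<le> (\<Sum>i. hausdorff_outer s (A i))"
      unfolding hausdorff_outer_def[of s "\<Union>i. A i"]
    proof (rule SUP_least)
      fix d :: real assume d: "d \<in> {0<..}"
      have "hausdorff_pre s d (\<Union>i. A i) \<le> (\<Sum>i. hausdorff_pre s d (A i))"
        by (rule hausdorff_pre_subadditive)
      also have "\<dots> \<le> (\<Sum>i. hausdorff_outer s (A i))"
        unfolding hausdorff_outer_def using d by (intro suminf_le SUP_upper summableI) auto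
      finally show "hausdorff_pre s d (\<Union>i. A i) \<le> (\<Sum>i. hausdorff_outer s (A i))" .
    qed
  qed
qed

lemma hausdorff_pre_separated:
  assumes "\<And>x y. x \<in> A \<Longrightarrow> y \<in> B \<Longrightarrow> \<delta> < dist x y"
  shows "hausdorff_pre s \<delta> A + hausdorff_pre s \<delta> B \<le> hausdorff_pre s \<delta> (A \<union> B)"
  unfolding hausdorff_pre_def[of s \<delta> "A \<union> B"]
proof (rule INF_greatest, clarify)
  fix U :: "nat \<Rightarrow> 'a set"
  assume cov: "A \<union> B \<subseteq> (\<Union>i. U i)" and U: "\<forall>i. bounded (U i) \<and> diameter (U i) \<le> \<delta>"
  define V where "V C = (\<lambda>i. if U i \<inter> C = {} then {} else U i)" for C
  have V: "hausdorff_pre s \<delta> C \<le> (\<Sum>i. hausdorff_gauge s (V C i))" if "C \<subseteq> A \<union> B" for C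
  proof -
    have "0 \<le> \<delta>" using U diameter_ge_0[of "U 0"] by (meson order_trans)
    moreover have "C \<subseteq> (\<Union>i. V C i)" using cov that by (fastforce simp: V_def)
    ultimately show ?thesis
      unfolding hausdorff_pre_def using U by (intro INF_lower) (auto simp: V_def)
  qed
  have disj: "U i \<inter> A = {} \<or> U i \<inter> B = {}" for i
  proof (rule ccontr)
    assume "\<not> ?thesis"
    then obtain x y where "x \<in> U i" "x \<in> A" "y \<in> U i" "y \<in> B" by auto
    with assms[of x y] U diameter_bounded_bound[of "U i" x y] show False
      by (meson not_le order_trans)
  qed
  have "hausdorff_pre s \<delta> A + hausdorff_pre s \<delta> B
      \<le> (\<Sum>i. hausdorff_gauge s (V A i)) + (\<Sum>i. hausdorff_gauge s (V B i))"
    by (intro add_mono V) auto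
  also have "\<dots> = (\<Sum>i. hausdorff_gauge s (V A i) + hausdorff_gauge s (V B i))"
    by (intro suminf_add summableI)
  also have "\<dots> \<le> (\<Sum>i. hausdorff_gauge s (U i))"
    using disj by (intro suminf_le summableI) (auto simp: V_def hausdorff_gauge_def)
  finally show "hausdorff_pre s \<delta> A + hausdorff_pre s \<delta> B \<le> (\<Sum>i. hausdorff_gauge s (U i))" .
qed

lemma hausdorff_outer_separated:
  assumes d: "0 < d" and sep: "\<And>x y. x \<in> A \<Longrightarrow> y \<in> B \<Longrightarrow> d \<le> dist x y"
  shows "hausdorff_outer s A + hausdorff_outer s B \<le> hausdorff_outer s (A \<union> B)"
proof -
  have "hausdorff_outer s A + hausdorff_outer s B =
      (SUP \<delta>\<in>{0<..}. hausdorff_pre s \<delta> A + hausdorff_pre s \<delta> B)"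
    unfolding hausdorff_outer_def
  proof (rule SUP_add_directed_ennreal[symmetric])
    fix i j :: real assume "i \<in> {0<..}" "j \<in> {0<..}"
    then show "\<exists>k\<in>{0<..}. hausdorff_pre s i A + hausdorff_pre s j B
        \<le> hausdorff_pre s k A + hausdorff_pre s k B"
      by (intro bexI[of _ "min i j"] add_mono hausdorff_pre_antimono) auto
  qed
  also have "\<dots> \<le> hausdorff_outer s (A \<union> B)"
  proof (rule SUP_least)
    fix e :: real assume e: "e \<in> {0<..}"
    define k where "k = min e (d / 2)"
    have k: "0 < k" "k \<le> e" "k < d" using e d by (auto simp: k_def)
    have "hausdorff_pre s e A + hausdorff_pre s e B \<le> hausdorff_pre s k A + hausdorff_pre s k B"
      by (intro add_mono hausdorff_pre_antimono k)
    also have "\<dots> \<le> hausdorff_pre s k (A \<union> B)"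
      using sep k(3) by (intro hausdorff_pre_separated) fastforce
    also have "\<dots> \<le> hausdorff_outer s (A \<union> B)"
      unfolding hausdorff_outer_def using k by (intro SUP_upper) auto
    finally show "hausdorff_pre s e A + hausdorff_pre s e B \<le> hausdorff_outer s (A \<union> B)" .
  qed
  finally show ?thesis .
qed

lemma closed_in_lambda_system:
  fixes f :: "'a::metric_space set \<Rightarrow> ennreal"
  assumes om: "outer_measure_space (Pow UNIV) f"
    and sep: "\<And>A B d. 0 < d \<Longrightarrow> (\<And>x y. x \<in> A \<Longrightarrow> y \<in> B \<Longrightarrow> d \<le> dist x y) \<Longrightarrow> f A + f B \<le> f (A \<union> B)"
    and C: "closed C"
  shows "C \<in> lambda_system UNIV (Pow UNIV) f"
proof (cases "C = {}")
  case True
  interpret algebra UNIV "Pow UNIV" by (rule algebra_Pow)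
  show ?thesis using True lambda_system_empty om by (auto simp: outer_measure_space_def)
next
  case False
  have f0: "f {} = 0" using om by (auto simp: outer_measure_space_def positive_def)
  have mono: "A \<subseteq> B \<Longrightarrow> f A \<le> f B" for A B
    using om by (auto simp: outer_measure_space_def increasing_def)
  have csub': "f (\<Union>i. A i) \<le> (\<Sum>i. f (A i))" for A :: "nat \<Rightarrow> 'a set"
  proof -
    have "f (\<Union>i. disjointed A i) \<le> (\<Sum>i. f (disjointed A i))"
      using om disjoint_family_disjointed[of A]
      unfolding outer_measure_space_def countably_subadditive_def by (metis Pow_UNIV top_greatest UNIV_I)
    also have "\<dots> \<le> (\<Sum>i. f (A i))"
      by (intro suminf_le mono summableI disjointed_subset)
    finally show ?thesis by (simp add: UN_disjointed_eq)
  qed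
  have sub: "f (A \<union> B) \<le> f A + f B" for A B
  proof -
    have "f (A \<union> B) = f (\<Union>i. binaryset A B i)" by (simp add: UN_binaryset_eq)
    also have "\<dots> \<le> (\<Sum>i. f (binaryset A B i))" by (rule csub')
    also have "\<dots> = f A + f B" by (rule suminf_binaryset_eq) (rule f0)
    finally show ?thesis .
  qed
  have main: "f (C \<inter> A) + f (A - C) \<le> f A" for A
  proof (cases "f A = top")
    case True then show ?thesis by simp
  next
    case fin: False
    define B where "B k = {x \<in> A. 1 / real (Suc k) \<le> infdist x C}" for k
    define R where "R k = B (Suc k) - B k" for k
    have Bmono: "B k \<subseteq> B l" if "k \<le> l" for k l
    proof -
      have "1 / real (Suc l) \<le> 1 / real (Suc k)" using that by (simp add: frac_le)
      then show ?thesis unfolding B_def by force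
    qed
    have inf_le: "infdist x C \<le> infdist y C + dist x y" for x y
      by (rule infdist_triangle)
    have sepR: "\<exists>d>0. \<forall>x\<in>B k. \<forall>y\<in>A - B (Suc k). d \<le> dist x y" for k
    proof (intro exI conjI ballI)
      show "0 < 1 / real (Suc k) - 1 / real (Suc (Suc k))" by (simp add: frac_less2)
      fix x y assume "x \<in> B k" "y \<in> A - B (Suc k)"
      then have "1 / real (Suc k) \<le> infdist x C" "infdist y C < 1 / real (Suc (Suc k))"
        by (auto simp: B_def not_le)
      with inf_le[of x y] show "1 / real (Suc k) - 1 / real (Suc (Suc k)) \<le> dist x y" by linarith
    qed
    have partial: "(\<Sum>j<m. f (R (2 * j + c))) \<le> f (\<Union>j<m. R (2 * j + c))" for m c
    proof (induction m)
      case (Suc m)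
      have "f (\<Union>j<m. R (2 * j + c)) + f (R (2 * m + c))
          \<le> f ((\<Union>j<m. R (2 * j + c)) \<union> R (2 * m + c))"
      proof (cases m)
        case 0
        then show ?thesis by (simp add: f0)
      next
        case (Suc l)
        obtain d where d: "d > 0" "\<forall>x\<in>B (2*l+c+1). \<forall>y\<in>A - B (Suc (2*l+c+1)). d \<le> dist x y"
          using sepR by blast
        have "x \<in> B (2*l+c+1)" if x: "x \<in> (\<Union>j<m. R (2 * j + c))" for x
        proof -
          obtain j where "j < m" "x \<in> B (Suc (2 * j + c))" using x unfolding R_def by blast
          moreover have "Suc (2 * j + c) \<le> 2*l+c+1" using \<open>j < m\<close> Suc by simp
          ultimately show ?thesis using Bmono by blast
        qed
        moreover have "y \<in> A - B (Suc (2*l+c+1))" if "y \<in> R (2 * m + c)" for y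
          using that Suc by (auto simp: R_def B_def)
        ultimately show ?thesis using d by (intro sep[of d]) blast+
      qed
      then show ?case
        using order_trans[OF add_right_mono[OF Suc.IH, of "f (R (2 * m + c))"]]
        by (simp add: lessThan_Suc Un_commute add.commute)
    qed simp
    have RA: "R j \<subseteq> A" for j by (auto simp: R_def B_def)
    have partial': "(\<Sum>j<m. f (R (2 * j + c))) \<le> f A" for m c
      using partial[of c m] mono[of "\<Union>j<m. R (2 * j + c)" A] RA by (blast intro: order_trans)
    have double: "(\<Sum>i<2*m. f (R i)) = (\<Sum>j<m. f (R (2*j+0))) + (\<Sum>j<m. f (R (2*j+1)))" for m
      by (induction m) (auto simp: algebra_simps)
    have "(\<Sum>i<n. f (R i)) \<le> f A + f A" for n
    proof -
      have "(\<Sum>i<n. f (R i)) \<le> (\<Sum>i<2*n. f (R i))" by (intro sum_mono2) auto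
      also have "\<dots> \<le> f A + f A" unfolding double by (intro add_mono partial')
      finally show ?thesis .
    qed
    then have "(\<Sum>i. f (R i)) \<le> f A + f A" by (intro suminf_le_const summableI)
    moreover have "f A + f A < top" using fin by (simp add: top.not_eq_extremum)
    ultimately have T: "(\<Sum>i. f (R i)) < top" by (rule le_less_trans)
    have "(\<Sum>i. f (R i)) + (f (C \<inter> A) + f (A - C)) \<le> f A + (\<Sum>i. f (R i))"
    proof (rule ennreal_suminf_bound_add)
      fix k
      have "A - C \<subseteq> B k \<union> (\<Union>j. R (j + k))"
      proof
        fix x assume x: "x \<in> A - C"
        then have "infdist x C > 0"
          using C False by (simp add: infdist_pos_not_in_closed)
        then obtain m where "1 / real (Suc m) < infdist x C"
          using nat_approx_posE by blast
        then have m: "x \<in> B m" using x by (auto simp: B_def)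
        have "\<exists>j. x \<in> R (j + k)" if "x \<notin> B k"
        proof -
          define l where "l = (LEAST l. x \<in> B l)"
          have l: "x \<in> B l" unfolding l_def using m by (rule LeastI)
          have "k < l" using that l Bmono[of l k] by (meson not_le_imp_less subsetD)
          then obtain i where i: "l = Suc i" "k \<le> i" by (cases l) auto
          have "x \<notin> B i" using i not_less_Least[of i "\<lambda>l. x \<in> B l"] by (simp add: l_def)
          then have "x \<in> R i" using l i by (simp add: R_def)
          then show ?thesis using i by (intro exI[of _ "i - k"]) simp
        qed
        then show "x \<in> B k \<union> (\<Union>j. R (j + k))" by blast
      qed
      then have "f (A - C) \<le> f (B k) + f (\<Union>j. R (j + k))"
        by (rule order_trans[OF mono sub])
      also have "\<dots> \<le> f (B k) + (\<Sum>j. f (R (j + k)))"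
        by (intro add_left_mono csub')
      finally have 1: "f (A - C) \<le> f (B k) + (\<Sum>j. f (R (j + k)))" .
      have 2: "f (C \<inter> A) + f (B k) \<le> f A"
      proof -
        have "f (C \<inter> A) + f (B k) \<le> f (C \<inter> A \<union> B k)"
        proof (rule sep)
          show "0 < 1 / real (Suc k)" by simp
          fix x y assume "x \<in> C \<inter> A" "y \<in> B k"
          then show "1 / real (Suc k) \<le> dist x y"
            using infdist_le[of x C y] by (auto simp: B_def dist_commute)
        qed
        also have "\<dots> \<le> f A" by (rule mono) (auto simp: B_def)
        finally show ?thesis .
      qed
      have 3: "(\<Sum>i. f (R i)) = (\<Sum>j. f (R (j + k))) + (\<Sum>i<k. f (R i))"
        by (rule suminf_offset[OF summableI])
      have "(\<Sum>i<k. f (R i)) + (f (C \<inter> A) + f (A - C))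
          \<le> (\<Sum>i<k. f (R i)) + (f (C \<inter> A) + (f (B k) + (\<Sum>j. f (R (j + k)))))"
        by (intro add_left_mono 1)
      also have "\<dots> = (f (C \<inter> A) + f (B k)) + (\<Sum>i. f (R i))"
        unfolding 3 by (simp add: ac_simps)
      also have "\<dots> \<le> f A + (\<Sum>i. f (R i))" by (intro add_right_mono 2)
      finally show "(\<Sum>i<k. f (R i)) + (f (C \<inter> A) + f (A - C)) \<le> f A + (\<Sum>i. f (R i))" .
    qed
    then show ?thesis
      using T by (auto simp: add.commute[of "f A"] ennreal_add_left_cancel_le)
  qed
  have "f (C \<inter> A) + f ((UNIV - C) \<inter> A) = f A" for A
  proof (rule antisym)
    have *: "(UNIV - C) \<inter> A = A - C" by auto
    show "f (C \<inter> A) + f ((UNIV - C) \<inter> A) \<le> f A" unfolding * by (rule main)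
    have "A = (C \<inter> A) \<union> ((UNIV - C) \<inter> A)" by auto
    then show "f A \<le> f (C \<inter> A) + f ((UNIV - C) \<inter> A)" using sub by metis
  qed
  then show ?thesis by (simp add: lambda_system_def)
qed

text \<open>The following ensures that \<^const>\<open>hausdorff_measure\<close> is not the null measure which
  \<^const>\<open>measure_of\<close> returns for set functions that are not countably additive.\<close>

theorem emeasure_hausdorff_measure:
  fixes A :: "'a::metric_space set"
  assumes "A \<in> sets borel"
  shows "emeasure (hausdorff_measure s) A = hausdorff_outer s A"
proof -
  interpret sigma_algebra UNIV "Pow UNIV :: 'a set set" by (rule sigma_algebra_Pow)
  let ?L = "lambda_system UNIV (Pow UNIV) (hausdorff_outer s :: 'a set \<Rightarrow> ennreal)"
  have ms: "measure_space UNIV ?L (hausdorff_outer s)"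
    by (rule caratheodory_lemma[OF outer_measure_space_hausdorff])
  have sub: "sets (borel :: 'a measure) \<subseteq> ?L"
  proof -
    have "sigma_sets UNIV (Collect closed) \<subseteq> ?L"
    proof (rule sigma_algebra.sigma_sets_subset)
      show "sigma_algebra UNIV ?L" using ms by (simp add: measure_space_def)
      show "Collect closed \<subseteq> ?L"
      proof
        fix C :: "'a set" assume "C \<in> Collect closed"
        then have "closed C" by simp
        with outer_measure_space_hausdorff hausdorff_outer_separated show "C \<in> ?L"
          by (rule closed_in_lambda_system)
      qed
    qed
    then show ?thesis by (simp add: borel_eq_closed)
  qed
  have "measure_space UNIV (sets (borel :: 'a measure)) (hausdorff_outer s)"
    unfolding measure_space_def
  proof (intro conjI)
    show "sigma_algebra UNIV (sets (borel :: 'a measure))"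
      using sets.sigma_algebra_axioms[of "borel :: 'a measure"] by simp
    show "positive (sets (borel :: 'a measure)) (hausdorff_outer s)"
      using ms by (auto simp: measure_space_def positive_def)
    show "countably_additive (sets (borel :: 'a measure)) (hausdorff_outer s)"
      using ms sub by (auto simp: measure_space_def countably_additive_def)
  qed
  then show ?thesis
    unfolding hausdorff_measure_def measure_space_def using assms
    by (intro emeasure_measure_of_sigma) auto
qed

lemma space_hausdorff_measure [simp]: "space (hausdorff_measure s) = UNIV"
  by (simp add: hausdorff_measure_def)

lemma sets_hausdorff_measure [simp, measurable_cong]: "sets (hausdorff_measure s) = sets borel"
  unfolding hausdorff_measure_def
  by (metis sets.sets_measure_of_eq space_borel)


subsection \<open>Smooth functions and differential operators on the sphere\<close>

primrec Ck_on :: "nat \<Rightarrow> 'a::real_normed_vector set \<Rightarrow> ('a \<Rightarrow> 'b::real_normed_vector) \<Rightarrow> bool" where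
  "Ck_on 0 S f \<longleftrightarrow> continuous_on S f"
| "Ck_on (Suc k) S f \<longleftrightarrow>
     (\<forall>x\<in>S. f differentiable (at x)) \<and> (\<forall>v. Ck_on k S (\<lambda>x. frechet_derivative f (at x) v))"

text \<open>Functions on the unit sphere are represented by functions on the ambient space, of which only
  the values on the sphere matter.\<close>

definition smooth_on_sphere :: "('a::euclidean_space \<Rightarrow> 'b::real_normed_vector) \<Rightarrow> bool" where
  "smooth_on_sphere u \<longleftrightarrow>
     (\<exists>W F. open W \<and> sphere 0 1 \<subseteq> W \<and> (\<forall>k. Ck_on k W F) \<and> (\<forall>x\<in>sphere 0 1. u x = F x))"

text \<open>The Riemannian gradient: the tangent vector which represents the differential. The derivative
  within the sphere determines \<^term>\<open>g\<close> only up to multiples of the normal \<^term>\<open>x\<close>.\<close>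

definition sphere_gradient :: "('a::euclidean_space \<Rightarrow> real) \<Rightarrow> 'a \<Rightarrow> 'a" where
  "sphere_gradient u x =
     (THE g. g \<bullet> x = 0 \<and> (u has_derivative (\<lambda>v. g \<bullet> v)) (at x within sphere 0 1))"

lemma sphere_gradient_unique:
  fixes g h x :: "'a::euclidean_space"
  assumes x: "x \<in> sphere 0 1"
    and g: "g \<bullet> x = 0" "(u has_derivative (\<lambda>v. g \<bullet> v)) (at x within sphere 0 1)"
    and h: "h \<bullet> x = 0" "(u has_derivative (\<lambda>v. h \<bullet> v)) (at x within sphere 0 1)"
  shows "g = h"
proof (rule ccontr)
  assume "g \<noteq> h"
  define v where "v = (g - h) /\<^sub>R norm (g - h)"
  have v: "norm v = 1" "v \<bullet> x = 0"
    using \<open>g \<noteq> h\<close> g(1) h(1) by (auto simp: v_def inner_diff_left)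
  define c where "c t = cos t *\<^sub>R x + sin t *\<^sub>R v" for t :: real
  have "norm (c t) ^ 2 = cos t ^ 2 + sin t ^ 2" for t
    unfolding power2_norm_eq_inner c_def using x v
    by (simp add: inner_add_left inner_add_right inner_commute power2_eq_square norm_eq_1)
  then have c: "range c \<subseteq> sphere 0 1" by (auto simp: abs_square_eq_1)
  have c0: "c 0 = x" by (simp add: c_def)
  have dc: "(c has_derivative (\<lambda>t. t *\<^sub>R v)) (at 0)"
    unfolding c_def by (auto intro!: derivative_eq_intros)
  have "((\<lambda>t. u (c t)) has_derivative (\<lambda>t. a \<bullet> (t *\<^sub>R v))) (at 0)"
    if "(u has_derivative (\<lambda>v. a \<bullet> v)) (at x within sphere 0 1)" for a
    using has_derivative_in_compose[OF dc, of u "\<lambda>v. a \<bullet> v"] has_derivative_subset[OF that c] c0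
    by simp
  from this[OF g(2)] this[OF h(2)]
  have "(\<lambda>t. g \<bullet> (t *\<^sub>R v)) = (\<lambda>t. h \<bullet> (t *\<^sub>R v))" by (rule has_derivative_unique)
  then have "g \<bullet> v = h \<bullet> v" by (metis scaleR_one)
  then have "(g - h) \<bullet> (g - h) = 0"
    using \<open>g \<noteq> h\<close> by (simp add: v_def inner_diff_left)
  then show False using \<open>g \<noteq> h\<close> by simp
qed

text \<open>For tangent vector fields this is the Riemannian divergence.\<close>

definition sphere_div :: "(real ^ 'n \<Rightarrow> real ^ 'n) \<Rightarrow> real ^ 'n \<Rightarrow> real" where
  "sphere_div X x = (\<Sum>i\<in>UNIV. sphere_gradient (\<lambda>y. X y $ i) x $ i)"


subsection \<open>Sobolev spaces on the sphere\<close>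

definition sphere_measure :: "(real ^ 'n) measure" where
  "sphere_measure = restrict_space (hausdorff_measure (CARD('n) - 1)) (sphere 0 1)"

definition L2_sphere :: "(real ^ 'n \<Rightarrow> 'b::euclidean_space) set" where
  "L2_sphere =
     {f. f \<in> borel_measurable sphere_measure \<and> integrable sphere_measure (\<lambda>x. (norm (f x))\<^sup>2)}"

definition has_weak_gradient :: "(real ^ 'n \<Rightarrow> real) \<Rightarrow> (real ^ 'n \<Rightarrow> real ^ 'n) \<Rightarrow> bool" where
  "has_weak_gradient u G \<longleftrightarrow>
     (AE x in sphere_measure. G x \<bullet> x = 0) \<and>
     (\<forall>X. smooth_on_sphere X \<longrightarrow> (\<forall>x\<in>sphere 0 1. X x \<bullet> x = 0) \<longrightarrow>
        (LINT x|sphere_measure. G x \<bullet> X x) = - (LINT x|sphere_measure. u x * sphere_div X x))"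

definition H1_sphere :: "(real ^ 'n \<Rightarrow> real) set" where
  "H1_sphere = {u \<in> L2_sphere. \<exists>G\<in>L2_sphere. has_weak_gradient u G}"

text \<open>Elements of the Sobolev spaces are functions, not classes of functions; the weak gradient is
  determined almost everywhere.\<close>

definition weak_gradient :: "(real ^ 'n \<Rightarrow> real) \<Rightarrow> real ^ 'n \<Rightarrow> real ^ 'n" where
  "weak_gradient u = (SOME G. G \<in> L2_sphere \<and> has_weak_gradient u G)"

definition H1_norm :: "(real ^ 'n \<Rightarrow> real) \<Rightarrow> real" where
  "H1_norm u = sqrt ((LINT x|sphere_measure. (u x)\<^sup>2) +
                     (LINT x|sphere_measure. (norm (weak_gradient u x))\<^sup>2))"

definition Cc_smooth :: "(real ^ 'n) set \<Rightarrow> (real ^ 'n \<Rightarrow> real) set" where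
  "Cc_smooth \<Gamma> = {v. smooth_on_sphere v \<and> closure {x \<in> sphere 0 1. v x \<noteq> 0} \<subseteq> \<Gamma>}"

definition H1_0 :: "(real ^ 'n) set \<Rightarrow> (real ^ 'n \<Rightarrow> real) set" where
  "H1_0 \<Gamma> = {u \<in> H1_sphere. \<forall>\<epsilon>>0. \<exists>v\<in>Cc_smooth \<Gamma>. H1_norm (\<lambda>x. u x - v x) < \<epsilon>}"


subsection \<open>The first Dirichlet eigenvalue\<close>

text \<open>\<^const>\<open>Least\<close> is the minimum of a set of real numbers and not merely its infimum: it is
  unspecified unless the minimum is attained.\<close>

definition dirichlet_eigenvalue :: "(real ^ 'n) set \<Rightarrow> real" where
  "dirichlet_eigenvalue \<Gamma> =
     (LEAST r. \<exists>u\<in>H1_0 \<Gamma>. \<not> (AE x in sphere_measure. u x = 0) \<and>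
        r = (LINT x:\<Gamma>|sphere_measure. (norm (weak_gradient u x))\<^sup>2) /
            (LINT x:\<Gamma>|sphere_measure. (u x)\<^sup>2))"

definition spherical_cap :: "'a::euclidean_space \<Rightarrow> real \<Rightarrow> 'a set" where
  "spherical_cap p \<theta> = {x \<in> sphere 0 1. 0 \<le> arccos (p \<bullet> x) \<and> arccos (p \<bullet> x) < \<theta>}"

definition strictly_convex_on :: "'a::real_vector set \<Rightarrow> ('a \<Rightarrow> real) \<Rightarrow> bool" where
  "strictly_convex_on S f \<longleftrightarrow> convex S \<and>
     (\<forall>x\<in>S. \<forall>y\<in>S. \<forall>t. x \<noteq> y \<longrightarrow> 0 < t \<longrightarrow> t < 1 \<longrightarrow>
        f ((1 - t) *\<^sub>R x + t *\<^sub>R y) < (1 - t) * f x + t * f y)"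

end

theory Submission
  imports Defs "HOL-Real_Asymp.Real_Asymp"
begin

text \<open>Let \<open>m = n - 2\<close>. A radial eigenfunction of the cap solves \<open>u'' + m cot \<theta> u' + l u = 0\<close>; the solution
  that is regular at the pole is a power series in \<open>1 - cos \<theta>\<close> whose coefficients are polynomials in \<open>l\<close>, and the
  eigenvalue of the cap of colatitude \<open>t\<close> is the \<open>l\<close> for which \<open>t\<close> is its first zero. Indeed, for a test
  function \<open>v\<close> with support in the cap and the radial solution \<open>f\<close>, the divergence theorem for \<open>(v\<^sup>2 / f) \<nabla>f\<close>
  shows that \<open>\<integral>\<bar>\<nabla>v\<bar>\<^sup>2 - l \<integral>v\<^sup>2 = \<integral>\<bar>\<nabla>v - (v / f) \<nabla>f\<bar>\<^sup>2 \<ge> 0\<close>, and cutoffs of \<open>f\<close> show that the minimum is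
  attained. Integration by parts on the sphere only needs the invariance of Hausdorff measure under rotations:
  derivatives along rotations have integral zero.

  Sturm comparison makes the eigenvalue decreasing and continuous in \<open>t\<close>, and implicit differentiation of the
  equation for the zero makes it twice differentiable. For convexity, \<open>w = (sin \<theta>)\<^bsup>m/2\<^esup> u\<close> satisfies
  \<open>w'' + (l + m/2 - V) w = 0\<close> with \<open>V = (m/2) (m/2 - 1) cot\<^sup>2 \<theta>\<close>, which is convex for \<open>m \<ge> 3\<close>. By the Riccati equation
  the point \<open>x\<close> where \<open>- w' / w\<close> takes the value \<open>v\<close> satisfies \<open>dx/dv = 1 / (l + m/2 - V(x) + v\<^sup>2)\<close>. The right-hand
  side is jointly convex in \<open>(x, l)\<close>, so the zero, which is the limit of \<open>x\<close> for \<open>v \<rightarrow> \<infinity>\<close>, is a strictly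
  convex decreasing function of \<open>l\<close>, and so is its inverse.\<close>

subsection \<open>The radial eigenfunction\<close>

text \<open>The surface measure enters through invariance under orthogonal maps, finiteness and
  positivity on caps; no integration in polar coordinates occurs. The eigenvalue is a genuine
  minimum, so a minimizer has to be exhibited. It is the radial solution extended by zero, which has
  a kink at the boundary of the cap; its weak gradient is obtained as a bounded pointwise limit of
  gradients of smooth cutoffs. The Rayleigh quotient integrates over the cap alone while members of
  \<open>H1_0\<close> live on the whole sphere, so the lower bound also has to control what happens
  outside the cap.

  On the analytic side the obstacle is the pole, where \<open>cot\<close> is singular. The series in
  \<open>1 - cos \<theta>\<close> converges up to \<theta> = pi and carries the regular solution and
  its derivatives in l across \<theta> = 0, so monotonicity arguments can start at the pole with
  explicit values. For convexity the normal form itself is singular there; the second variation is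
  rewritten as an expression that is regular and vanishes at the pole. The threshold n \<ge> 5 is
  the condition (m/2) (m/2 - 1) > 0 on the coefficient of the square of \<open>cot\<close>.\<close>

lemma suminf_diffs_mult:
  fixes c :: "nat \<Rightarrow> real"
  assumes "summable (\<lambda>k. diffs c k * s ^ k)"
  shows "(\<lambda>k. real k * c k * s ^ k) sums (s * (\<Sum>k. diffs c k * s ^ k))"
proof -
  have "(\<lambda>n. s * (of_nat n * c n * s ^ (n - Suc 0))) sums (s * (\<Sum>k. diffs c k * s ^ k))"
    by (intro sums_mult diffs_equiv assms)
  moreover have "s * (of_nat n * c n * s ^ (n - Suc 0)) = real n * c n * s ^ n" for n
    by (cases n) auto
  ultimately show ?thesis by simp
qed

lemma summable_diffs:
  fixes c :: "nat \<Rightarrow> real"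
  assumes "\<And>s. \<bar>s\<bar> < K \<Longrightarrow> summable (\<lambda>k. c k * s ^ k)" and "\<bar>s\<bar> < K"
  shows "summable (\<lambda>k. diffs c k * s ^ k)"
  using termdiff_converges[of s K c] assms by auto

text \<open>In the variable \<open>s = 1 - cos \<theta>\<close> the radial equation is
  hypergeometric with finite singular points 0 and 2, and comparing coefficients gives
  \<open>rec\<close>. The inhomogeneity \<open>g\<close> lets the same lemma cover the equations
  obtained by differentiating in \<open>l\<close>.\<close>

lemma power_series_ode:
  fixes c g :: "nat \<Rightarrow> real" and m :: nat
  assumes rec: "\<And>k. real ((k + 1) * (2 * k + m + 1)) * c (Suc k) = (real (k * (k + m)) - l) * c k - g k"
    and c: "\<And>s. \<bar>s\<bar> < 2 \<Longrightarrow> summable (\<lambda>k. c k * s ^ k)"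
    and g: "summable (\<lambda>k. g k * s ^ k)" and s: "\<bar>s\<bar> < 2"
  shows "s * (2 - s) * (\<Sum>k. diffs (diffs c) k * s ^ k) + real (m + 1) * (1 - s) * (\<Sum>k. diffs c k * s ^ k)
      + l * (\<Sum>k. c k * s ^ k) + (\<Sum>k. g k * s ^ k) = 0"
proof -
  define D where "D = (\<Sum>k. diffs c k * s ^ k)"
  define DD where "DD = (\<Sum>k. diffs (diffs c) k * s ^ k)"
  have sD: "summable (\<lambda>k. diffs c k * t ^ k)" if "\<bar>t\<bar> < 2" for t
    using summable_diffs[OF c that] .
  have sDD: "summable (\<lambda>k. diffs (diffs c) k * s ^ k)"
    using summable_diffs[OF sD s] .
  have 1: "(\<lambda>k. real k * c k * s ^ k) sums (s * D)"
    unfolding D_def by (rule suminf_diffs_mult[OF sD[OF s]])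
  have 2: "(\<lambda>k. real k * diffs c k * s ^ k) sums (s * DD)"
    unfolding DD_def by (rule suminf_diffs_mult[OF sDD])
  have 3: "(\<lambda>k. real k * (real k - 1) * c k * s ^ k) sums (s * (s * DD))"
  proof -
    have "(\<lambda>n. s * (real n * diffs c n * s ^ n)) sums (s * (s * DD))"
      by (rule sums_mult[OF 2])
    then have "(\<lambda>n. (\<lambda>k. real k * (real k - 1) * c k * s ^ k) (Suc n)) sums (s * (s * DD))"
      by (simp add: diffs_def algebra_simps)
    then show ?thesis by (subst (asm) sums_Suc_iff) auto
  qed
  have "(\<lambda>k. 2 * (real k * diffs c k * s ^ k) - real k * (real k - 1) * c k * s ^ k
      + real (m + 1) * (diffs c k * s ^ k - real k * c k * s ^ k) + l * (c k * s ^ k) + g k * s ^ k)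
     sums (2 * (s * DD) - s * (s * DD) + real (m + 1) * (D - s * D) + l * (\<Sum>k. c k * s ^ k) + (\<Sum>k. g k * s ^ k))"
    using sD[OF s] c[OF s] g unfolding D_def
    by (intro sums_add sums_diff sums_mult 1 2 3 1[unfolded D_def] summable_sums)
  moreover have "2 * (real k * diffs c k * s ^ k) - real k * (real k - 1) * c k * s ^ k
      + real (m + 1) * (diffs c k * s ^ k - real k * c k * s ^ k) + l * (c k * s ^ k) + g k * s ^ k = 0" for k
  proof -
    have "2 * (real k * diffs c k * s ^ k) - real k * (real k - 1) * c k * s ^ k
      + real (m + 1) * (diffs c k * s ^ k - real k * c k * s ^ k) + l * (c k * s ^ k) + g k * s ^ k
      = (real ((k + 1) * (2 * k + m + 1)) * c (Suc k) - (real (k * (k + m)) - l) * c k + g k) * s ^ k"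
      by (simp add: diffs_def algebra_simps)
    then show ?thesis using rec[of k] by simp
  qed
  ultimately have "2 * (s * DD) - s * (s * DD) + real (m + 1) * (D - s * D) + l * (\<Sum>k. c k * s ^ k) + (\<Sum>k. g k * s ^ k) = 0"
    using sums_unique2[OF _ sums_zero] by simp
  then show ?thesis unfolding D_def DD_def by (simp add: algebra_simps)
qed

text \<open>One majorant \<open>e\<close> for the coefficients and their parameter derivatives
  bounds the differentiated terms on a rectangle by \<open>M k\<close>, so the derivatives converge
  uniformly and the series may be differentiated termwise in both variables at once. Joint
  differentiability is what implicit differentiation asks for.\<close>

lemma power_series_joint_derivative:
  fixes a b :: "real \<Rightarrow> nat \<Rightarrow> real" and e :: "nat \<Rightarrow> real"
  assumes ab: "\<And>x k. \<bar>x\<bar> < L \<Longrightarrow> ((\<lambda>x. a x k) has_real_derivative b x k) (at x)"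
    and ae: "\<And>x k. \<bar>x\<bar> < L \<Longrightarrow> \<bar>a x k\<bar> \<le> e k"
    and be: "\<And>x k. \<bar>x\<bar> < L \<Longrightarrow> \<bar>b x k\<bar> \<le> e k"
    and e: "\<And>s. \<bar>s\<bar> < K \<Longrightarrow> summable (\<lambda>k. e k * s ^ k)"
    and x: "\<bar>x\<bar> < L" and s: "\<bar>s\<bar> < K"
  shows "((\<lambda>(x, s). \<Sum>k. a x k * s ^ k) has_derivative
     (\<lambda>(h, j). h * (\<Sum>k. b x k * s ^ k) + j * (\<Sum>k. diffs (a x) k * s ^ k))) (at (x, s))"
proof -
  obtain r where r: "\<bar>s\<bar> < r" "r < K" using s dense by blast
  have r0: "0 < r" using r by linarith
  define S where "S = {-L<..<L} \<times> {-r<..<r}"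
  have S: "convex S" "open S" "(x, s) \<in> S" using x r
    by (auto simp: S_def convex_Times open_Times)
  have e0: "0 \<le> e k" for k using ae[OF x, of k] by linarith
  have bnd: "summable (\<lambda>k. c k * t ^ k)" if "\<And>k. \<bar>c k\<bar> \<le> e k" "\<bar>t\<bar> < K" for c t
  proof (rule summable_comparison_test)
    show "summable (\<lambda>k. e k * \<bar>t\<bar> ^ k)" using that by (intro e) auto
    show "\<exists>N. \<forall>n\<ge>N. norm (c n * t ^ n) \<le> e n * \<bar>t\<bar> ^ n"
      using that by (auto simp: abs_mult power_abs intro!: mult_right_mono)
  qed
  define M where "M k = e k * r ^ k + real k * e k * r ^ (k - Suc 0)" for k
  have rK: "\<bar>r\<bar> < K" using r r0 by simp
  have "summable (\<lambda>k. real k * e k * r ^ (k - Suc 0))"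
    using diffs_equiv[OF summable_diffs[OF e rK]] by (simp add: sums_iff)
  then have M: "summable M" unfolding M_def[abs_def] by (intro summable_add e rK)
  define f where "f k = (\<lambda>(x, s). a x k * s ^ k)" for k
  define f' where "f' k p = (\<lambda>(h, j). h * (b (fst p) k * snd p ^ k) + j * (real k * a (fst p) k * snd p ^ (k - Suc 0)))" for k and p :: "real \<times> real"
  define g' where "g' p = (\<lambda>(h, j). h * (\<Sum>k. b (fst p) k * snd p ^ k) + j * (\<Sum>k. diffs (a (fst p)) k * snd p ^ k))" for p :: "real \<times> real"
  have f'M: "\<bar>f' k p h\<bar> \<le> M k * norm h" if "p \<in> S" for k p h
  proof -
    obtain y t where p: "p = (y, t)" by force
    obtain u v where h: "h = (u, v)" by force
    have yt: "\<bar>y\<bar> < L" "\<bar>t\<bar> < r" using that p by (auto simp: S_def)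
    have "\<bar>u\<bar> \<le> norm h" "\<bar>v\<bar> \<le> norm h" using h norm_fst_le[of u v] norm_snd_le[of v u] by auto
    then have "\<bar>u * (b y k * t ^ k)\<bar> \<le> norm h * (e k * r ^ k)"
      "\<bar>v * (real k * a y k * t ^ (k - Suc 0))\<bar> \<le> norm h * (real k * e k * r ^ (k - Suc 0))"
      unfolding abs_mult power_abs using yt ae be e0 r0
      by (intro mult_mono power_mono; simp)+
    then show ?thesis by (simp add: f'_def p h M_def algebra_simps)
  qed
  have f's: "(\<lambda>k. f' k p h) sums g' p h" if "p \<in> S" for p h
  proof -
    obtain y t where p: "p = (y, t)" by force
    obtain u v where h: "h = (u, v)" by force
    have yt: "\<bar>y\<bar> < L" "\<bar>t\<bar> < K" using that p r by (auto simp: S_def)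
    have "summable (\<lambda>k. diffs (a y) k * t ^ k)" by (rule summable_diffs[OF bnd[OF ae[OF yt(1)]] yt(2)])
    from diffs_equiv[OF this] show ?thesis
      unfolding f'_def g'_def p h using bnd[OF be[OF yt(1)] yt(2)]
      by (auto intro!: sums_add sums_mult summable_sums)
  qed
  have "\<exists>g. \<forall>p\<in>S. (\<lambda>n. f n p) sums (g p) \<and> (g has_derivative g' p) (at p within S)"
  proof (rule has_derivative_series[of S f f' g' "(x, s)"])
    show "(f n has_derivative f' n p) (at p within S)" if "p \<in> S" for n p
    proof -
      obtain y t where p: "p = (y, t)" by force
      have y: "\<bar>y\<bar> < L" using that p by (auto simp: S_def)
      have "((\<lambda>x. a x n) has_derivative (\<lambda>h. h * b y n)) (at (fst p))"
        using ab[OF y, of n] p by (simp add: has_field_derivative_def mult_commute_abs)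
      from has_derivative_compose[OF has_derivative_fst[OF has_derivative_ident] this]
      have "((\<lambda>q. a (fst q) n) has_derivative (\<lambda>h. fst h * b y n)) (at p)" .
      then have "((\<lambda>q. a (fst q) n * snd q ^ n) has_derivative f' n p) (at p)"
        unfolding f'_def p by (auto intro!: derivative_eq_intros simp: algebra_simps fun_eq_iff)
      then show ?thesis unfolding f_def case_prod_beta' by (rule has_derivative_at_withinI)
    qed
    show "\<forall>\<^sub>F n in sequentially. \<forall>p\<in>S. \<forall>h. norm ((\<Sum>i<n. f' i p h) - g' p h) \<le> \<epsilon> * norm h" if "\<epsilon> > 0" for \<epsilon>
    proof -
      obtain N where N: "\<And>n. n \<ge> N \<Longrightarrow> norm (\<Sum>i. M (i + n)) < \<epsilon>"
        using suminf_exist_split[OF \<open>\<epsilon> > 0\<close> M] by auto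
      show ?thesis unfolding eventually_sequentially
      proof (intro exI[of _ N] allI impI ballI)
        fix n p h assume n: "n \<ge> N" and p: "p \<in> S"
        have "g' p h - (\<Sum>i<n. f' i p h) = (\<Sum>i. f' (i + n) p h)"
          using suminf_minus_initial_segment[of "\<lambda>k. f' k p h" n] f's[OF p, of h] by (simp add: sums_iff)
        moreover have "norm (\<Sum>i. f' (i + n) p h) \<le> (\<Sum>i. M (i + n) * norm h)"
          using f'M[OF p] M by (intro norm_suminf_le summable_mult2) (auto simp: summable_iff_shift)
        moreover have "(\<Sum>i. M (i + n) * norm h) = (\<Sum>i. M (i + n)) * norm h"
          using M by (intro suminf_mult2[symmetric]) (simp add: summable_iff_shift)
        moreover have "(\<Sum>i. M (i + n)) * norm h \<le> \<epsilon> * norm h"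
          using N[OF n] by (intro mult_right_mono) auto
        ultimately show "norm ((\<Sum>i<n. f' i p h) - g' p h) \<le> \<epsilon> * norm h"
          by (simp add: norm_minus_commute)
      qed
    qed
    show "(\<lambda>n. f n (x, s)) sums (\<Sum>n. f n (x, s))"
      unfolding f_def using bnd[OF ae[OF x] s] by (auto intro: summable_sums)
  qed (use S in auto)
  then obtain G where G: "\<And>p. p \<in> S \<Longrightarrow> (\<lambda>n. f n p) sums G p"
     "\<And>p. p \<in> S \<Longrightarrow> (G has_derivative g' p) (at p within S)" by blast
  have "(G has_derivative g' (x, s)) (at (x, s))"
    using G(2)[OF S(3)] at_within_open[OF S(3,2)] by simp
  moreover have "G p = (\<lambda>(x, s). \<Sum>k. a x k * s ^ k) p" if "p \<in> S" for p
    using G(1)[OF that] by (auto simp: sums_iff f_def case_prod_beta)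
  ultimately have "((\<lambda>(x, s). \<Sum>k. a x k * s ^ k) has_derivative g' (x, s)) (at (x, s))"
    using has_derivative_transform_within_open[of G _ _ UNIV S] S(2,3) by blast
  then show ?thesis by (simp add: g'_def)
qed

definition pow_series :: "(nat \<Rightarrow> real) \<Rightarrow> real \<Rightarrow> real" where
  "pow_series c s = (\<Sum>k. c k * s ^ k)"

text \<open>The coefficients of the solution \<open>\<Sum>k. c\<^sub>k (1 - cos \<theta>)\<^sup>k\<close> of \<open>u'' + m cot \<theta> u' + l u = 0\<close> with
  \<open>u 0 = 1\<close>, where \<open>m = n - 2\<close>, followed by their first and second derivatives in \<open>l\<close>. The fourth sequence
  dominates all three of them for \<open>\<bar>l\<bar> < L\<close>; the summand 2 absorbs the inhomogeneous terms.\<close>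

primrec radial_coeff :: "nat \<Rightarrow> real \<Rightarrow> nat \<Rightarrow> real" where
  "radial_coeff m l 0 = 1"
| "radial_coeff m l (Suc k) = (real (k * (k + m)) - l) * radial_coeff m l k / real ((k + 1) * (2 * k + m + 1))"

primrec radial_coeff_dl :: "nat \<Rightarrow> real \<Rightarrow> nat \<Rightarrow> real" where
  "radial_coeff_dl m l 0 = 0"
| "radial_coeff_dl m l (Suc k) = ((real (k * (k + m)) - l) * radial_coeff_dl m l k - radial_coeff m l k) / real ((k + 1) * (2 * k + m + 1))"

primrec radial_coeff_dll :: "nat \<Rightarrow> real \<Rightarrow> nat \<Rightarrow> real" where
  "radial_coeff_dll m l 0 = 0"
| "radial_coeff_dll m l (Suc k) = ((real (k * (k + m)) - l) * radial_coeff_dll m l k - 2 * radial_coeff_dl m l k) / real ((k + 1) * (2 * k + m + 1))"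

primrec radial_coeff_maj :: "nat \<Rightarrow> real \<Rightarrow> nat \<Rightarrow> real" where
  "radial_coeff_maj m L 0 = 1"
| "radial_coeff_maj m L (Suc k) = (real (k * (k + m)) + L + 2) * radial_coeff_maj m L k / real ((k + 1) * (2 * k + m + 1))"

lemma radial_coeff_deriv: "((\<lambda>l. radial_coeff m l k) has_real_derivative radial_coeff_dl m l k) (at l)"
  by (induction k) (auto intro!: derivative_eq_intros simp del: of_nat_mult of_nat_add)

lemma radial_coeff_dl_deriv: "((\<lambda>l. radial_coeff_dl m l k) has_real_derivative radial_coeff_dll m l k) (at l)"
  by (induction k) (auto intro!: derivative_eq_intros radial_coeff_deriv simp del: of_nat_mult of_nat_add)

lemma radial_coeff_maj_bounds:
  assumes "\<bar>l\<bar> < L"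
  shows "0 \<le> radial_coeff_maj m L k \<and> \<bar>radial_coeff m l k\<bar> \<le> radial_coeff_maj m L k \<and> \<bar>radial_coeff_dl m l k\<bar> \<le> radial_coeff_maj m L k \<and> \<bar>radial_coeff_dll m l k\<bar> \<le> radial_coeff_maj m L k"
proof (induction k)
  case (Suc k)
  define c where "c = real (k * (k + m))"
  define d where "d = real ((k + 1) * (2 * k + m + 1))"
  have d: "d > 0" unfolding d_def by (simp del: of_nat_mult)
  have c: "c \<ge> 0" by (simp add: c_def)
  have cl: "\<bar>(c - l) * y\<bar> \<le> (c + L) * radial_coeff_maj m L k" if "\<bar>y\<bar> \<le> radial_coeff_maj m L k" for y
    unfolding abs_mult using that c assms by (intro mult_mono) auto
  have 1: "\<bar>(c - l) * radial_coeff m l k\<bar> \<le> (c + L + 2) * radial_coeff_maj m L k"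
    and 2: "\<bar>(c - l) * radial_coeff_dl m l k - radial_coeff m l k\<bar> \<le> (c + L + 2) * radial_coeff_maj m L k"
    and 3: "\<bar>(c - l) * radial_coeff_dll m l k - 2 * radial_coeff_dl m l k\<bar> \<le> (c + L + 2) * radial_coeff_maj m L k"
    using cl[of "radial_coeff m l k"] cl[of "radial_coeff_dl m l k"] cl[of "radial_coeff_dll m l k"] Suc by (auto simp: distrib_right)
  have "0 \<le> (c + L + 2) * radial_coeff_maj m L k" using 1 by linarith
  then show ?case
    using 1 2 3 d unfolding radial_coeff.simps radial_coeff_dl.simps radial_coeff_dll.simps radial_coeff_maj.simps c_def[symmetric] d_def[symmetric] abs_divide
    by (auto simp: abs_of_pos intro!: divide_right_mono)
qed (simp add: assms)

lemma radial_coeff_maj_summable: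
  assumes "\<bar>s\<bar> < 2" "0 \<le> L"
  shows "summable (\<lambda>k. radial_coeff_maj m L k * s ^ k)"
proof -
  define q where "q k = (real (k * (k + m)) + L + 2) / real ((k + 1) * (2 * k + m + 1))" for k
  have q0: "q k \<ge> 0" for k using assms by (simp add: q_def)
  \<comment> \<open>The ratio of consecutive coefficients tends to 1/2, so the radius of convergence
    is 2, which corresponds to \<theta> = pi. The ratio used for the test is midway between |s| / 2
    and 1.\<close>
  have "q \<longlonglongrightarrow> 1 / 2" unfolding q_def of_nat_mult of_nat_add by real_asymp
  then have "(\<lambda>k. q k * \<bar>s\<bar>) \<longlonglongrightarrow> 1 / 2 * \<bar>s\<bar>" by (intro tendsto_mult tendsto_const)
  moreover have "1 / 2 * \<bar>s\<bar> < (1 + \<bar>s\<bar> / 2) / 2" using assms by simp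
  ultimately have "\<forall>\<^sub>F k in sequentially. q k * \<bar>s\<bar> < (1 + \<bar>s\<bar> / 2) / 2" by (rule order_tendstoD)
  then obtain N where N: "\<And>k. k \<ge> N \<Longrightarrow> q k * \<bar>s\<bar> < (1 + \<bar>s\<bar> / 2) / 2"
    unfolding eventually_sequentially by blast
  show ?thesis
  proof (rule summable_ratio_test[of "(1 + \<bar>s\<bar> / 2) / 2" N])
    show "(1 + \<bar>s\<bar> / 2) / 2 < 1" using assms by simp
    fix k assume k: "k \<ge> N"
    have "norm (radial_coeff_maj m L (Suc k) * s ^ Suc k) = (q k * \<bar>s\<bar>) * norm (radial_coeff_maj m L k * s ^ k)"
    proof -
      have "radial_coeff_maj m L (Suc k) = q k * radial_coeff_maj m L k" by (simp add: q_def del: of_nat_mult of_nat_add)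
      then show ?thesis using q0[of k] by (simp add: abs_mult mult_ac del: radial_coeff_maj.simps)
    qed
    also have "\<dots> \<le> (1 + \<bar>s\<bar> / 2) / 2 * norm (radial_coeff_maj m L k * s ^ k)"
      using N[OF k] by (intro mult_right_mono) auto
    finally show "norm (radial_coeff_maj m L (Suc k) * s ^ Suc k) \<le> (1 + \<bar>s\<bar> / 2) / 2 * norm (radial_coeff_maj m L k * s ^ k)" .
  qed
qed

lemma radial_coeff_summable:
  assumes "\<bar>s\<bar> < 2"
  shows "summable (\<lambda>k. radial_coeff m l k * s ^ k)" "summable (\<lambda>k. radial_coeff_dl m l k * s ^ k)" "summable (\<lambda>k. radial_coeff_dll m l k * s ^ k)"
proof -
  have "summable (\<lambda>k. c k * s ^ k)" if "\<And>k. \<bar>c k\<bar> \<le> radial_coeff_maj m (\<bar>l\<bar> + 1) k" for c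
  proof (rule summable_comparison_test)
    show "summable (\<lambda>k. radial_coeff_maj m (\<bar>l\<bar> + 1) k * \<bar>s\<bar> ^ k)" using assms by (intro radial_coeff_maj_summable) auto
    show "\<exists>N. \<forall>n\<ge>N. norm (c n * s ^ n) \<le> radial_coeff_maj m (\<bar>l\<bar> + 1) n * \<bar>s\<bar> ^ n"
      using that by (auto simp: abs_mult power_abs intro!: mult_right_mono)
  qed
  moreover have "\<bar>radial_coeff m l k\<bar> \<le> radial_coeff_maj m (\<bar>l\<bar> + 1) k" "\<bar>radial_coeff_dl m l k\<bar> \<le> radial_coeff_maj m (\<bar>l\<bar> + 1) k" "\<bar>radial_coeff_dll m l k\<bar> \<le> radial_coeff_maj m (\<bar>l\<bar> + 1) k" for k
    using radial_coeff_maj_bounds[of l "\<bar>l\<bar> + 1" m k] by auto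
  ultimately show "summable (\<lambda>k. radial_coeff m l k * s ^ k)" "summable (\<lambda>k. radial_coeff_dl m l k * s ^ k)" "summable (\<lambda>k. radial_coeff_dll m l k * s ^ k)"
    by blast+
qed

lemma pow_series_deriv:
  assumes "\<And>s. \<bar>s\<bar> < 2 \<Longrightarrow> summable (\<lambda>k. c k * s ^ k)" "\<bar>s\<bar> < 2"
  shows "(pow_series c has_real_derivative pow_series (diffs c) s) (at s)"
  unfolding pow_series_def[abs_def] using termdiffs_strong'[of 2 c s] assms by simp

lemma pow_series_ode:
  fixes c g :: "nat \<Rightarrow> real" and m :: nat
  assumes rec: "\<And>k. c (Suc k) = ((real (k * (k + m)) - l) * c k - g k) / real ((k + 1) * (2 * k + m + 1))"
    and c: "\<And>s. \<bar>s\<bar> < 2 \<Longrightarrow> summable (\<lambda>k. c k * s ^ k)"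
    and g: "\<And>s. \<bar>s\<bar> < 2 \<Longrightarrow> summable (\<lambda>k. g k * s ^ k)" and s: "\<bar>s\<bar> < 2"
  shows "s * (2 - s) * pow_series (diffs (diffs c)) s + real (m + 1) * (1 - s) * pow_series (diffs c) s
      + l * pow_series c s + pow_series g s = 0"
  unfolding pow_series_def
proof (rule power_series_ode)
  show "real ((k + 1) * (2 * k + m + 1)) * c (Suc k) = (real (k * (k + m)) - l) * c k - g k" for k
    using rec[of k] by (simp del: of_nat_mult of_nat_add)
qed (use c g s in auto)

text \<open>As \<open>1 - cos \<theta>\<close> is even and smooth, these functions pass regularly
  through the pole. Hence the lemmas on them ask for |\<theta>| < pi, and values at 0 are
  available.\<close>

definition colat_series :: "(nat \<Rightarrow> real) \<Rightarrow> real \<Rightarrow> real" where "colat_series c \<theta> = pow_series c (1 - cos \<theta>)"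
definition colat_series' :: "(nat \<Rightarrow> real) \<Rightarrow> real \<Rightarrow> real" where "colat_series' c \<theta> = sin \<theta> * pow_series (diffs c) (1 - cos \<theta>)"

lemma cos_gt_minus_one: "\<bar>\<theta>\<bar> < pi \<Longrightarrow> - 1 < cos \<theta>"
  using cos_monotone_0_pi[of "\<bar>\<theta>\<bar>" pi] by simp

lemma one_minus_cos_less_2: "\<bar>\<theta>\<bar> < pi \<Longrightarrow> \<bar>1 - cos \<theta>\<bar> < 2"
  using cos_gt_minus_one[of \<theta>] cos_le_one[of \<theta>] by linarith

lemma colat_series_deriv:
  assumes c: "\<And>s. \<bar>s\<bar> < 2 \<Longrightarrow> summable (\<lambda>k. c k * s ^ k)" and \<theta>: "\<bar>\<theta>\<bar> < pi"
  shows "(colat_series c has_real_derivative colat_series' c \<theta>) (at \<theta>)"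
    and "(colat_series' c has_real_derivative sin \<theta> ^ 2 * pow_series (diffs (diffs c)) (1 - cos \<theta>) + cos \<theta> * pow_series (diffs c) (1 - cos \<theta>)) (at \<theta>)"
proof -
  have s: "\<bar>1 - cos \<theta>\<bar> < 2" using \<theta> by (rule one_minus_cos_less_2)
  have 0: "((\<lambda>\<theta>. 1 - cos \<theta>) has_real_derivative sin \<theta>) (at \<theta>)" by (auto intro!: derivative_eq_intros)
  have cd: "\<And>s. \<bar>s\<bar> < 2 \<Longrightarrow> summable (\<lambda>k. diffs c k * s ^ k)" using summable_diffs[OF c] .
  note 1 = DERIV_chain2[OF pow_series_deriv[OF c s] 0]
  note 2 = DERIV_chain2[OF pow_series_deriv[OF cd s] 0]
  show "(colat_series c has_real_derivative colat_series' c \<theta>) (at \<theta>)"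
    unfolding colat_series_def[abs_def] colat_series'_def using 1 by (simp add: mult.commute)
  show "(colat_series' c has_real_derivative sin \<theta> ^ 2 * pow_series (diffs (diffs c)) (1 - cos \<theta>) + cos \<theta> * pow_series (diffs c) (1 - cos \<theta>)) (at \<theta>)"
    using DERIV_mult[OF DERIV_sin 2] unfolding colat_series'_def[abs_def] by (simp add: power2_eq_square algebra_simps)
qed

lemma colat_series'_deriv:
  fixes m :: nat
  assumes rec: "\<And>k. c (Suc k) = ((real (k * (k + m)) - l) * c k - g k) / real ((k + 1) * (2 * k + m + 1))"
    and c: "\<And>s. \<bar>s\<bar> < 2 \<Longrightarrow> summable (\<lambda>k. c k * s ^ k)"
    and g: "\<And>s. \<bar>s\<bar> < 2 \<Longrightarrow> summable (\<lambda>k. g k * s ^ k)" and \<theta>: "0 < \<theta>" "\<theta> < pi"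
  shows "(colat_series' c has_real_derivative - (real m * cos \<theta> / sin \<theta> * colat_series' c \<theta>) - l * colat_series c \<theta> - colat_series g \<theta>) (at \<theta>)"
proof -
  have \<theta>': "\<bar>\<theta>\<bar> < pi" using \<theta> by simp
  have s: "sin \<theta> > 0" using \<theta> by (rule sin_gt_zero)
  have e: "sin \<theta> ^ 2 = (1 - cos \<theta>) * (2 - (1 - cos \<theta>))" by (simp add: sin_squared_eq algebra_simps power2_eq_square)
  have "sin \<theta> ^ 2 * pow_series (diffs (diffs c)) (1 - cos \<theta>) + cos \<theta> * pow_series (diffs c) (1 - cos \<theta>)
     = - (real m * cos \<theta> / sin \<theta> * colat_series' c \<theta>) - l * colat_series c \<theta> - colat_series g \<theta>"
    using pow_series_ode[OF rec c g one_minus_cos_less_2[OF \<theta>']] s unfolding e colat_series_def colat_series'_def by (simp add: algebra_simps)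
  with colat_series_deriv(2)[OF c \<theta>'] show ?thesis by simp
qed

definition "radial m l = colat_series (radial_coeff m l)"
definition "radial' m l = colat_series' (radial_coeff m l)"
definition "radial_dl m l = colat_series (radial_coeff_dl m l)"
definition "radial_dl' m l = colat_series' (radial_coeff_dl m l)"
definition "radial_dll m l = colat_series (radial_coeff_dll m l)"
definition "radial_dll' m l = colat_series' (radial_coeff_dll m l)"

lemma radial_deriv:
  assumes "\<bar>\<theta>\<bar> < pi"
  shows "(radial m l has_real_derivative radial' m l \<theta>) (at \<theta>)" "(radial_dl m l has_real_derivative radial_dl' m l \<theta>) (at \<theta>)" "(radial_dll m l has_real_derivative radial_dll' m l \<theta>) (at \<theta>)"
  unfolding radial_def radial'_def radial_dl_def radial_dl'_def radial_dll_def radial_dll'_def by (intro colat_series_deriv radial_coeff_summable assms; assumption)+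

lemma radial'_deriv:
  assumes "0 < \<theta>" "\<theta> < pi"
  shows "(radial' m l has_real_derivative - (real m * cos \<theta> / sin \<theta> * radial' m l \<theta>) - l * radial m l \<theta>) (at \<theta>)"
    "(radial_dl' m l has_real_derivative - (real m * cos \<theta> / sin \<theta> * radial_dl' m l \<theta>) - l * radial_dl m l \<theta> - radial m l \<theta>) (at \<theta>)"
    "(radial_dll' m l has_real_derivative - (real m * cos \<theta> / sin \<theta> * radial_dll' m l \<theta>) - l * radial_dll m l \<theta> - 2 * radial_dl m l \<theta>) (at \<theta>)"
proof -
  have "colat_series (\<lambda>k. 0) \<theta> = 0" by (simp add: colat_series_def pow_series_def)
  then show "(radial' m l has_real_derivative - (real m * cos \<theta> / sin \<theta> * radial' m l \<theta>) - l * radial m l \<theta>) (at \<theta>)"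
    unfolding radial_def radial'_def using colat_series'_deriv[of "radial_coeff m l" m l "\<lambda>k. 0" \<theta>, OF _ radial_coeff_summable(1) _ assms] by simp
  show "(radial_dl' m l has_real_derivative - (real m * cos \<theta> / sin \<theta> * radial_dl' m l \<theta>) - l * radial_dl m l \<theta> - radial m l \<theta>) (at \<theta>)"
    unfolding radial_def radial_dl_def radial_dl'_def using colat_series'_deriv[of "radial_coeff_dl m l" m l "radial_coeff m l" \<theta>, OF _ radial_coeff_summable(2) radial_coeff_summable(1) assms] by simp
  have "colat_series (\<lambda>k. 2 * radial_coeff_dl m l k) \<theta> = 2 * colat_series (radial_coeff_dl m l) \<theta>"
    unfolding colat_series_def pow_series_def using suminf_mult[OF radial_coeff_summable(2), of "1 - cos \<theta>" 2 m l] one_minus_cos_less_2[of \<theta>] assms by (simp add: mult.assoc)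
  moreover have "summable (\<lambda>k. 2 * radial_coeff_dl m l k * s ^ k)" if "\<bar>s\<bar> < 2" for s
    using summable_mult[OF radial_coeff_summable(2)[OF that], of 2 m l] by (simp add: mult.assoc)
  ultimately
  show "(radial_dll' m l has_real_derivative - (real m * cos \<theta> / sin \<theta> * radial_dll' m l \<theta>) - l * radial_dll m l \<theta> - 2 * radial_dl m l \<theta>) (at \<theta>)"
    unfolding radial_dll_def radial_dl_def radial_dll'_def using colat_series'_deriv[of "radial_coeff_dll m l" m l "\<lambda>k. 2 * radial_coeff_dl m l k" \<theta>, OF _ radial_coeff_summable(3) _ assms] by simp
qed

lemma colat_series_joint:
  fixes a b :: "real \<Rightarrow> nat \<Rightarrow> real" and e :: "nat \<Rightarrow> real"
  assumes ab: "\<And>x k. \<bar>x\<bar> < L \<Longrightarrow> ((\<lambda>x. a x k) has_real_derivative b x k) (at x)"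
    and ae: "\<And>x k. \<bar>x\<bar> < L \<Longrightarrow> \<bar>a x k\<bar> \<le> e k"
    and be: "\<And>x k. \<bar>x\<bar> < L \<Longrightarrow> \<bar>b x k\<bar> \<le> e k"
    and e: "\<And>s. \<bar>s\<bar> < 2 \<Longrightarrow> summable (\<lambda>k. e k * s ^ k)"
    and x: "\<bar>x\<bar> < L" and \<theta>: "\<bar>\<theta>\<bar> < pi"
  shows "((\<lambda>p. colat_series (a (fst p)) (snd p)) has_derivative
     (\<lambda>h. fst h * colat_series (b x) \<theta> + snd h * colat_series' (a x) \<theta>)) (at (x, \<theta>))"
proof -
  have 0: "((\<lambda>p. (fst p, 1 - cos (snd p))) has_derivative (\<lambda>h. (fst h, snd h * sin \<theta>))) (at (x, \<theta>))"
    by (auto intro!: derivative_eq_intros)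
  note power_series_joint_derivative[OF ab ae be e x one_minus_cos_less_2[OF \<theta>]]
  then have "((\<lambda>(x, s). \<Sum>k. a x k * s ^ k) has_derivative
     (\<lambda>(h, j). h * pow_series (b x) (1 - cos \<theta>) + j * pow_series (diffs (a x)) (1 - cos \<theta>))) (at (fst (x, \<theta>), 1 - cos (snd (x, \<theta>))))"
    by (simp add: pow_series_def)
  from has_derivative_compose[OF 0 this] show ?thesis
    by (simp add: colat_series_def colat_series'_def pow_series_def[abs_def] mult_ac)
qed

lemma radial_joint_deriv:
  assumes \<theta>: "\<bar>\<theta>\<bar> < pi"
  shows "((\<lambda>p. radial m (fst p) (snd p)) has_derivative (\<lambda>h. fst h * radial_dl m l \<theta> + snd h * radial' m l \<theta>)) (at (l, \<theta>))"
    "((\<lambda>p. radial_dl m (fst p) (snd p)) has_derivative (\<lambda>h. fst h * radial_dll m l \<theta> + snd h * radial_dl' m l \<theta>)) (at (l, \<theta>))"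
proof -
  define L where "L = \<bar>l\<bar> + 1"
  have L: "\<bar>l\<bar> < L" "0 \<le> L" by (auto simp: L_def)
  show "((\<lambda>p. radial m (fst p) (snd p)) has_derivative (\<lambda>h. fst h * radial_dl m l \<theta> + snd h * radial' m l \<theta>)) (at (l, \<theta>))"
    unfolding radial_def radial'_def radial_dl_def
    by (rule colat_series_joint[OF radial_coeff_deriv _ _ radial_coeff_maj_summable[OF _ L(2)] L(1) \<theta>]) (use radial_coeff_maj_bounds[of _ L m] in auto)
  show "((\<lambda>p. radial_dl m (fst p) (snd p)) has_derivative (\<lambda>h. fst h * radial_dll m l \<theta> + snd h * radial_dl' m l \<theta>)) (at (l, \<theta>))"
    unfolding radial_dl_def radial_dl'_def radial_dll_def
    by (rule colat_series_joint[OF radial_coeff_dl_deriv _ _ radial_coeff_maj_summable[OF _ L(2)] L(1) \<theta>]) (use radial_coeff_maj_bounds[of _ L m] in auto)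
qed

text \<open>\<open>radial'\<close> is \<open>sin \<theta>\<close> times a series with differentiated
  coefficients, to which the joint lemma applies. Away from the pole the \<theta>-derivative can
  then be read off from the radial equation.\<close>

lemma radial'_joint_deriv:
  assumes \<theta>: "0 < \<theta>" "\<theta> < pi"
  shows "((\<lambda>p. radial' m (fst p) (snd p)) has_derivative
    (\<lambda>h. fst h * radial_dl' m l \<theta> + snd h * (- (real m * cos \<theta> / sin \<theta> * radial' m l \<theta>) - l * radial m l \<theta>))) (at (l, \<theta>))"
proof -
  define L where "L = \<bar>l\<bar> + 1"
  have L: "\<bar>l\<bar> < L" "0 \<le> L" by (auto simp: L_def)
  have \<theta>': "\<bar>\<theta>\<bar> < pi" using \<theta> by simp
  have "((\<lambda>p. colat_series (diffs (radial_coeff m (fst p))) (snd p)) has_derivative (\<lambda>h. fst h * colat_series (diffs (radial_coeff_dl m l)) \<theta> + snd h * colat_series' (diffs (radial_coeff m l)) \<theta>)) (at (l, \<theta>))"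
  proof (rule colat_series_joint[where a = "\<lambda>x. diffs (radial_coeff m x)" and b = "\<lambda>x. diffs (radial_coeff_dl m x)" and e = "diffs (radial_coeff_maj m L)", OF _ _ _ summable_diffs[OF radial_coeff_maj_summable[OF _ L(2)]] L(1) \<theta>'])
    show "((\<lambda>x. diffs (radial_coeff m x) k) has_real_derivative diffs (radial_coeff_dl m x) k) (at x)" for x k
      unfolding diffs_def by (intro DERIV_cmult radial_coeff_deriv)
    show "\<bar>diffs (radial_coeff m x) k\<bar> \<le> diffs (radial_coeff_maj m L) k" "\<bar>diffs (radial_coeff_dl m x) k\<bar> \<le> diffs (radial_coeff_maj m L) k" if "\<bar>x\<bar> < L" for x k
      unfolding diffs_def abs_mult using radial_coeff_maj_bounds[OF that, of m "Suc k"] by (auto intro!: mult_left_mono simp del: radial_coeff.simps radial_coeff_dl.simps radial_coeff_maj.simps)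
  qed auto
  then have "((\<lambda>p. sin (snd p) * colat_series (diffs (radial_coeff m (fst p))) (snd p)) has_derivative
     (\<lambda>h. fst h * (sin \<theta> * colat_series (diffs (radial_coeff_dl m l)) \<theta>) + snd h * (sin \<theta> * colat_series' (diffs (radial_coeff m l)) \<theta> + cos \<theta> * colat_series (diffs (radial_coeff m l)) \<theta>))) (at (l, \<theta>))"
    by (auto intro!: derivative_eq_intros simp: algebra_simps)
  moreover have "sin \<theta> * colat_series' (diffs (radial_coeff m l)) \<theta> + cos \<theta> * colat_series (diffs (radial_coeff m l)) \<theta> = - (real m * cos \<theta> / sin \<theta> * radial' m l \<theta>) - l * radial m l \<theta>"
    using DERIV_unique[OF radial'_deriv(1)[OF \<theta>, of m l] colat_series_deriv(2)[OF radial_coeff_summable(1) \<theta>', folded radial'_def]] by (simp add: colat_series'_def colat_series_def power2_eq_square)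
  ultimately show ?thesis unfolding radial'_def radial_dl'_def colat_series'_def colat_series_def by simp
qed

lemma radial_values_0: "radial m l 0 = 1" "radial' m l 0 = 0" "radial_dl m l 0 = 0" "radial_dl' m l 0 = 0" "radial_dll m l 0 = 0" "radial_dll' m l 0 = 0"
  by (simp_all add: radial_def radial'_def radial_dl_def radial_dl'_def radial_dll_def radial_dll'_def colat_series_def colat_series'_def pow_series_def)

lemma radial_eigenvalue_0: "radial m 0 \<theta> = 1"
proof -
  have "radial_coeff m 0 k = (if k = 0 then 1 else 0)" for k
  proof (induction k)
    case (Suc k) then show ?case by (cases k) auto
  qed auto
  then have "radial_coeff m 0 = (\<lambda>k. if k = 0 then 1 else 0)" by auto
  moreover have "(\<Sum>k. (if k = 0 then 1 else 0) * (1 - cos \<theta>) ^ k) = (1::real)"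
    by (subst suminf_finite[of "{0}"]) auto
  ultimately show ?thesis by (simp add: radial_def colat_series_def pow_series_def)
qed

subsection \<open>The first zero as a function of the eigenvalue\<close>

lemma isCont_radial:
  assumes "\<bar>\<theta>\<bar> < pi"
  shows "isCont (radial m l) \<theta>" "isCont (radial_dl m l) \<theta>" "isCont (radial_dll m l) \<theta>" "isCont (radial' m l) \<theta>" "isCont (radial_dl' m l) \<theta>" "isCont (radial_dll' m l) \<theta>"
  using radial_deriv[OF assms] colat_series_deriv(2)[OF radial_coeff_summable(1) assms] colat_series_deriv(2)[OF radial_coeff_summable(2) assms] colat_series_deriv(2)[OF radial_coeff_summable(3) assms]
  unfolding radial'_def radial_dl'_def radial_dll'_def by (blast intro: DERIV_isCont)+

lemma continuous_radial_comp [continuous_intros]: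
  assumes "continuous (at x within S) f" "\<bar>f x\<bar> < pi"
  shows "continuous (at x within S) (\<lambda>x. radial m l (f x))" "continuous (at x within S) (\<lambda>x. radial_dl m l (f x))"
    "continuous (at x within S) (\<lambda>x. radial_dll m l (f x))" "continuous (at x within S) (\<lambda>x. radial' m l (f x))"
    "continuous (at x within S) (\<lambda>x. radial_dl' m l (f x))" "continuous (at x within S) (\<lambda>x. radial_dll' m l (f x))"
  using isCont_radial[OF assms(2)] by (auto intro!: continuous_within_compose3[OF _ assms(1)])

lemma isCont_radial_joint:
  assumes "\<bar>\<theta>\<bar> < pi"
  shows "isCont (\<lambda>p. radial m (fst p) (snd p)) (l, \<theta>)" "isCont (\<lambda>p. radial_dl m (fst p) (snd p)) (l, \<theta>)"
  using radial_joint_deriv[OF assms] by (blast intro: has_derivative_continuous)+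

text \<open>The radial equation in divergence form: the weight \<open>sin ^ m\<close> absorbs the
  first-order term, and comparison arguments become monotonicity of a weighted flux or
  Wronskian.\<close>

lemma sin_power_radial'_deriv:
  assumes "0 < \<theta>" "\<theta> < pi"
  shows "((\<lambda>x. sin x ^ m * radial' m l x) has_real_derivative - l * (sin \<theta> ^ m * radial m l \<theta>)) (at \<theta>)"
proof -
  have s: "sin \<theta> > 0" using assms by (rule sin_gt_zero)
  have *: "real m * sin \<theta> ^ (m - Suc 0) = real m * (sin \<theta> ^ m / sin \<theta>)" using s by (cases m) auto
  have "((\<lambda>x. sin x ^ m * radial' m l x) has_real_derivative
    sin \<theta> ^ m * (- (real m * cos \<theta> / sin \<theta> * radial' m l \<theta>) - l * radial m l \<theta>) + (real m * sin \<theta> ^ (m - Suc 0)) * cos \<theta> * radial' m l \<theta>) (at \<theta>)"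
    by (auto intro!: derivative_eq_intros radial'_deriv assms)
  then show ?thesis unfolding * using s by (simp add: field_simps)
qed

text \<open>The flux \<open>sin ^ m * radial'\<close> is 0 at the pole and strictly decreases as
  long as the solution is positive.\<close>

lemma radial'_negative:
  assumes l: "0 < l" and t: "0 < t" "t < pi" and pos: "\<And>x. 0 < x \<Longrightarrow> x < t \<Longrightarrow> 0 < radial m l x"
  shows "radial' m l t < 0"
proof -
  have "sin t ^ m * radial' m l t < sin 0 ^ m * radial' m l 0"
  proof (rule DERIV_neg_imp_decreasing_open[OF t(1), of "\<lambda>x. sin x ^ m * radial' m l x"])
    fix x assume x: "0 < x" "x < t"
    then have "0 < sin x" using t by (intro sin_gt_zero) auto
    then have "- l * (sin x ^ m * radial m l x) < 0" using l pos[OF x] by simp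
    then show "\<exists>y. ((\<lambda>x. sin x ^ m * radial' m l x) has_real_derivative y) (at x) \<and> y < 0"
      using sin_power_radial'_deriv[of x m l] x t by auto
  next
    show "continuous_on {0..t} (\<lambda>x. sin x ^ m * radial' m l x)"
      unfolding continuous_on_eq_continuous_within using t by (auto intro!: continuous_intros)
  qed
  moreover have "0 < sin t ^ m" using t by (intro zero_less_power sin_gt_zero)
  ultimately show ?thesis
    using mult_less_cancel_left_pos[of "sin t ^ m" "radial' m l t" 0] by (simp add: radial_values_0)
qed

definition first_zero :: "nat \<Rightarrow> real \<Rightarrow> real \<Rightarrow> bool" where
  "first_zero m l t \<longleftrightarrow> 0 < t \<and> t < pi \<and> radial m l t = 0 \<and> (\<forall>x. 0 \<le> x \<longrightarrow> x < t \<longrightarrow> 0 < radial m l x)"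

text \<open>The witness is the infimum of the points with nonpositive value. A negative value there
  would force an earlier zero by the intermediate value theorem.\<close>

lemma first_zero_exists:
  assumes "0 \<le> x" "x < pi" "radial m l x \<le> 0"
  shows "\<exists>t\<le>x. first_zero m l t"
proof -
  define Z where "Z = {0..x} \<inter> radial m l -` {..0}"
  have "closed Z" unfolding Z_def
    by (rule continuous_closed_preimage) (use assms in \<open>auto simp: continuous_on_eq_continuous_within intro!: continuous_intros\<close>)
  moreover have Z: "x \<in> Z" "bdd_below Z" using assms by (auto simp: Z_def)
  ultimately have "Inf Z \<in> Z" using closed_contains_Inf by blast
  moreover define t where "t = Inf Z"
  ultimately have t: "0 \<le> t" "t \<le> x" "radial m l t \<le> 0" by (auto simp: Z_def)
  have pos: "0 < radial m l y" if "0 \<le> y" "y < t" for y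
  proof (rule ccontr)
    assume "\<not> 0 < radial m l y"
    then have "y \<in> Z" using that t by (auto simp: Z_def)
    then show False using cInf_lower[OF _ Z(2)] that t_def by force
  qed
  have "t \<noteq> 0" using t radial_values_0(1)[of m l] by auto
  moreover have "radial m l t = 0"
  proof (rule ccontr)
    assume "radial m l t \<noteq> 0"
    then have "radial m l t < 0" using t by simp
    moreover have "continuous_on {0..t} (radial m l)" using t assms
      by (auto simp: continuous_on_eq_continuous_within intro!: continuous_intros)
    ultimately obtain y where "0 \<le> y" "y \<le> t" "radial m l y = 0"
      using IVT2'[of "radial m l" t 0 0] t radial_values_0(1)[of m l] by auto
    then show False using pos[of y] \<open>radial m l t < 0\<close> by (cases "y = t") auto
  qed
  ultimately show ?thesis using t assms pos by (intro exI[of _ t]) (auto simp: first_zero_def)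
qed

text \<open>The weighted Wronskian \<open>W\<close> of the two solutions starts at 0 and strictly
  decreases while both are positive. At t, however, it is minus \<open>radial m k t\<close> times
  the negative flux of the first solution, hence nonnegative.\<close>

lemma sturm_comparison:
  assumes fz: "first_zero m l t" and l: "0 < l" "l < k"
    and pos: "\<And>x. 0 < x \<Longrightarrow> x < t \<Longrightarrow> 0 < radial m k x"
  shows False
proof -
  have t: "0 < t" "t < pi" "radial m l t = 0" "\<And>x. 0 \<le> x \<Longrightarrow> x < t \<Longrightarrow> 0 < radial m l x"
    using fz by (auto simp: first_zero_def)
  have st: "0 < sin t ^ m" using t by (intro zero_less_power sin_gt_zero)
  define W where "W x = radial m l x * (sin x ^ m * radial' m k x) - radial m k x * (sin x ^ m * radial' m l x)" for x
  have "W t < W 0"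
  proof (rule DERIV_neg_imp_decreasing_open[OF t(1), of W])
    fix x assume x: "0 < x" "x < t"
    have s: "0 < sin x" using x t by (intro sin_gt_zero) auto
    have xp: "0 < x" "x < pi" "\<bar>x\<bar> < pi" using x t by auto
    have "(W has_real_derivative (l - k) * (sin x ^ m * radial m l x * radial m k x)) (at x)"
      unfolding W_def[abs_def]
      by (rule DERIV_cong[OF DERIV_diff[OF DERIV_mult[OF radial_deriv(1)[OF xp(3)] sin_power_radial'_deriv[OF xp(1,2)]]
              DERIV_mult[OF radial_deriv(1)[OF xp(3)] sin_power_radial'_deriv[OF xp(1,2)]]]])
        (simp add: algebra_simps)
    moreover have "(l - k) * (sin x ^ m * radial m l x * radial m k x) < 0"
      using s t(4)[of x] pos[of x] x l by (intro mult_neg_pos) auto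
    ultimately show "\<exists>y. (W has_real_derivative y) (at x) \<and> y < 0" by blast
  next
    show "continuous_on {0..t} W" unfolding W_def
      unfolding continuous_on_eq_continuous_within using t by (auto intro!: continuous_intros)
  qed
  moreover have "W 0 = 0" by (simp add: W_def radial_values_0)
  moreover have "radial m k t \<ge> 0"
  proof (rule ccontr)
    assume "\<not> radial m k t \<ge> 0"
    then obtain x where "x \<le> t" "first_zero m k x" using first_zero_exists[of t m k] t by auto
    then show False using pos[of x] \<open>\<not> radial m k t \<ge> 0\<close> unfolding first_zero_def by (cases "x = t") auto
  qed
  moreover have "radial' m l t < 0" using radial'_negative[OF l(1) t(1,2)] t(4) by simp
  ultimately show False
    using mult_nonneg_nonpos[of "radial m k t" "sin t ^ m * radial' m l t"] mult_pos_neg[OF st, of "radial' m l t"] t(3)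
    by (simp add: W_def radial_values_0)
qed

text \<open>Joint continuity extends positivity from the compact segment over [0, t] at parameter l
  to a neighbourhood of it; the same \<open>d\<close> serves for the parameter and for the end
  point.\<close>

lemma radial_positive_stable:
  assumes t: "0 < t" "t < pi" and pos: "\<And>x. 0 \<le> x \<Longrightarrow> x \<le> t \<Longrightarrow> 0 < radial m l x"
  shows "\<exists>d>0. t + d < pi \<and> (\<forall>k x. \<bar>k - l\<bar> \<le> d \<longrightarrow> 0 \<le> x \<longrightarrow> x \<le> t + d \<longrightarrow> 0 < radial m k x)"
proof -
  define f where "f p = radial m (fst p) (snd p)" for p
  define Q where "Q = (UNIV :: real set) \<times> {-pi<..<pi}"
  have "open Q" unfolding Q_def by (intro open_Times) auto
  have "continuous_on Q f"
    unfolding continuous_on_eq_continuous_at[OF \<open>open Q\<close>] f_def[abs_def] using isCont_radial_joint(1) by (auto simp: Q_def)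
  then have "open (Q \<inter> f -` {0<..})" using \<open>open Q\<close> by (intro continuous_open_preimage) auto
  moreover have "{l} \<times> {0..t} \<subseteq> Q \<inter> f -` {0<..}" using t pos by (auto simp: Q_def f_def)
  moreover have "compact ({l} \<times> {0..t})" by (intro compact_Times) auto
  ultimately obtain e where e: "e > 0" "(\<Union>x\<in>{l} \<times> {0..t}. ball x e) \<subseteq> Q \<inter> f -` {0<..}"
    using compact_subset_open_imp_ball_epsilon_subset by blast
  have *: "0 < radial m k x \<and> x < pi" if "\<bar>k - l\<bar> \<le> e / 3" "0 \<le> x" "x \<le> t + e / 3" for k x
  proof -
    have "dist (l, min x t) (k, x) \<le> dist l k + dist (min x t) x"
      unfolding dist_prod_def by (simp add: sqrt_sum_squares_le_sum)
    also have "\<dots> \<le> e / 3 + e / 3" using that e by (intro add_mono) (auto simp: dist_real_def abs_minus_commute min_def)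
    also have "\<dots> < e" using e by simp
    finally have "(k, x) \<in> ball (l, min x t) e" by simp
    moreover have "(l, min x t) \<in> {l} \<times> {0..t}" using that t by auto
    ultimately have "(k, x) \<in> Q \<inter> f -` {0<..}" using e(2) by blast
    then show ?thesis by (auto simp: f_def Q_def)
  qed
  show ?thesis using e(1) *[of l "t + e / 3"] * t by (intro exI[of _ "e / 3"]) auto
qed

text \<open>Where the solution is positive it decreases, and its slope on the last third of the interval is at least a
  multiple of \<open>l\<close>.\<close>

lemma eigenvalue_upper_bound:
  assumes t: "0 < t" "t < pi"
  shows "\<exists>c>0. \<forall>l>0. (\<forall>x. 0 \<le> x \<longrightarrow> x \<le> t \<longrightarrow> 0 < radial m l x) \<longrightarrow> l * c < 1"
proof -
  define a b where "a = t / 3" and "b = 2 * t / 3"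
  have ab: "0 < a" "a < b" "b < t" using t by (auto simp: a_def b_def)
  define q where "q = min (sin a) (sin t) ^ m"
  have sat: "0 < sin a" "0 < sin t" using ab t by (auto intro!: sin_gt_zero)
  have q: "0 < q" unfolding q_def using sat by (intro zero_less_power) auto
  have sin_ge: "min (sin a) (sin t) \<le> sin x" if "a \<le> x" "x \<le> t" for x
  proof (cases "x \<le> pi / 2")
    case True
    then have "sin a \<le> sin x" using that ab by (intro sin_monotone_2pi_le) auto
    then show ?thesis by simp
  next
    case False
    then have "sin (pi - t) \<le> sin (pi - x)" using that t by (intro sin_monotone_2pi_le) auto
    then show ?thesis by simp
  qed
  \<comment> \<open>The flux at b is at most \<open>- l * q * (b - a)\<close> times the value at b,
    where q bounds the weight from below. Over the length \<open>t - b\<close> this lowers the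
    solution by at least \<open>l * c\<close> times its value at b, so positivity at t forces
    \<open>l * c < 1\<close>.\<close>
  define c where "c = q * (b - a) * (t - b)"
  have "l * c < 1" if l: "0 < l" and pos: "\<And>x. 0 \<le> x \<Longrightarrow> x \<le> t \<Longrightarrow> 0 < radial m l x" for l
  proof -
    have neg: "radial' m l x < 0" if "0 < x" "x \<le> t" for x
      using that t pos by (intro radial'_negative l) auto
    have dec: "radial m l y \<le> radial m l x" if "0 < x" "x \<le> y" "y \<le> t" for x y
    proof (rule DERIV_nonpos_imp_nonincreasing[OF that(2)])
      fix z assume "x \<le> z" "z \<le> y"
      then show "\<exists>y. (radial m l has_real_derivative y) (at z) \<and> y \<le> 0"
        using that t radial_deriv(1)[of z m l] neg[of z] by (intro exI[of _ "radial' m l z"]) auto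
    qed
    let ?g = "\<lambda>x. sin x ^ m * radial' m l x"
    have g: "(?g has_real_derivative - l * (sin x ^ m * radial m l x)) (at x)" if "0 < x" "x \<le> t" for x
      using sin_power_radial'_deriv that t by auto
    obtain z where z: "a < z" "z < b" "?g b - ?g a = (b - a) * (- l * (sin z ^ m * radial m l z))"
      using MVT2[OF ab(2), of ?g "\<lambda>x. - l * (sin x ^ m * radial m l x)"] g ab by auto
    have "q * radial m l b \<le> sin z ^ m * radial m l z"
      unfolding q_def using z ab t sat sin_ge[of z] dec[of z b] pos[of b]
      by (intro mult_mono power_mono) (auto simp: sin_ge_zero)
    then have "(b - a) * (- l * (sin z ^ m * radial m l z)) \<le> (b - a) * (- l * (q * radial m l b))"
      using mult_left_mono[of _ _ "(b - a) * l"] ab l by (simp add: mult_ac)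
    moreover have "?g a \<le> 0" using neg[of a] sat ab by (auto intro!: mult_nonneg_nonpos)
    ultimately have gb: "?g b \<le> - (l * q * (b - a) * radial m l b)" using z(3) by (simp add: algebra_simps)
    have slope: "radial' m l x \<le> - (l * q * (b - a) * radial m l b)" if x: "b < x" "x < t" for x
    proof -
      have "?g x \<le> ?g b"
      proof (rule DERIV_nonpos_imp_nonincreasing[of b x ?g])
        show "b \<le> x" using x by simp
      next
        fix y assume y: "b \<le> y" "y \<le> x"
        have "- l * (sin y ^ m * radial m l y) \<le> 0" using l pos[of y] y x ab t
          by (auto intro!: mult_nonneg_nonneg sin_ge_zero zero_le_power less_imp_le[OF pos])
        then show "\<exists>z. (?g has_real_derivative z) (at y) \<and> z \<le> 0" using g[of y] y x ab by auto
      qed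
      moreover have "radial' m l x \<le> ?g x"
      proof -
        have "sin x ^ m \<le> 1" using x ab t by (intro power_le_one) (auto intro!: sin_ge_zero)
        then have "(sin x ^ m - 1) * radial' m l x \<ge> 0" using neg[of x] x ab by (intro mult_nonpos_nonpos) auto
        then show ?thesis by (simp add: algebra_simps)
      qed
      ultimately show ?thesis using gb by linarith
    qed
    obtain z where z: "b < z" "z < t" "radial m l t - radial m l b = (t - b) * radial' m l z"
      using MVT2[OF ab(3), of "radial m l" "radial' m l"] radial_deriv(1) ab t by auto
    have "(t - b) * radial' m l z \<le> (t - b) * (- (l * q * (b - a) * radial m l b))"
      using slope[OF z(1,2)] ab by (intro mult_left_mono) auto
    then have "radial m l t \<le> radial m l b * (1 - l * c)" using z(3) by (simp add: c_def algebra_simps)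
    then have "0 < radial m l b * (1 - l * c)" using pos[of t] t by simp
    then show "l * c < 1" using pos[of b] ab by (simp add: zero_less_mult_iff)
  qed
  moreover have "c > 0" unfolding c_def using q ab by simp
  ultimately show ?thesis by blast
qed

text \<open>The eigenvalue is the supremum of the parameters whose solution stays positive on
  [0, t]. At the supremum the solution is nonnegative by continuity in the parameter, but not
  positive everywhere by stability, so it has a first zero. A zero before t would be crossed with
  negative slope.\<close>

lemma eigenvalue_exists:
  assumes t: "0 < t" "t < pi"
  shows "\<exists>l>0. first_zero m l t"
proof -
  define S where "S = {l. 0 < l \<and> (\<forall>x. 0 \<le> x \<longrightarrow> x \<le> t \<longrightarrow> 0 < radial m l x)}"
  \<comment> \<open>For l = 0 the solution is the constant 1, so by stability S contains small
    positive parameters.\<close>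
  obtain d0 where "d0 > 0" "\<forall>k x. \<bar>k - 0\<bar> \<le> d0 \<longrightarrow> 0 \<le> x \<longrightarrow> x \<le> t + d0 \<longrightarrow> 0 < radial m k x"
    using radial_positive_stable[OF t, of m 0] by (auto simp: radial_eigenvalue_0)
  then have d0: "d0 > 0" "d0 \<in> S" by (auto simp: S_def)
  obtain c where c: "c > 0" "\<And>l. l \<in> S \<Longrightarrow> l * c < 1" using eigenvalue_upper_bound[OF t, of m] by (auto simp: S_def)
  have bdd: "bdd_above S"
    using c by (intro bdd_aboveI[of _ "1 / c"]) (auto simp: field_simps less_imp_le)
  define l where "l = Sup S"
  have l: "l > 0" using d0 cSup_upper[OF d0(2) bdd] by (simp add: l_def)
  have nn: "0 \<le> radial m l x" if x: "0 \<le> x" "x \<le> t" for x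
  proof (rule ccontr)
    assume "\<not> 0 \<le> radial m l x"
    have "isCont (\<lambda>k. (k, x)) l" by (intro continuous_intros)
    from isCont_o2[OF this, of "\<lambda>p. radial m (fst p) (snd p)"] isCont_radial_joint(1)[of x l m] x t
    have "((\<lambda>k. radial m k x) \<longlongrightarrow> radial m l x) (at l)" by (simp add: isCont_def)
    then have "\<forall>\<^sub>F k in at l. radial m k x < 0" using \<open>\<not> 0 \<le> radial m l x\<close> by (intro order_tendstoD(2)) auto
    then obtain d where d: "d > 0" "\<And>k. k \<noteq> l \<Longrightarrow> dist k l < d \<Longrightarrow> radial m k x < 0" unfolding eventually_at by auto
    have "\<exists>k\<in>S. l - d < k" using d(1) d0(2) less_cSup_iff[of S "l - d"] bdd by (auto simp: l_def)
    then obtain k where k: "k \<in> S" "l - d < k" by blast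
    have "k \<le> l" unfolding l_def using k(1) bdd by (rule cSup_upper)
    with d(2)[of k] k x \<open>\<not> 0 \<le> radial m l x\<close> show False by (cases "k = l") (auto simp: S_def dist_real_def not_less)
  qed
  have "\<exists>x. 0 \<le> x \<and> x \<le> t \<and> radial m l x \<le> 0"
  proof (rule ccontr)
    assume "\<not> ?thesis"
    then have "\<And>x. 0 \<le> x \<Longrightarrow> x \<le> t \<Longrightarrow> 0 < radial m l x" by force
    then obtain d where "d > 0" "\<forall>k x. \<bar>k - l\<bar> \<le> d \<longrightarrow> 0 \<le> x \<longrightarrow> x \<le> t + d \<longrightarrow> 0 < radial m k x"
      using radial_positive_stable[OF t, of m l] by auto
    then have "l + d \<in> S" using l by (auto simp: S_def)
    then have "l + d \<le> l" unfolding l_def using bdd by (rule cSup_upper)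
    then show False using \<open>d > 0\<close> by simp
  qed
  then obtain t1 where t1: "t1 \<le> t" "first_zero m l t1" using first_zero_exists[of _ m l] t by (meson order.trans order.strict_trans1)
  have "t1 = t"
  proof (rule ccontr)
    assume "t1 \<noteq> t"
    have z: "0 < t1" "t1 < pi" "radial m l t1 = 0" "\<And>x. 0 \<le> x \<Longrightarrow> x < t1 \<Longrightarrow> 0 < radial m l x" using t1 by (auto simp: first_zero_def)
    have "radial' m l t1 < 0" using radial'_negative[OF l z(1,2)] z(4) by auto
    then obtain d where d: "d > 0" "\<And>h. h > 0 \<Longrightarrow> h < d \<Longrightarrow> radial m l (t1 + h) < radial m l t1"
      using DERIV_neg_dec_right[OF radial_deriv(1)[of t1 m l]] z by auto
    define h where "h = min (d / 2) (t - t1)"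
    have "h > 0" "h < d" "t1 + h \<le> t" using d t1 \<open>t1 \<noteq> t\<close> by (auto simp: h_def)
    then show False using d(2)[of h] nn[of "t1 + h"] z by auto
  qed
  then show ?thesis using t1 l by auto
qed

lemma first_zero_decreasing:
  assumes "first_zero m l1 t1" "first_zero m l2 t2" "0 < l1" "0 < l2" "t1 < t2"
  shows "l2 < l1"
proof (rule ccontr)
  assume "\<not> l2 < l1"
  moreover have "l1 \<noteq> l2" using assms unfolding first_zero_def by (metis less_imp_le less_irrefl)
  ultimately have "l1 < l2" by simp
  then show False using assms by (intro sturm_comparison[of m l1 t1 l2]) (auto simp: first_zero_def)
qed

lemma first_zero_unique:
  assumes "first_zero m l1 t" "first_zero m l2 t" "0 < l1" "0 < l2"
  shows "l1 = l2"
proof -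
  have "\<not> l1 < l2" "\<not> l2 < l1"
    using assms sturm_comparison[of m l1 t l2] sturm_comparison[of m l2 t l1] by (auto simp: first_zero_def)
  then show ?thesis by simp
qed

definition cap_eigenvalue :: "nat \<Rightarrow> real \<Rightarrow> real" where
  "cap_eigenvalue m t = (THE l. 0 < l \<and> first_zero m l t)"

lemma cap_eigenvalue:
  assumes "0 < t" "t < pi"
  shows "0 < cap_eigenvalue m t" "first_zero m (cap_eigenvalue m t) t"
proof -
  have "\<exists>!l. 0 < l \<and> first_zero m l t"
    using eigenvalue_exists[OF assms, of m] first_zero_unique[of m _ t] by blast
  from theI'[OF this] show "0 < cap_eigenvalue m t" "first_zero m (cap_eigenvalue m t) t" by (auto simp: cap_eigenvalue_def)
qed

lemma cap_eigenvalue_decreasing: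
  assumes "0 < s" "s < t" "t < pi" shows "cap_eigenvalue m t < cap_eigenvalue m s"
  using assms by (intro first_zero_decreasing[OF cap_eigenvalue(2) cap_eigenvalue(2)] cap_eigenvalue(1)) auto

text \<open>Sturm comparison on both sides. For k above the eigenvalue at t, the solution for k has
  a first zero y < t, and monotonicity keeps the eigenvalue below k on (y, pi). For k below it, the
  solution for k is positive on [0, t], hence up to t + d by stability, which forces the eigenvalues
  on (0, t + d) above k.\<close>

lemma isCont_cap_eigenvalue:
  assumes t: "0 < t" "t < pi" shows "isCont (cap_eigenvalue m) t"
proof -
  define l where "l = cap_eigenvalue m t"
  have l: "0 < l" "first_zero m l t" using cap_eigenvalue[OF t] by (auto simp: l_def)
  have "(cap_eigenvalue m \<longlongrightarrow> l) (at t)"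
  proof (rule order_tendstoI)
    fix k assume k: "l < k"
    then obtain x where x: "0 < x" "x < t" "radial m k x \<le> 0" using sturm_comparison[OF l(2,1) k] by force
    then obtain y where y: "y \<le> x" "first_zero m k y" using first_zero_exists[of x m k] t by auto
    have y0: "0 < y" "y < pi" using y by (auto simp: first_zero_def)
    have ky: "cap_eigenvalue m y = k" using first_zero_unique[OF cap_eigenvalue(2)[OF y0] y(2) cap_eigenvalue(1)[OF y0]] k l by simp
    have "\<forall>\<^sub>F s in at t. s \<in> {y<..<pi}"
      using y x t by (intro eventually_at_in_open') auto
    then show "\<forall>\<^sub>F s in at t. cap_eigenvalue m s < k"
      by (rule eventually_mono) (use cap_eigenvalue_decreasing[of y _ m] ky y0 in auto)
  next
    fix k0 assume k0: "k0 < l"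
    \<comment> \<open>Sturm comparison is stated for positive parameters, so k0 is raised to a
      positive value still below l.\<close>
    define k where "k = max k0 (l / 2)"
    have k: "k0 \<le> k" "0 < k" "k < l" using k0 l by (auto simp: k_def)
    have "\<And>x. 0 \<le> x \<Longrightarrow> x \<le> t \<Longrightarrow> 0 < radial m k x"
    proof (rule ccontr)
      fix x assume "0 \<le> x" "x \<le> t" "\<not> 0 < radial m k x"
      then obtain y where y: "y \<le> x" "first_zero m k y" using first_zero_exists[of x m k] t by auto
      show False using sturm_comparison[OF y(2) k(2,3)] l y \<open>x \<le> t\<close> by (auto simp: first_zero_def)
    qed
    then obtain d where d: "d > 0" "t + d < pi" "\<And>x. 0 \<le> x \<Longrightarrow> x \<le> t + d \<Longrightarrow> 0 < radial m k x"
      using radial_positive_stable[OF t, of m k] by force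
    have "k < cap_eigenvalue m s" if s: "0 < s" "s < t + d" for s
    proof (rule ccontr)
      assume "\<not> k < cap_eigenvalue m s"
      have fs: "0 < cap_eigenvalue m s" "first_zero m (cap_eigenvalue m s) s" using s d by (auto intro!: cap_eigenvalue)
      have "cap_eigenvalue m s \<noteq> k" using fs d(3)[of s] s unfolding first_zero_def by auto
      then show False using sturm_comparison[OF fs(2,1), of k] \<open>\<not> k < cap_eigenvalue m s\<close> d s by auto
    qed
    moreover have "\<forall>\<^sub>F s in at t. s \<in> {0<..<t + d}"
      using d t by (intro eventually_at_in_open') auto
    ultimately show "\<forall>\<^sub>F s in at t. k0 < cap_eigenvalue m s"
      using k by (auto elim!: eventually_mono intro: order.strict_trans1)
  qed
  then show ?thesis by (simp add: isCont_def l_def)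
qed

text \<open>Up to pi / 2 the weight \<open>sin ^ m\<close> increases, and the solution is at most 1,
  so the slope is at most l t in absolute value. Falling from 1 to 0 over the length t therefore
  requires the bound. It yields the blow-up at 0.\<close>

lemma cap_eigenvalue_lower_bound:
  assumes t: "0 < t" "t < pi / 2"
  shows "1 \<le> cap_eigenvalue m t * t\<^sup>2"
proof -
  define l where "l = cap_eigenvalue m t"
  have l: "0 < l" "first_zero m l t" using cap_eigenvalue[of t m] t by (auto simp: l_def)
  have fz: "radial m l t = 0" "\<And>x. 0 \<le> x \<Longrightarrow> x < t \<Longrightarrow> 0 < radial m l x" using l by (auto simp: first_zero_def)
  have neg: "radial' m l x < 0" if "0 < x" "x \<le> t" for x
    using that t fz by (intro radial'_negative l) auto
  have dec: "radial m l y \<le> 1" if "0 \<le> y" "y \<le> t" for y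
  proof -
    have "radial m l y \<le> radial m l 0"
    proof (rule DERIV_nonpos_imp_nonincreasing[OF that(1)])
      fix z assume "0 \<le> z" "z \<le> y"
      then show "\<exists>y. (radial m l has_real_derivative y) (at z) \<and> y \<le> 0"
        using that t radial_deriv(1)[of z m l] neg[of z] radial_values_0(2)[of m l]
        by (intro exI[of _ "radial' m l z"]) (cases "z = 0", auto)
    qed
    then show ?thesis by (simp add: radial_values_0)
  qed
  have slope: "- radial' m l x \<le> l * t" if x: "0 < x" "x < t" for x
  proof -
    let ?g = "\<lambda>x. sin x ^ m * radial' m l x"
    have "continuous_on {0..x} ?g"
      unfolding continuous_on_eq_continuous_within using x t by (auto intro!: continuous_intros)
    moreover have "?g differentiable (at y)" if "0 < y" "y < x" for y
      using sin_power_radial'_deriv[of y m l] that x t by (auto simp: real_differentiable_def)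
    ultimately obtain L y where y': "0 < y" "y < x" "(?g has_real_derivative L) (at y)" "?g x - ?g 0 = (x - 0) * L"
      using MVT[OF x(1), of ?g] by blast
    have "L = - l * (sin y ^ m * radial m l y)"
      by (rule DERIV_unique[OF y'(3) sin_power_radial'_deriv]) (use y' x t in auto)
    with y' have y: "0 < y" "y < x" "?g x - ?g 0 = (x - 0) * (- l * (sin y ^ m * radial m l y))" by auto
    have sx: "0 < sin x" using x t by (intro sin_gt_zero) auto
    have "sin y ^ m * radial m l y \<le> sin x ^ m * 1"
      using y x t sx dec[of y] fz(2)[of y] by (intro mult_mono power_mono sin_monotone_2pi_le) (auto intro!: sin_ge_zero zero_le_power)
    then have "l * (sin y ^ m * radial m l y) \<le> l * (sin x ^ m * 1)" using l by (intro mult_left_mono) auto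
    then have "x * (l * (sin y ^ m * radial m l y)) \<le> t * (l * (sin x ^ m * 1))"
      by (rule mult_mono[rotated]) (use x l t y fz(2)[of y] in \<open>auto intro!: mult_nonneg_nonneg zero_le_power sin_ge_zero\<close>)
    then have "- (sin x ^ m * radial' m l x) \<le> sin x ^ m * (l * t)" using y(3) by (simp add: radial_values_0 algebra_simps)
    then have "sin x ^ m * (- radial' m l x) \<le> sin x ^ m * (l * t)" by simp
    then show ?thesis by (rule mult_left_le_imp_le) (use sx in simp)
  qed
  obtain z where z: "0 < z" "z < t" "radial m l t - radial m l 0 = (t - 0) * radial' m l z"
    using MVT2[of 0 t "radial m l" "radial' m l"] radial_deriv(1) t by auto
  have "t * (- radial' m l z) \<le> t * (l * t)" using slope[OF z(1,2)] t by (intro mult_left_mono) auto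
  then show ?thesis using z(3) fz by (simp add: radial_values_0 power2_eq_square l_def[symmetric] algebra_simps)
qed

subsection \<open>Derivatives of the eigenvalue\<close>

lemma sin_power_radial_dl'_deriv:
  assumes "0 < \<theta>" "\<theta> < pi"
  shows "((\<lambda>x. sin x ^ m * radial_dl' m l x) has_real_derivative - l * (sin \<theta> ^ m * radial_dl m l \<theta>) - sin \<theta> ^ m * radial m l \<theta>) (at \<theta>)"
proof -
  have s: "sin \<theta> > 0" using assms by (rule sin_gt_zero)
  have *: "real m * sin \<theta> ^ (m - Suc 0) = real m * (sin \<theta> ^ m / sin \<theta>)" using s by (cases m) auto
  have "((\<lambda>x. sin x ^ m * radial_dl' m l x) has_real_derivative
    sin \<theta> ^ m * (- (real m * cos \<theta> / sin \<theta> * radial_dl' m l \<theta>) - l * radial_dl m l \<theta> - radial m l \<theta>) + (real m * sin \<theta> ^ (m - Suc 0)) * cos \<theta> * radial_dl' m l \<theta>) (at \<theta>)"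
    by (auto intro!: derivative_eq_intros radial'_deriv assms)
  then show ?thesis by (rule DERIV_cong) (use s in \<open>simp add: * field_simps\<close>)
qed

text \<open>The weighted Wronskian of the solution with its own derivative in \<open>l\<close> has
  derivative \<open>sin ^ m\<close> times the square of the solution. At a zero of the solution this
  fixes the sign of \<open>radial_dl\<close>, which makes implicit differentiation possible.\<close>

lemma radial_wronskian_pos:
  assumes t: "0 < t" "t < pi" and pos: "\<And>x. 0 < x \<Longrightarrow> x < t \<Longrightarrow> 0 < radial m l x"
  shows "0 < radial_dl m l t * radial' m l t - radial_dl' m l t * radial m l t"
proof -
  define W where "W x = radial_dl m l x * (sin x ^ m * radial' m l x) - radial m l x * (sin x ^ m * radial_dl' m l x)" for x
  have "W 0 < W t"
  proof (rule DERIV_pos_imp_increasing_open[OF t(1), of W])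
    fix x assume x: "0 < x" "x < t"
    have s: "0 < sin x" using x t by (intro sin_gt_zero) auto
    have xp: "0 < x" "x < pi" "\<bar>x\<bar> < pi" using x t by auto
    have "(W has_real_derivative sin x ^ m * (radial m l x)\<^sup>2) (at x)"
      unfolding W_def[abs_def]
      by (rule DERIV_cong[OF DERIV_diff[OF DERIV_mult[OF radial_deriv(2)[OF xp(3)] sin_power_radial'_deriv[OF xp(1,2)]]
              DERIV_mult[OF radial_deriv(1)[OF xp(3)] sin_power_radial_dl'_deriv[OF xp(1,2)]]]])
        (simp add: algebra_simps power2_eq_square)
    moreover have "sin x ^ m * (radial m l x)\<^sup>2 > 0" using s pos[OF x] by simp
    ultimately show "\<exists>y. (W has_real_derivative y) (at x) \<and> y > 0" by blast
  next
    show "continuous_on {0..t} W" unfolding W_def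
      unfolding continuous_on_eq_continuous_within using t by (auto intro!: continuous_intros)
  qed
  then have "0 < sin t ^ m * (radial_dl m l t * radial' m l t - radial_dl' m l t * radial m l t)"
    by (simp add: W_def radial_values_0 algebra_simps)
  moreover have "0 < sin t ^ m" using t by (intro zero_less_power sin_gt_zero)
  ultimately show ?thesis by (rule zero_less_mult_pos)
qed

text \<open>\<open>G\<close> is differentiable at one point and \<open>f\<close> merely continuous
  there, so the slope is estimated directly: the linear part of \<open>G\<close> gives |f s - f t|
  \<le> C |s - t|, after which the remainder of \<open>G\<close> is small compared with |s -
  t|.\<close>

lemma implicit_deriv:
  fixes G :: "real \<times> real \<Rightarrow> real"
  assumes G: "(G has_derivative (\<lambda>h. fst h * a + snd h * b)) (at (f t, t))" and a: "a \<noteq> 0"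
    and f: "isCont f t" and r: "r > 0" and z: "\<And>s. \<bar>s - t\<bar> < r \<Longrightarrow> G (f s, s) = 0"
  shows "(f has_real_derivative - b / a) (at t)"
proof -
  define C where "C = (\<bar>b\<bar> + \<bar>a\<bar> / 2) * 2 / \<bar>a\<bar>"
  have C: "C \<ge> 0" unfolding C_def by (intro divide_nonneg_nonneg mult_nonneg_nonneg) auto
  have "\<exists>d>0. \<forall>s. norm (s - t) < d \<longrightarrow> norm (f s - f t - - b / a * (s - t)) \<le> e * norm (s - t)" if e: "e > 0" for e
  proof -
    \<comment> \<open>The bound |a| / 2 lets the error in |u| be absorbed into |u| |a|, which
      produces the constant C; the second bound makes the final error at most e |v|.\<close>
    define \<epsilon> where "\<epsilon> = min (\<bar>a\<bar> / 2) (e * \<bar>a\<bar> / (C + 1))"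
    have \<epsilon>: "\<epsilon> > 0" "\<epsilon> \<le> \<bar>a\<bar> / 2" "\<epsilon> * (C + 1) \<le> e * \<bar>a\<bar>"
    proof -
      show "\<epsilon> > 0" using e a C by (simp add: \<epsilon>_def)
      show "\<epsilon> \<le> \<bar>a\<bar> / 2" unfolding \<epsilon>_def by (rule min.cobounded1)
      have "\<epsilon> \<le> e * \<bar>a\<bar> / (C + 1)" by (simp add: \<epsilon>_def)
      then show "\<epsilon> * (C + 1) \<le> e * \<bar>a\<bar>" using C by (simp add: field_simps)
    qed
    obtain d1 where d1: "d1 > 0" "\<And>y. norm (y - (f t, t)) < d1 \<Longrightarrow>
        norm (G y - G (f t, t) - (fst (y - (f t, t)) * a + snd (y - (f t, t)) * b)) \<le> \<epsilon> * norm (y - (f t, t))"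
      using G \<epsilon>(1) unfolding has_derivative_at_alt by metis
    obtain d2 where d2: "d2 > 0" "\<And>s. norm (s - t) < d2 \<Longrightarrow> norm (f s - f t) < d1 / 2"
      using f d1(1) unfolding isCont_def LIM_eq
      by (metis diff_self half_gt_zero norm_zero)
    define d where "d = min r (min d2 (d1 / 2))"
    have "norm (f s - f t - - b / a * (s - t)) \<le> e * norm (s - t)" if s: "norm (s - t) < d" for s
    proof -
      define u v where "u = f s - f t" and "v = s - t"
      have n: "norm ((f s, s) - (f t, t)) \<le> \<bar>u\<bar> + \<bar>v\<bar>"
        unfolding u_def v_def by (simp add: norm_Pair sqrt_sum_squares_le_sum_abs)
      have "\<bar>u\<bar> + \<bar>v\<bar> < d1" using s d2(2)[of s] by (auto simp: d_def u_def v_def)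
      then have "norm (G (f s, s) - G (f t, t) - (u * a + v * b)) \<le> \<epsilon> * norm ((f s, s) - (f t, t))"
        using d1(2)[of "(f s, s)"] n by (simp add: u_def v_def)
      also have "\<dots> \<le> \<epsilon> * (\<bar>u\<bar> + \<bar>v\<bar>)" using n \<epsilon>(1) by (intro mult_left_mono) auto
      finally have main: "\<bar>u * a + v * b\<bar> \<le> \<epsilon> * (\<bar>u\<bar> + \<bar>v\<bar>)" using z[of s] z[of t] s r by (simp add: d_def abs_minus_commute)
      have "\<bar>u\<bar> * \<bar>a\<bar> \<le> \<bar>v\<bar> * \<bar>b\<bar> + \<epsilon> * (\<bar>u\<bar> + \<bar>v\<bar>)"
        using main unfolding abs_mult[symmetric] by linarith
      also have "\<dots> \<le> \<bar>v\<bar> * \<bar>b\<bar> + \<bar>a\<bar> / 2 * (\<bar>u\<bar> + \<bar>v\<bar>)" using \<epsilon> by (intro add_left_mono mult_right_mono) auto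
      finally have "\<bar>u\<bar> \<le> C * \<bar>v\<bar>" using a by (simp add: C_def field_simps)
      then have "\<epsilon> * (\<bar>u\<bar> + \<bar>v\<bar>) \<le> \<epsilon> * (C * \<bar>v\<bar> + \<bar>v\<bar>)" using \<epsilon> by (intro mult_left_mono) auto
      also have "\<dots> = \<epsilon> * (C + 1) * \<bar>v\<bar>" by (simp add: algebra_simps)
      also have "\<dots> \<le> e * \<bar>a\<bar> * \<bar>v\<bar>" using \<epsilon>(3) by (rule mult_right_mono) simp
      finally have "\<bar>u * a + v * b\<bar> \<le> \<bar>a\<bar> * (e * \<bar>v\<bar>)" using main by (simp add: mult_ac)
      moreover have "u * a + v * b = a * (u - - b / a * v)" using a by (simp add: field_simps)
      ultimately show ?thesis using a by (simp add: abs_mult u_def v_def)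
    qed
    moreover have "d > 0" using r d1 d2 by (simp add: d_def)
    ultimately show ?thesis by blast
  qed
  then show ?thesis unfolding has_field_derivative_def has_derivative_at_alt
    by (auto intro: bounded_linear_mult_right)
qed

lemma cap_eigenvalue_facts:
  fixes m :: nat
  assumes t: "0 < t" "t < pi"
  defines "l \<equiv> cap_eigenvalue m t"
  shows "radial m l t = 0" "radial' m l t < 0" "radial_dl m l t < 0"
proof -
  have l: "0 < l" "first_zero m l t" using cap_eigenvalue[OF t] by (auto simp: l_def)
  then show 1: "radial m l t = 0" by (simp add: first_zero_def)
  show 2: "radial' m l t < 0" using l by (intro radial'_negative t) (auto simp: first_zero_def)
  have "0 < radial_dl m l t * radial' m l t - radial_dl' m l t * radial m l t" by (rule radial_wronskian_pos[OF t]) (use l in \<open>auto simp: first_zero_def\<close>)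
  then show "radial_dl m l t < 0" using 1 2 by (simp add: zero_less_mult_iff)
qed

lemma cap_eigenvalue_deriv:
  assumes t: "0 < t" "t < pi"
  shows "(cap_eigenvalue m has_real_derivative - radial' m (cap_eigenvalue m t) t / radial_dl m (cap_eigenvalue m t) t) (at t)"
proof (rule implicit_deriv[of "\<lambda>p. radial m (fst p) (snd p)"])
  show "((\<lambda>p. radial m (fst p) (snd p)) has_derivative (\<lambda>h. fst h * radial_dl m (cap_eigenvalue m t) t + snd h * radial' m (cap_eigenvalue m t) t)) (at (cap_eigenvalue m t, t))"
    using t by (intro radial_joint_deriv) auto
  show "radial_dl m (cap_eigenvalue m t) t \<noteq> 0" using cap_eigenvalue_facts(3)[OF t, of m] by simp
  show "isCont (cap_eigenvalue m) t" by (rule isCont_cap_eigenvalue[OF t])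
  show "min t (pi - t) > 0" using t by simp
  show "radial m (fst (cap_eigenvalue m s, s)) (snd (cap_eigenvalue m s, s)) = 0" if "\<bar>s - t\<bar> < min t (pi - t)" for s
    using cap_eigenvalue_facts(1)[of s m] that by auto
qed

text \<open>Quotient rule along the curve \<open>(cap_eigenvalue m s, s)\<close>, on which the
  solution vanishes; the radial equation replaces the second \<theta>-derivative. The factor before
  the bracket is a quotient of two negative numbers, so the bracket decides the sign of the second
  derivative.\<close>

lemma cap_eigenvalue_deriv2:
  fixes m :: nat
  assumes t: "0 < t" "t < pi"
  defines "l \<equiv> cap_eigenvalue m t"
  shows "((\<lambda>s. - radial' m (cap_eigenvalue m s) s / radial_dl m (cap_eigenvalue m s) s) has_real_derivative
    radial' m l t / radial_dl m l t ^ 3 * (2 * radial_dl m l t * radial_dl' m l t + real m * cos t / sin t * (radial_dl m l t)\<^sup>2 - radial' m l t * radial_dll m l t)) (at t)"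
proof -
  define d where "d = - radial' m l t / radial_dl m l t"
  have "((\<lambda>s. (cap_eigenvalue m s, s)) has_derivative (\<lambda>h. (h * d, h))) (at t)"
    using cap_eigenvalue_deriv[OF t, of m] unfolding has_field_derivative_def d_def l_def
    by (auto intro!: derivative_eq_intros simp: mult.commute)
  note chain = has_derivative_compose[OF this, folded l_def]
  have t': "\<bar>t\<bar> < pi" using t by simp
  have z: "radial m l t = 0" "radial_dl m l t \<noteq> 0" using cap_eigenvalue_facts[OF t, of m] by (auto simp: l_def)
  have 1: "((\<lambda>s. radial' m (cap_eigenvalue m s) s) has_real_derivative d * radial_dl' m l t - real m * cos t / sin t * radial' m l t) (at t)"
    using has_derivative_imp_has_field_derivative[OF chain[OF radial'_joint_deriv[OF t, of m l]],
        of "d * radial_dl' m l t - real m * cos t / sin t * radial' m l t"]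
    by (simp add: z algebra_simps)
  have 2: "((\<lambda>s. radial_dl m (cap_eigenvalue m s) s) has_real_derivative d * radial_dll m l t + radial_dl' m l t) (at t)"
    using has_derivative_imp_has_field_derivative[OF chain[OF radial_joint_deriv(2)[OF t', of m l]],
        of "d * radial_dll m l t + radial_dl' m l t"]
    by (simp add: algebra_simps)
  have s: "sin t \<noteq> 0" using sin_gt_zero[OF t] by simp
  show ?thesis
    by (rule DERIV_cong[OF DERIV_divide[OF DERIV_minus[OF 1] 2]])
      (use z s in \<open>simp_all add: l_def[symmetric] d_def field_simps power2_eq_square power3_eq_cube\<close>)
qed

text \<open>For \<open>w'' = q w\<close> with \<open>q = V - l\<close>, the slope \<open>v = - w' / w\<close> satisfies \<open>v' = l - V + v\<^sup>2\<close>. Let \<open>x(v, l)\<close> be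
  the point where the slope is \<open>v\<close>, and let \<open>a\<close>, \<open>b\<close> be the first and second derivatives of \<open>w\<close> in \<open>l\<close>.
  Then \<open>y\<close> is the first derivative of \<open>x\<close> in \<open>l\<close>, and the function differentiated below is \<open>D\<close> times the
  second one; both expressions remain regular at the zeros of \<open>w\<close>.\<close>

lemma convexity_identity:
  fixes w w1 a a1 b b1 q q1 :: "real \<Rightarrow> real" and q2 :: real
  assumes d: "(w has_real_derivative w1 x) (at x)" "(w1 has_real_derivative q x * w x) (at x)"
    "(a has_real_derivative a1 x) (at x)" "(a1 has_real_derivative q x * a x - w x) (at x)"
    "(b has_real_derivative b1 x) (at x)" "(b1 has_real_derivative q x * b x - 2 * a x) (at x)"
    "(q has_real_derivative q1 x) (at x)" "(q1 has_real_derivative q2) (at x)"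
  defines "D \<equiv> \<lambda>x. (w1 x)\<^sup>2 - q x * (w x)\<^sup>2"
  defines "y \<equiv> \<lambda>x. - (a x * w1 x - a1 x * w x) / D x"
  assumes D: "D x \<noteq> 0"
  shows "((\<lambda>x. - (b x * w1 x - b1 x * w x) + 2 * (q x * a x * w x - (w x)\<^sup>2 - w1 x * a1 x) * y x + q1 x * (w x)\<^sup>2 * (y x)\<^sup>2)
    has_real_derivative 2 * w x ^ 4 * (1 - q1 x * y x)\<^sup>2 / D x + (w x)\<^sup>2 * q2 * (y x)\<^sup>2) (at x)"
proof -
  define e where "e = 1 - q1 x * y x"
  define y' where "y' = - (w x)\<^sup>2 * e / D x"
  have dD: "(D has_real_derivative - q1 x * (w x)\<^sup>2) (at x)"
    unfolding D_def by (rule DERIV_cong, (rule derivative_intros d)+) (simp add: algebra_simps power2_eq_square)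
  have dR: "((\<lambda>x. - (a x * w1 x - a1 x * w x)) has_real_derivative - (w x)\<^sup>2) (at x)"
    by (rule DERIV_cong, (rule derivative_intros d)+) (simp add: algebra_simps power2_eq_square)
  have yD: "y x * D x = - (a x * w1 x - a1 x * w x)" using D by (simp add: y_def)
  have dy: "(y has_real_derivative y') (at x)"
  proof -
    have "(y has_real_derivative (- (w x)\<^sup>2 * D x - - (a x * w1 x - a1 x * w x) * (- q1 x * (w x)\<^sup>2)) / (D x * D x)) (at x)"
      unfolding y_def by (rule DERIV_divide[OF dR dD D])
    moreover have "(- (w x)\<^sup>2 * D x - - (a x * w1 x - a1 x * w x) * (- q1 x * (w x)\<^sup>2)) / (D x * D x) = y'"
      unfolding yD[symmetric] using D by (simp add: y'_def e_def field_simps)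
    ultimately show ?thesis by simp
  qed
  have key: "D x * (a x + w1 x * y x) = w x * (a1 x * w1 x - a x * q x * w x)"
  proof -
    have "D x * (a x + w1 x * y x) = D x * a x + w1 x * (y x * D x)" by (simp add: algebra_simps)
    also have "\<dots> = w x * (a1 x * w1 x - a x * q x * w x)"
      unfolding yD by (simp add: D_def algebra_simps power2_eq_square)
    finally show ?thesis .
  qed
  \<comment> \<open>The cancellation on which the sign rests: after it only a square over
    \<open>D\<close> and the term with \<open>q2\<close> survive.\<close>
  have key2: "2 * y' * (q x * a x * w x - w1 x * a1 x) = 2 * w x * e * (a x + w1 x * y x)"
  proof -
    have "2 * y' * (q x * a x * w x - w1 x * a1 x) = 2 * w x * e * (w x * (a1 x * w1 x - a x * q x * w x)) / D x"
      unfolding y'_def using D by (simp add: field_simps power2_eq_square)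
    also have "\<dots> = 2 * w x * e * (a x + w1 x * y x)" unfolding key[symmetric] using D by simp
    finally show ?thesis .
  qed
  have key3: "2 * w x ^ 4 * e\<^sup>2 / D x = - 2 * (w x)\<^sup>2 * e * y'"
    unfolding y'_def using D by (simp add: power2_eq_square power4_eq_xxxx)
  have p1: "((\<lambda>x. b x * w1 x - b1 x * w x) has_real_derivative 2 * a x * w x) (at x)"
    by (rule DERIV_cong, (rule derivative_intros d)+) (simp add: algebra_simps)
  have p2: "((\<lambda>x. q x * a x * w x - (w x)\<^sup>2 - w1 x * a1 x) has_real_derivative q1 x * a x * w x - w x * w1 x) (at x)"
    by (rule DERIV_cong, (rule derivative_intros d)+) (simp add: algebra_simps power2_eq_square)
  have p3: "((\<lambda>x. q1 x * (w x)\<^sup>2 * (y x)\<^sup>2) has_real_derivative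
      q2 * (w x)\<^sup>2 * (y x)\<^sup>2 + 2 * q1 x * w x * w1 x * (y x)\<^sup>2 + 2 * q1 x * (w x)\<^sup>2 * y x * y') (at x)"
    by (rule DERIV_cong, (rule derivative_intros d dy)+) (simp add: algebra_simps power2_eq_square)
  have "- (2 * a x * w x) + (2 * (q1 x * a x * w x - w x * w1 x) * y x + y' * (2 * (q x * a x * w x - (w x)\<^sup>2 - w1 x * a1 x)))
       + (q2 * (w x)\<^sup>2 * (y x)\<^sup>2 + 2 * q1 x * w x * w1 x * (y x)\<^sup>2 + 2 * q1 x * (w x)\<^sup>2 * y x * y')
      = - (2 * w x * e * (a x + w1 x * y x)) + 2 * y' * (q x * a x * w x - w1 x * a1 x) - 2 * (w x)\<^sup>2 * e * y' + q2 * (w x)\<^sup>2 * (y x)\<^sup>2"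
    by (simp add: e_def algebra_simps power2_eq_square)
  \<comment> \<open>For \<open>D x > 0\<close> and \<open>q2 \<ge> 0\<close> both summands are
    nonnegative. This is where convexity of the potential enters.\<close>
  also have "\<dots> = 2 * w x ^ 4 * (1 - q1 x * y x)\<^sup>2 / D x + (w x)\<^sup>2 * q2 * (y x)\<^sup>2"
    unfolding key2 key3[unfolded e_def] e_def by simp
  finally show ?thesis
    by (rule DERIV_cong[OF DERIV_add[OF DERIV_add[OF DERIV_minus[OF p1] DERIV_mult[OF DERIV_cmult[OF p2, of 2] dy]] p3]])
qed


section \<open>Liouville normal form and convexity of the eigenvalue\<close>

lemma DERIV_cos_over_sin:
  fixes x :: real
  assumes "sin x \<noteq> 0"
  shows "((\<lambda>x. cos x / sin x) has_real_derivative - 1 - (cos x / sin x)\<^sup>2) (at x)"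
  by (rule DERIV_cong[OF DERIV_divide[OF DERIV_cos DERIV_sin assms]])
    (use assms in \<open>auto simp: field_simps power2_eq_square\<close>)

text \<open>\<open>sqrt (sin x) ^ m\<close> is sin to the power m / 2 with a natural exponent; this
  factor removes the first-order term. The number \<open>g\<close> is the value of the inhomogeneity
  at x, so the derivatives in \<open>l\<close> are covered as well.\<close>

lemma liouville_substitution:
  fixes Y Y' :: "real \<Rightarrow> real" and h l g :: real
  assumes x: "0 < x" "x < pi"
    and Y: "(Y has_real_derivative Y' x) (at x)"
    and Y': "(Y' has_real_derivative - (real m * cos x / sin x * Y' x) - l * Y x - g) (at x)"
  defines "h \<equiv> real m / 2"
  shows "((\<lambda>x. sqrt (sin x) ^ m * Y x) has_real_derivative sqrt (sin x) ^ m * (Y' x + h * (cos x / sin x) * Y x)) (at x)"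
    "((\<lambda>x. sqrt (sin x) ^ m * (Y' x + h * (cos x / sin x) * Y x)) has_real_derivative
      ((h\<^sup>2 - h) * (cos x / sin x)\<^sup>2 - h - l) * (sqrt (sin x) ^ m * Y x) - sqrt (sin x) ^ m * g) (at x)"
proof -
  have s: "sin x > 0" using x by (rule sin_gt_zero)
  have *: "real m * sqrt (sin x) ^ (m - Suc 0) = real m * (sqrt (sin x) ^ m / sqrt (sin x))" using s by (cases m) auto
  have "((\<lambda>x. sqrt (sin x) ^ m) has_real_derivative real m * sqrt (sin x) ^ (m - Suc 0) * (cos x * (inverse (sqrt (sin x)) / 2))) (at x)"
    using s by (auto intro!: derivative_eq_intros)
  moreover have "real m * sqrt (sin x) ^ (m - Suc 0) * (cos x * (inverse (sqrt (sin x)) / 2)) = h * (cos x / sin x) * sqrt (sin x) ^ m"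
    unfolding * h_def using s by (simp add: field_simps)
  ultimately have ds: "((\<lambda>x. sqrt (sin x) ^ m) has_real_derivative h * (cos x / sin x) * sqrt (sin x) ^ m) (at x)" by simp
  note dc = DERIV_cos_over_sin[OF less_imp_neq[OF s, symmetric]]
  show "((\<lambda>x. sqrt (sin x) ^ m * Y x) has_real_derivative sqrt (sin x) ^ m * (Y' x + h * (cos x / sin x) * Y x)) (at x)"
    by (rule DERIV_cong[OF DERIV_mult[OF ds Y]]) (simp add: algebra_simps)
  have Y'': "(Y' has_real_derivative - (2 * h * (cos x / sin x) * Y' x) - l * Y x - g) (at x)"
    using Y' by (simp add: h_def)
  define c where "c = cos x / sin x"
  show "((\<lambda>x. sqrt (sin x) ^ m * (Y' x + h * (cos x / sin x) * Y x)) has_real_derivative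
      ((h\<^sup>2 - h) * (cos x / sin x)\<^sup>2 - h - l) * (sqrt (sin x) ^ m * Y x) - sqrt (sin x) ^ m * g) (at x)"
    by (rule DERIV_cong[OF DERIV_mult[OF ds DERIV_add[OF Y'' DERIV_mult[OF DERIV_cmult[OF dc, of h] Y]]]])
      (unfold c_def[symmetric], simp add: algebra_simps power2_eq_square)
qed

text \<open>Multiplied by \<open>sin ^ m\<close>, the form vanishes at the pole and has derivative
  \<open>- m * sin ^ m * (1 + cot^2) * u * u'\<close>, positive because u > 0 > u'. Adding
  \<open>(m / 2) * u^2 / sin^2\<close> to the form gives the denominator \<open>D\<close> of the
  convexity identity divided by \<open>sin ^ m\<close>.\<close>

lemma cap_form_pos:
  assumes m: "0 < m" and l: "0 < l" and t: "0 < t" "t < pi" and pos: "\<And>x. 0 < x \<Longrightarrow> x < t \<Longrightarrow> 0 < radial m l x"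
  shows "0 < (radial' m l t)\<^sup>2 + real m * (cos t / sin t) * radial m l t * radial' m l t + l * (radial m l t)\<^sup>2"
proof -
  \<comment> \<open>Multiplied out so that \<open>cot\<close> turns into
    \<open>sin x ^ (m - 1) * cos x\<close>. This is regular at 0, where it meets the factor
    \<open>radial' m l 0 = 0\<close>.\<close>
  define K where "K x = radial' m l x * (sin x ^ m * radial' m l x) + real m * sin x ^ (m - 1) * cos x * radial m l x * radial' m l x + l * (sin x ^ m * (radial m l x * radial m l x))" for x
  have Keq: "K x = sin x ^ m * ((radial' m l x)\<^sup>2 + real m * (cos x / sin x) * radial m l x * radial' m l x + l * (radial m l x)\<^sup>2)" if "0 < sin x" for x
    using that m by (cases m) (auto simp: K_def field_simps power2_eq_square)
  have "K 0 < K t"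
  proof (rule DERIV_pos_imp_increasing_open[OF t(1), of K])
    fix x assume x: "0 < x" "x < t"
    have s: "0 < sin x" using x t by (intro sin_gt_zero) auto
    have xp: "0 < x" "x < pi" "\<bar>x\<bar> < pi" using x t by auto
    have dsm: "((\<lambda>x. sin x ^ m) has_real_derivative real m * (cos x / sin x) * sin x ^ m) (at x)"
      using s m by (auto intro!: derivative_eq_intros) (cases m; simp)
    note dc = DERIV_cos_over_sin[OF less_imp_neq[OF s, symmetric]]
    have dU'': "(radial' m l has_real_derivative - (real m * (cos x / sin x) * radial' m l x) - l * radial m l x) (at x)"
      using radial'_deriv(1)[OF xp(1,2), of m l] by simp
    note dU = radial_deriv(1)[OF xp(3), of m l]
    define c where "c = cos x / sin x"
    have "((\<lambda>x. sin x ^ m * ((radial' m l x)\<^sup>2 + real m * (cos x / sin x) * radial m l x * radial' m l x + l * (radial m l x)\<^sup>2)) has_real_derivative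
       - real m * sin x ^ m * (1 + (cos x / sin x)\<^sup>2) * radial m l x * radial' m l x) (at x)"
      by (rule DERIV_cong, (rule derivative_intros dsm dc dU dU'')+)
        (unfold c_def[symmetric], simp add: algebra_simps power2_eq_square)
    moreover have "open {0<..<pi}" "x \<in> {0<..<pi}" using xp by auto
    ultimately have "(K has_real_derivative - real m * sin x ^ m * (1 + (cos x / sin x)\<^sup>2) * radial m l x * radial' m l x) (at x)"
      by (rule has_field_derivative_transform_within_open) (auto simp: Keq sin_gt_zero)
    moreover have "- real m * sin x ^ m * (1 + (cos x / sin x)\<^sup>2) * radial m l x * radial' m l x > 0"
    proof -
      have "radial' m l x < 0" using x t by (intro radial'_negative l pos) auto
      moreover have "0 < real m * sin x ^ m * (1 + (cos x / sin x)\<^sup>2) * radial m l x"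
        using m s pos[OF x] by (intro mult_pos_pos) (auto intro: add_pos_nonneg)
      ultimately show ?thesis using mult_pos_neg by fastforce
    qed
    ultimately show "\<exists>y. (K has_real_derivative y) (at x) \<and> y > 0" by blast
  next
    show "continuous_on {0..t} K" unfolding K_def
      unfolding continuous_on_eq_continuous_within using t by (auto intro!: continuous_intros)
  qed
  moreover have "K 0 = 0" using m by (simp add: K_def radial_values_0)
  moreover have "0 < sin t" using t by (intro sin_gt_zero)
  ultimately have "0 < sin t ^ m * ((radial' m l t)\<^sup>2 + real m * (cos t / sin t) * radial m l t * radial' m l t + l * (radial m l t)\<^sup>2)"
    by (simp add: Keq)
  then show ?thesis using \<open>0 < sin t\<close> by (simp add: zero_less_mult_iff)
qed


text \<open>The function of \<open>convexity_identity\<close> is compared at the pole and at t.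
  \<open>G\<close> is that function rewritten without negative powers of \<open>sin\<close>, so it
  is continuous up to the pole with value 0, and it increases strictly because k > 0. At t the
  solution vanishes and \<open>G t\<close> becomes \<open>sin t ^ m\<close> times the claimed
  expression.\<close>

lemma cap_eigenvalue_convexity:
  fixes m :: nat
  assumes m: "3 \<le> m" and t: "0 < t" "t < pi"
  defines "l \<equiv> cap_eigenvalue m t"
  shows "0 < 2 * radial_dl m l t * radial_dl' m l t + real m * cos t / sin t * (radial_dl m l t)\<^sup>2 - radial' m l t * radial_dll m l t"
proof -
  define h where "h = real m / 2"
  \<comment> \<open>The coefficient of the square of \<open>cot\<close> in the potential. From m
    \<ge> 3 it follows that h \<ge> 3/2, so k is positive.\<close>
  define k where "k = h\<^sup>2 - h"
  have mh: "real m = 2 * h" by (simp add: h_def)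
  have h: "h > 0" "k > 0" using m by (auto simp: h_def k_def power2_eq_square)
  have l: "0 < l" "first_zero m l t" using cap_eigenvalue[OF t] by (auto simp: l_def)
  have zt: "radial m l t = 0" "radial' m l t < 0" using cap_eigenvalue_facts[OF t, of m] by (auto simp: l_def)
  have pos: "0 < radial m l x" if "0 \<le> x" "x < t" for x using l that by (auto simp: first_zero_def)
  \<comment> \<open>\<open>T\<close> is \<open>D * sin^2 / sin^m\<close>, a form of the denominator
    that stays positive at the pole, where it equals h.\<close>
  define T where "T x = (sin x)\<^sup>2 * (radial' m l x)\<^sup>2 + 2 * h * sin x * cos x * radial m l x * radial' m l x + (h + l * (sin x)\<^sup>2) * (radial m l x)\<^sup>2" for x
  \<comment> \<open>The regular part of \<open>Y\<close>, the derivative in \<open>l\<close> of the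
    point with a given slope: \<open>Y = sin^2 * y\<close>.\<close>
  define y where "y x = - (radial_dl m l x * radial' m l x - radial_dl' m l x * radial m l x) / T x" for x
  define G where "G x = - (sin x ^ m * (radial_dll m l x * radial' m l x - radial_dll' m l x * radial m l x))
    + 2 * (sin x ^ m * ((k * (cos x)\<^sup>2 - (h + l) * (sin x)\<^sup>2) * radial_dl m l x * radial m l x - (sin x)\<^sup>2 * (radial m l x)\<^sup>2
        - (sin x * radial' m l x + h * cos x * radial m l x) * (sin x * radial_dl' m l x + h * cos x * radial_dl m l x))) * y x
    - 2 * k * cos x * sin x ^ m * sin x * (radial m l x)\<^sup>2 * (y x)\<^sup>2" for x
  have Tpos: "T x > 0" if x: "0 \<le> x" "x \<le> t" for x
  proof (cases "x = 0")
    case True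
    then show ?thesis using h by (simp add: T_def radial_values_0)
  next
    case False
    then have s: "0 < sin x" using x t by (intro sin_gt_zero) auto
    have "0 < (radial' m l x)\<^sup>2 + real m * (cos x / sin x) * radial m l x * radial' m l x + l * (radial m l x)\<^sup>2"
      by (rule cap_form_pos) (use m l x t False pos in auto)
    then have "0 < (sin x)\<^sup>2 * ((radial' m l x)\<^sup>2 + real m * (cos x / sin x) * radial m l x * radial' m l x + l * (radial m l x)\<^sup>2) + h * (radial m l x)\<^sup>2"
      using s h mult_pos_pos[of "(sin x)\<^sup>2"] by (intro add_pos_nonneg) auto
    also have "\<dots> = T x" unfolding T_def mh using s by (simp add: field_simps power2_eq_square)
    finally show ?thesis .
  qed
  define \<sigma> where "\<sigma> x = sqrt (sin x) ^ m" for x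
  define q where "q x = k * (cos x / sin x)\<^sup>2 - h - l" for x
  define q1 where "q1 x = - 2 * k * cos x / sin x ^ 3" for x
  define w where "w x = \<sigma> x * radial m l x" for x
  define w1 where "w1 x = \<sigma> x * (radial' m l x + h * (cos x / sin x) * radial m l x)" for x
  define a where "a x = \<sigma> x * radial_dl m l x" for x
  define a1 where "a1 x = \<sigma> x * (radial_dl' m l x + h * (cos x / sin x) * radial_dl m l x)" for x
  define b where "b x = \<sigma> x * radial_dll m l x" for x
  define b1 where "b1 x = \<sigma> x * (radial_dll' m l x + h * (cos x / sin x) * radial_dll m l x)" for x
  define D where "D x = (w1 x)\<^sup>2 - q x * (w x)\<^sup>2" for x
  define Y where "Y x = - (a x * w1 x - a1 x * w x) / D x" for x
  define M where "M x = - (b x * w1 x - b1 x * w x) + 2 * (q x * a x * w x - (w x)\<^sup>2 - w1 x * a1 x) * Y x + q1 x * (w x)\<^sup>2 * (Y x)\<^sup>2" for x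
  have \<sigma>2: "\<sigma> x * \<sigma> x = sin x ^ m" if "0 < sin x" for x
    using that by (simp add: \<sigma>_def power_mult_distrib[symmetric])
  have Deq: "D x * (sin x)\<^sup>2 = sin x ^ m * T x" if s: "0 < sin x" for x
  proof -
    define c where "c = cos x / sin x"
    have cc: "c * sin x = cos x" using s by (simp add: c_def)
    have "D x = (\<sigma> x * \<sigma> x) * ((radial' m l x + h * c * radial m l x)\<^sup>2 - (k * c\<^sup>2 - h - l) * (radial m l x)\<^sup>2)"
      by (simp add: D_def w1_def w_def q_def c_def power_mult_distrib power2_eq_square algebra_simps)
    moreover have "((radial' m l x + h * c * radial m l x)\<^sup>2 - (k * c\<^sup>2 - h - l) * (radial m l x)\<^sup>2) * (sin x)\<^sup>2
      = (sin x)\<^sup>2 * (radial' m l x)\<^sup>2 + 2 * h * sin x * (c * sin x) * radial m l x * radial' m l x + (h * ((c * sin x)\<^sup>2 + (sin x)\<^sup>2) + l * (sin x)\<^sup>2) * (radial m l x)\<^sup>2"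
      by (simp add: k_def algebra_simps power2_eq_square)
    ultimately show ?thesis using \<sigma>2[OF s] unfolding cc by (simp add: T_def)
  qed
  have Req: "a x * w1 x - a1 x * w x = sin x ^ m * (radial_dl m l x * radial' m l x - radial_dl' m l x * radial m l x)" if s: "0 < sin x" for x
    unfolding \<sigma>2[OF s, symmetric] by (simp add: a_def a1_def w_def w1_def algebra_simps)
  have Seq: "b x * w1 x - b1 x * w x = sin x ^ m * (radial_dll m l x * radial' m l x - radial_dll' m l x * radial m l x)" if s: "0 < sin x" for x
    unfolding \<sigma>2[OF s, symmetric] by (simp add: b_def b1_def w_def w1_def algebra_simps)
  have Yeq: "Y x = (sin x)\<^sup>2 * y x" if s: "0 < sin x" and T: "T x > 0" for x
  proof -
    have D: "D x = sin x ^ m * T x / (sin x)\<^sup>2" using Deq[OF s] s by (simp add: field_simps)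
    have "sin x ^ m \<noteq> 0" using s by simp
    then show ?thesis unfolding Y_def y_def Req[OF s] D using s T by (simp add: field_simps)
  qed
  have MG: "M x = G x" if s: "0 < sin x" and T: "T x > 0" for x
  proof -
    define c where "c = cos x / sin x"
    have cc: "cos x = c * sin x" using s by (simp add: c_def)
    have 1: "2 * (q x * a x * w x - (w x)\<^sup>2 - w1 x * a1 x) * Y x
      = 2 * (sin x ^ m * ((k * (cos x)\<^sup>2 - (h + l) * (sin x)\<^sup>2) * radial_dl m l x * radial m l x - (sin x)\<^sup>2 * (radial m l x)\<^sup>2
        - (sin x * radial' m l x + h * cos x * radial m l x) * (sin x * radial_dl' m l x + h * cos x * radial_dl m l x))) * y x"
      unfolding Yeq[OF that] \<sigma>2[OF s, symmetric] q_def w_def w1_def a_def a1_def c_def[symmetric] cc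
      by (simp add: algebra_simps power2_eq_square)
    have "q1 x * sin x ^ 3 = - 2 * k * cos x" using s by (simp add: q1_def)
    moreover have "q1 x * (w x)\<^sup>2 * (Y x)\<^sup>2 = (q1 x * sin x ^ 3) * (sin x * (\<sigma> x * \<sigma> x) * (radial m l x)\<^sup>2 * (y x)\<^sup>2)"
      unfolding Yeq[OF that] w_def by (simp add: power2_eq_square power3_eq_cube)
    ultimately have "q1 x * (w x)\<^sup>2 * (Y x)\<^sup>2 = - 2 * k * cos x * (sin x * sin x ^ m * (radial m l x)\<^sup>2 * (y x)\<^sup>2)"
      by (simp only: \<sigma>2[OF s])
    then show ?thesis unfolding M_def G_def 1 Seq[OF s] \<sigma>2[OF s] by (simp add: mult_ac)
  qed
  have "G 0 < G t"
  proof (rule DERIV_pos_imp_increasing_open[OF t(1), of G])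
    fix x assume x: "0 < x" "x < t"
    have s: "0 < sin x" using x t by (intro sin_gt_zero) auto
    have xp: "0 < x" "x < pi" "\<bar>x\<bar> < pi" using x t by auto
    have T: "T x > 0" using Tpos[of x] x by simp
    have P: "sin x ^ m > 0" using s by simp
    have Dp: "D x > 0" using Deq[OF s] T P s by (metis mult_pos_pos zero_less_mult_pos2 zero_less_power)
    define q2 where "q2 = 2 * k * ((sin x)\<^sup>2 + 3 * (cos x)\<^sup>2) / sin x ^ 4"
    note dcot = DERIV_cos_over_sin[OF less_imp_neq[OF s, symmetric]]
    have sc: "cos x * cos x = 1 - sin x * sin x" using sin_cos_squared_add[of x] by (simp add: power2_eq_square algebra_simps)
    have dq: "(q has_real_derivative q1 x) (at x)"
      unfolding q_def q1_def
      by (rule DERIV_cong, (rule derivative_intros dcot)+) (use s in \<open>simp add: field_simps power2_eq_square power3_eq_cube sc\<close>)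
    have dq1: "(q1 has_real_derivative q2) (at x)"
      unfolding q1_def q2_def
      by (rule DERIV_cong, (rule derivative_intros)+)
        (use s in \<open>simp_all add: field_simps power2_eq_square power3_eq_cube power4_eq_xxxx\<close>)
    have dw: "(w has_real_derivative w1 x) (at x)" "(w1 has_real_derivative q x * w x) (at x)"
      using liouville_substitution[where Y = "radial m l" and Y' = "radial' m l" and m = m and l = l and g = "0", OF xp(1,2) radial_deriv(1)[OF xp(3)]] radial'_deriv(1)[OF xp(1,2), of m l]
      unfolding w_def w1_def q_def k_def h_def \<sigma>_def by simp_all
    have da: "(a has_real_derivative a1 x) (at x)" "(a1 has_real_derivative q x * a x - w x) (at x)"
      using liouville_substitution[where Y = "radial_dl m l" and Y' = "radial_dl' m l" and m = m and l = l and g = "radial m l x", OF xp(1,2) radial_deriv(2)[OF xp(3)]] radial'_deriv(2)[OF xp(1,2), of m l]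
      unfolding w_def a_def a1_def q_def k_def h_def \<sigma>_def by simp_all
    have db: "(b has_real_derivative b1 x) (at x)" "(b1 has_real_derivative q x * b x - 2 * a x) (at x)"
      using liouville_substitution[where Y = "radial_dll m l" and Y' = "radial_dll' m l" and m = m and l = l and g = "2 * radial_dl m l x", OF xp(1,2) radial_deriv(3)[OF xp(3)]] radial'_deriv(3)[OF xp(1,2), of m l]
      unfolding a_def b_def b1_def q_def k_def h_def \<sigma>_def by (simp_all add: mult_ac)
    define V where "V = 2 * w x ^ 4 * (1 - q1 x * Y x)\<^sup>2 / D x + (w x)\<^sup>2 * q2 * (Y x)\<^sup>2"
    have "(M has_real_derivative V) (at x)"
      using convexity_identity[OF dw da db dq dq1] Dp unfolding M_def[abs_def] V_def Y_def D_def by simp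
    moreover have "open {0<..<t}" "x \<in> {0<..<t}" using x by auto
    ultimately have "(G has_real_derivative V) (at x)"
      by (rule has_field_derivative_transform_within_open) (use t Tpos in \<open>auto intro!: MG sin_gt_zero\<close>)
    moreover have "V > 0"
    proof -
      have "\<sigma> x > 0" using s by (simp add: \<sigma>_def)
      then have "w x \<noteq> 0" using pos[of x] x by (simp add: w_def)
      moreover have "q2 > 0" unfolding q2_def using h s by (intro divide_pos_pos mult_pos_pos) (auto intro: add_pos_nonneg)
      \<comment> \<open>Strictness comes from here: \<open>Y\<close> is a multiple of the Wronskian
        in \<open>l\<close>, so the term with \<open>q2\<close> is positive even where the square
        vanishes.\<close>
      moreover have "Y x \<noteq> 0"
        using radial_wronskian_pos[OF xp(1,2), of m l] pos x T s by (auto simp: Yeq[OF s T] y_def)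
      ultimately have "0 < (w x)\<^sup>2 * q2 * (Y x)\<^sup>2" by simp
      moreover have "0 \<le> 2 * w x ^ 4 * (1 - q1 x * Y x)\<^sup>2 / D x" using Dp by simp
      ultimately show ?thesis by (simp add: V_def)
    qed
    ultimately show "\<exists>y. (G has_real_derivative y) (at x) \<and> y > 0" by blast
  next
    have "continuous (at x within {0..t}) G" if x: "x \<in> {0..t}" for x
    proof -
      have xp: "\<bar>x\<bar> < pi" using x t by auto
      have "continuous (at x within {0..t}) T"
        unfolding T_def by (intro continuous_intros xp)
      then have "continuous (at x within {0..t}) y"
        unfolding y_def using Tpos[of x] x by (intro continuous_intros xp) auto
      then show ?thesis
        unfolding G_def by (intro continuous_intros xp)
    qed
    then show "continuous_on {0..t} G" unfolding continuous_on_eq_continuous_within by blast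
  qed
  moreover have "G 0 = 0" using m by (simp add: G_def)
  moreover have "G t = sin t ^ m * (2 * radial_dl m l t * radial_dl' m l t + real m * cos t / sin t * (radial_dl m l t)\<^sup>2 - radial' m l t * radial_dll m l t)"
  proof -
    have s: "0 < sin t" using t by (rule sin_gt_zero)
    have yt: "y t = - radial_dl m l t / ((sin t)\<^sup>2 * radial' m l t)"
      using s zt by (simp add: y_def T_def field_simps power2_eq_square)
    show ?thesis unfolding G_def mh yt zt(1) using s zt(2) by (simp add: field_simps power2_eq_square)
  qed
  moreover have "0 < sin t ^ m" using t by (intro zero_less_power sin_gt_zero)
  ultimately show ?thesis by (metis zero_less_mult_pos)
qed

theorem cap_eigenvalue_analysis:
  assumes lam: "\<And>t. 0 < t \<Longrightarrow> t < pi \<Longrightarrow> lam t = cap_eigenvalue m t"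
  shows "\<forall>t\<in>{0<..<pi}. lam differentiable (at t) \<and> deriv lam differentiable (at t)"
    and "strict_antimono_on {0<..<pi} lam"
    and "filterlim lam at_top (at_right 0)"
    and "3 \<le> m \<Longrightarrow> 0 < a \<Longrightarrow> a < b \<Longrightarrow> b < pi \<Longrightarrow> 0 < s \<Longrightarrow> s < 1 \<Longrightarrow>
      lam ((1 - s) * a + s * b) < (1 - s) * lam a + s * lam b"
proof -
  define g where "g s = - radial' m (cap_eigenvalue m s) s / radial_dl m (cap_eigenvalue m s) s" for s
  have d1: "(lam has_real_derivative g t) (at t)" if t: "0 < t" "t < pi" for t
  proof -
    have "open {0<..<pi}" "t \<in> {0<..<pi}" using t by auto
    with cap_eigenvalue_deriv[OF t, of m, folded g_def] show ?thesis
      by (rule has_field_derivative_transform_within_open) (use lam in auto)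
  qed
  have d2: "(deriv lam has_real_derivative d) (at t)" if t: "0 < t" "t < pi" and d: "(g has_real_derivative d) (at t)" for t d
  proof -
    have "open {0<..<pi}" "t \<in> {0<..<pi}" using t by auto
    with d show ?thesis
      by (rule has_field_derivative_transform_within_open) (auto intro!: DERIV_imp_deriv[symmetric] d1)
  qed
  note dg = cap_eigenvalue_deriv2[where m = m, folded g_def[abs_def]]
  show "\<forall>t\<in>{0<..<pi}. lam differentiable (at t) \<and> deriv lam differentiable (at t)"
    using d1 d2[OF _ _ dg] by (auto simp: real_differentiable_def intro!: exI)
  show "strict_antimono_on {0<..<pi} lam"
    by (auto intro!: monotone_onI simp: lam cap_eigenvalue_decreasing)
  show "filterlim lam at_top (at_right 0)"
  proof (rule filterlim_at_top_mono)
    show "filterlim (\<lambda>t::real. 1 / t\<^sup>2) at_top (at_right 0)" by real_asymp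
    have "\<forall>\<^sub>F t in at_right (0::real). t \<in> {0<..<pi / 2}" by (rule eventually_at_right_real) simp
    then show "\<forall>\<^sub>F t in at_right 0. 1 / t\<^sup>2 \<le> lam t"
    proof (rule eventually_mono)
      fix t assume "t \<in> {0<..<pi / 2}"
      then show "1 / t\<^sup>2 \<le> lam t" using cap_eigenvalue_lower_bound[of t m] lam[of t] by (simp add: field_simps)
    qed
  qed
  show "lam ((1 - s) * a + s * b) < (1 - s) * lam a + s * lam b"
    if m: "3 \<le> m" and ab: "0 < a" "a < b" "b < pi" and s: "0 < s" "s < 1"
  proof -
    define c where "c = (1 - s) * a + s * b"
    have ca: "c - a = s * (b - a)" and bc: "b - c = (1 - s) * (b - a)" by (simp_all add: c_def algebra_simps)
    have "0 < c - a" "0 < b - c" unfolding ca bc using ab s by auto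
    then have c: "a < c" "c < b" by auto
    have ginc: "g x < g y" if "0 < x" "x < y" "y < pi" for x y
    proof (rule DERIV_pos_imp_increasing[OF that(2)])
      fix z assume "x \<le> z" "z \<le> y"
      then have z: "0 < z" "z < pi" using that by auto
      have "radial' m (cap_eigenvalue m z) z / radial_dl m (cap_eigenvalue m z) z ^ 3 > 0"
        using cap_eigenvalue_facts[OF z, of m] by (simp add: zero_less_divide_iff)
      then show "\<exists>d. (g has_real_derivative d) (at z) \<and> 0 < d"
        using dg[OF z] cap_eigenvalue_convexity[OF m z] by (meson mult_pos_pos)
    qed
    obtain x where x: "a < x" "x < c" "lam c - lam a = (c - a) * g x"
      using MVT2[OF c(1), of lam g] d1 ab c by auto
    obtain y where y: "c < y" "y < b" "lam b - lam c = (b - c) * g y"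
      using MVT2[OF c(2), of lam g] d1 ab c by auto
    have "g x < g y" using ginc[of x y] x y ab by simp
    have "(1 - s) * lam a + s * lam b - lam c = s * (lam b - lam c) - (1 - s) * (lam c - lam a)" by (simp add: algebra_simps)
    also have "\<dots> = s * (1 - s) * (b - a) * (g y - g x)" unfolding x(3) y(3) ca bc by (simp add: algebra_simps)
    also have "\<dots> > 0" using s ab \<open>g x < g y\<close> by simp
    finally show ?thesis by (simp add: c_def)
  qed
qed

subsection \<open>Hausdorff measure on the sphere\<close>

lemma hausdorff_pre_isometry:
  assumes iso: "\<And>x y. dist (f x) (f y) = dist x y"
  shows "hausdorff_pre s \<delta> (f ` A) \<le> hausdorff_pre s \<delta> A"
  unfolding hausdorff_pre_def[of s \<delta> A]
proof (rule INF_greatest, clarify)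
  fix U :: "nat \<Rightarrow> 'a set"
  assume U: "A \<subseteq> (\<Union>i. U i)" "\<forall>i. bounded (U i) \<and> diameter (U i) \<le> \<delta>"
  have bd: "bounded (f ` U i)" for i
  proof -
    obtain a b where "\<forall>x\<in>U i. dist a x \<le> b" using U(2) unfolding bounded_def by blast
    then show ?thesis unfolding bounded_def by (intro exI[of _ "f a"] exI[of _ b]) (auto simp: iso)
  qed
  have diam: "diameter (f ` U i) = diameter (U i)" for i
  proof -
    have "(\<lambda>(x, y). dist x y) ` (f ` U i \<times> f ` U i) = (\<lambda>(x, y). dist x y) ` (U i \<times> U i)"
      by (force simp: iso image_iff)
    then show ?thesis unfolding diameter_def by (simp add: case_prod_beta')
  qed
  have "hausdorff_pre s \<delta> (f ` A) \<le> (\<Sum>i. hausdorff_gauge s (f ` U i))"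
    unfolding hausdorff_pre_def using U bd diam image_mono[OF U(1), of f] by (intro INF_lower) (auto simp: image_UN)
  also have "\<dots> = (\<Sum>i. hausdorff_gauge s (U i))"
    by (simp add: hausdorff_gauge_def diam cong: if_cong)
  finally show "hausdorff_pre s \<delta> (f ` A) \<le> (\<Sum>i. hausdorff_gauge s (U i))" .
qed

lemma hausdorff_outer_isometry:
  assumes "\<And>x y. dist (f x) (f y) = dist x y"
  shows "hausdorff_outer s (f ` A) \<le> hausdorff_outer s A"
  unfolding hausdorff_outer_def by (intro SUP_mono') (simp add: hausdorff_pre_isometry assms)

text \<open>An isometry does not increase the outer measure; this is applied to the map and to its
  inverse.\<close>

lemma hausdorff_outer_orthogonal:
  fixes f :: "'a::euclidean_space \<Rightarrow> 'a"
  assumes f: "orthogonal_transformation f"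
  shows "hausdorff_outer s (f ` A) = hausdorff_outer s A"
proof (rule antisym)
  have iso: "dist (h x) (h y) = dist x y" if "orthogonal_transformation h" for h :: "'a \<Rightarrow> 'a" and x y
    using that unfolding orthogonal_transformation_isometry by blast
  show "hausdorff_outer s (f ` A) \<le> hausdorff_outer s A"
    by (intro hausdorff_outer_isometry iso f)
  have "inv f ` f ` A = A"
    using orthogonal_transformation_inj[OF f] by (simp add: image_inv_f_f)
  with hausdorff_outer_isometry[of "inv f" s "f ` A"] iso[OF orthogonal_transformation_inv[OF f]]
  show "hausdorff_outer s A \<le> hausdorff_outer s (f ` A)" by simp
qed

lemma space_sphere_measure [simp]: "space sphere_measure = sphere 0 1"
  by (simp add: sphere_measure_def space_restrict_space)

lemma sets_sphere_measure [measurable_cong]: "sets sphere_measure = sets (restrict_space borel (sphere 0 1))"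
  unfolding sphere_measure_def by (intro sets_restrict_space_cong) simp

lemma sets_sphere_measureD: "B \<in> sets (sphere_measure :: (real ^ 'n) measure) \<Longrightarrow> B \<in> sets borel \<and> B \<subseteq> sphere 0 1"
  unfolding sets_sphere_measure by (auto simp: sets_restrict_space)

lemma sets_sphere_measureI: "B \<in> sets borel \<Longrightarrow> B \<subseteq> sphere 0 1 \<Longrightarrow> B \<in> sets (sphere_measure :: (real ^ 'n) measure)"
  unfolding sets_sphere_measure by (auto simp: sets_restrict_space)

lemma emeasure_sphere_measure:
  assumes "B \<in> sets (sphere_measure :: (real ^ 'n) measure)"
  shows "emeasure (sphere_measure :: (real ^ 'n) measure) B = hausdorff_outer (CARD('n) - 1) B"
  using sets_sphere_measureD[OF assms] unfolding sphere_measure_def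
  by (subst emeasure_restrict_space) (auto simp: emeasure_hausdorff_measure)

lemma borel_measurable_sphere_continuous:
  "continuous_on (sphere 0 1) f \<Longrightarrow> f \<in> borel_measurable (sphere_measure :: (real ^ 'n) measure)"
  using borel_measurable_continuous_on_restrict measurable_cong_sets[OF sets_sphere_measure refl] by blast

lemma orthogonal_measurable_sphere:
  fixes f :: "real ^ 'n \<Rightarrow> real ^ 'n"
  assumes f: "orthogonal_transformation f"
  shows "f \<in> measurable sphere_measure sphere_measure"
proof -
  have "continuous_on (sphere 0 1) f"
    using orthogonal_transformation_linear[OF f] by (intro linear_continuous_on) (simp add: linear_conv_bounded_linear)
  then have "f \<in> borel_measurable sphere_measure" by (rule borel_measurable_sphere_continuous)
  then show ?thesis
    unfolding measurable_cong_sets[OF refl sets_sphere_measure]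
    by (intro measurable_restrict_space2) (auto simp: orthogonal_transformation_norm[OF f])
qed

lemma distr_sphere_measure:
  fixes f :: "real ^ 'n \<Rightarrow> real ^ 'n"
  assumes f: "orthogonal_transformation f"
  shows "distr sphere_measure sphere_measure f = sphere_measure"
proof (rule measure_eqI)
  fix B assume B: "B \<in> sets (distr sphere_measure sphere_measure f)"
  then have B': "B \<in> sets sphere_measure" by simp
  define C where "C = f -` B \<inter> space sphere_measure"
  have C: "C \<in> sets sphere_measure" unfolding C_def
    using measurable_sets[OF orthogonal_measurable_sphere[OF f] B'] .
  have "f ` C = B"
  proof
    show "f ` C \<subseteq> B" by (auto simp: C_def)
    show "B \<subseteq> f ` C"
    proof
      fix y assume y: "y \<in> B"
      obtain x where x: "y = f x" using orthogonal_transformation_surj[OF f] by (metis surjD)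
      have "norm y = 1" using y sets_sphere_measureD[OF B'] by auto
      then show "y \<in> f ` C" using x y by (auto simp: C_def orthogonal_transformation_norm[OF f])
    qed
  qed
  have "emeasure (distr sphere_measure sphere_measure f) B = emeasure sphere_measure C"
    unfolding C_def by (rule emeasure_distr[OF orthogonal_measurable_sphere[OF f] B'])
  also have "\<dots> = hausdorff_outer (CARD('n) - 1) (f ` C)"
    by (simp add: emeasure_sphere_measure[OF C] hausdorff_outer_orthogonal[OF f])
  also have "\<dots> = emeasure sphere_measure B"
    by (simp add: \<open>f ` C = B\<close> emeasure_sphere_measure[OF B'])
  finally show "emeasure (distr sphere_measure sphere_measure f) B = emeasure sphere_measure B" .
qed simp

lemma integral_sphere_orthogonal:
  fixes f :: "real ^ 'n \<Rightarrow> real ^ 'n" and u :: "real ^ 'n \<Rightarrow> real"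
  assumes f: "orthogonal_transformation f" and u: "u \<in> borel_measurable sphere_measure"
  shows "(LINT x|sphere_measure. u (f x)) = (LINT x|sphere_measure. u x)"
  using integral_distr[OF orthogonal_measurable_sphere[OF f] u] by (simp add: distr_sphere_measure[OF f])

section \<open>Finiteness of the surface measure and its positivity on caps\<close>

lemma power_diff_le:
  fixes a b :: real
  assumes "0 \<le> b" "b \<le> a" "a \<le> c"
  shows "a ^ n - b ^ n \<le> real n * c ^ (n - 1) * (a - b)"
proof -
  have "a ^ n - b ^ n = (a - b) * (\<Sum>i<n. a ^ i * b ^ (n - 1 - i))"
    by (simp add: power_diff_sumr2 mult.commute)
  moreover have "(\<Sum>i<n. a ^ i * b ^ (n - 1 - i)) \<le> (\<Sum>i<n. c ^ (n - 1))"
  proof (rule sum_mono)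
    fix i assume "i \<in> {..<n}"
    then have "c ^ (n - 1) = c ^ i * c ^ (n - 1 - i)" by (simp add: power_add[symmetric])
    moreover have "a ^ i * b ^ (n - 1 - i) \<le> c ^ i * c ^ (n - 1 - i)"
      using assms by (intro mult_mono power_mono) auto
    ultimately show "a ^ i * b ^ (n - 1 - i) \<le> c ^ (n - 1)" by simp
  qed
  ultimately show ?thesis using mult_left_mono[of "\<Sum>i<n. a ^ i * b ^ (n - 1 - i)" "\<Sum>i<n. c ^ (n - 1)" "a - b"] assms
    by (simp add: mult_ac)
qed

text \<open>The disjoint balls of radius \<open>r / 2\<close> around the points lie in an annulus of width proportional to \<open>r\<close>.\<close>

lemma separated_card_bound:
  fixes D :: "(real ^ 'n) set"
  assumes D: "finite D" "D \<subseteq> sphere 0 1" "\<And>x y. x \<in> D \<Longrightarrow> y \<in> D \<Longrightarrow> x \<noteq> y \<Longrightarrow> r \<le> dist x y"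
    and r: "0 < r" "r \<le> 1"
  shows "real (card D) * r ^ (CARD('n) - 1) \<le> real CARD('n) * 4 ^ CARD('n)"
proof -
  let ?N = "CARD('n)"
  define V where "V = measure lborel (ball (0 :: real ^ 'n) 1)"
  have V: "V > 0" unfolding V_def by (simp add: content_ball_pos)
  have cb: "measure lborel (ball c q) = q ^ ?N * V" if "q > 0" for c :: "real ^ 'n" and q
    using content_ball_conv_unit_ball[of q c] that by (simp add: V_def)
  have fin: "emeasure lborel (ball c q) \<noteq> top" for c :: "real ^ 'n" and q
    using emeasure_bounded_finite[of "ball c q"] by simp
  have disj: "disjoint_family_on (\<lambda>d. ball d (r / 2)) D"
  proof (unfold disjoint_family_on_def, intro ballI impI)
    fix x y assume "x \<in> D" "y \<in> D" "x \<noteq> y"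
    then have "r \<le> dist x y" by (rule D(3))
    have "\<not> (dist x z < r / 2 \<and> dist y z < r / 2)" for z
      using \<open>r \<le> dist x y\<close> dist_triangle[of x y z] dist_commute[of y z] by linarith
    then show "ball x (r / 2) \<inter> ball y (r / 2) = {}" by auto
  qed
  have "real (card D) * ((r / 2) ^ ?N * V) = (\<Sum>d\<in>D. measure lborel (ball d (r / 2)))" using r by (simp add: cb)
  also have "\<dots> = measure lborel (\<Union>d\<in>D. ball d (r / 2))"
    by (rule measure_finite_Union[symmetric]) (use D disj in \<open>auto simp: fin\<close>)
  also have "\<dots> \<le> measure lborel (ball 0 (1 + r) - ball (0::real ^ 'n) (1 - r / 2))"
  proof (rule measure_mono_fmeasurable)
    show "(\<Union>d\<in>D. ball d (r / 2)) \<subseteq> ball 0 (1 + r) - ball 0 (1 - r / 2)"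
    proof
      fix x assume "x \<in> (\<Union>d\<in>D. ball d (r / 2))"
      then obtain d where d: "norm d = 1" "norm (d - x) < r / 2" using D(2) by (auto simp: dist_norm)
      have "norm d \<le> norm x + norm (d - x)" "norm x \<le> norm d + norm (d - x)"
        using norm_triangle_ineq[of x "d - x"] norm_triangle_ineq4[of d "d - x"] by auto
      then show "x \<in> ball 0 (1 + r) - ball 0 (1 - r / 2)" using d r by auto
    qed
    show "ball 0 (1 + r) - ball (0::real ^ 'n) (1 - r / 2) \<in> fmeasurable lborel"
      by (intro fmeasurable.Diff fmeasurableI) (auto simp: fin top.not_eq_extremum[symmetric])
  qed (auto intro!: borel_open open_UN)
  also have "\<dots> = measure lborel (ball (0::real ^ 'n) (1 + r)) - measure lborel (ball (0::real ^ 'n) (1 - r / 2))"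
    using r by (intro measure_Diff) (auto simp: fin)
  also have "\<dots> = ((1 + r) ^ ?N - (1 - r / 2) ^ ?N) * V" using r by (simp add: cb algebra_simps)
  \<comment> \<open>Both radii of the annulus are at most 2; its width 3 r / 2 is rounded up to 2 r
    in the next step.\<close>
  also have "\<dots> \<le> (real ?N * 2 ^ (?N - 1) * ((1 + r) - (1 - r / 2))) * V"
    using r V by (intro mult_right_mono power_diff_le) auto
  also have "\<dots> \<le> (real ?N * 2 ^ (?N - 1) * (2 * r)) * V"
    using r V by (intro mult_right_mono mult_left_mono) auto
  finally have F: "real (card D) * (r / 2) ^ ?N \<le> real ?N * 2 ^ (?N - 1) * (2 * r)" using V by simp
  obtain M where M: "?N = Suc M" using not0_implies_Suc[of "CARD('n)"] by auto
  have e1: "(r / 2) ^ ?N = r ^ (?N - 1) * r / 2 ^ ?N"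
    by (simp add: M power_divide)
  have e2: "2 ^ (?N - 1) * (2 * r) = 2 ^ ?N * r"
    by (simp add: M)
  have "real (card D) * (r ^ (?N - 1) * r / 2 ^ ?N) \<le> real ?N * (2 ^ ?N * r)"
    using F unfolding e1 mult.assoc[of "real ?N"] e2 by simp
  then have "real (card D) * r ^ (?N - 1) \<le> real ?N * (2 ^ ?N * 2 ^ ?N)" using r by (simp add: field_simps)
  then show ?thesis by (simp add: power_mult_distrib[symmetric])
qed

text \<open>An r-separated set of largest cardinality exists by the bound on cardinalities. It is a
  net, since a point left uncovered could be added to it.\<close>

lemma sphere_net_exists:
  assumes r: "0 < r" "r \<le> 1"
  shows "\<exists>D :: (real ^ 'n) set. finite D \<and> D \<subseteq> sphere 0 1 \<and> sphere 0 1 \<subseteq> (\<Union>d\<in>D. ball d r) \<and>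
    real (card D) * r ^ (CARD('n) - 1) \<le> real CARD('n) * 4 ^ CARD('n)"
proof -
  define P where "P D \<longleftrightarrow> finite D \<and> D \<subseteq> sphere 0 1 \<and> (\<forall>x\<in>D. \<forall>y\<in>D. x \<noteq> y \<longrightarrow> r \<le> dist x y)" for D :: "(real ^ 'n) set"
  define C where "C = real CARD('n) * 4 ^ CARD('n)"
  have bd: "real (card D) * r ^ (CARD('n) - 1) \<le> C" if "P D" for D
    unfolding C_def by (rule separated_card_bound) (use that r in \<open>auto simp: P_def\<close>)
  have "card D \<le> nat \<lceil>C / r ^ (CARD('n) - 1)\<rceil>" if "P D" for D
  proof -
    have "real (card D) \<le> C / r ^ (CARD('n) - 1)" using bd[OF that] r by (simp add: field_simps)
    then show ?thesis by linarith
  qed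
  then have "\<forall>D. P D \<longrightarrow> card D < Suc (nat \<lceil>C / r ^ (CARD('n) - 1)\<rceil>)" by (simp add: less_Suc_eq_le)
  moreover have "P {}" by (simp add: P_def)
  ultimately have "\<exists>D. P D \<and> (\<forall>E. P E \<longrightarrow> card E \<le> card D)"
    using ex_has_greatest_nat[of P "{}" card] by simp
  then obtain D where D: "P D" "\<And>E. P E \<Longrightarrow> card E \<le> card D" by blast
  have "sphere 0 1 \<subseteq> (\<Union>d\<in>D. ball d r)"
  proof (rule subsetI, rule ccontr)
    fix x :: "real ^ 'n" assume x: "x \<in> sphere 0 1" "x \<notin> (\<Union>d\<in>D. ball d r)"
    then have "x \<notin> D" using r by auto
    moreover have "P (insert x D)" using D(1) x by (auto simp: P_def dist_commute not_less)
    ultimately show False using D(2)[of "insert x D"] D(1) by (simp add: P_def)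
  qed
  then show ?thesis using D(1) bd[OF D(1)] unfolding P_def C_def by blast
qed

text \<open>At every scale \<delta> the sphere is covered by balls about a net. Their number is at
  most a constant over \<open>r ^ (n - 1)\<close>, which the gauges of the balls compensate, so the
  bound C does not depend on \<delta>.\<close>

lemma finite_measure_sphere: "finite_measure (sphere_measure :: (real ^ 'n) measure)"
proof
  let ?N = "CARD('n)"
  define C where "C = unit_ball_vol (real (?N - 1)) * (real ?N * 4 ^ ?N)"
  have "hausdorff_pre (?N - 1) \<delta> (sphere (0::real ^ 'n) 1) \<le> ennreal C" if \<delta>: "\<delta> > 0" for \<delta>
  proof -
    define r where "r = min (\<delta> / 2) 1"
    have r: "0 < r" "r \<le> 1" "2 * r \<le> \<delta>" using \<delta> by (auto simp: r_def)
    obtain D :: "(real ^ 'n) set" where D: "finite D" "sphere 0 1 \<subseteq> (\<Union>d\<in>D. ball d r)"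
      "real (card D) * r ^ (?N - 1) \<le> real ?N * 4 ^ ?N" using sphere_net_exists[OF r(1,2)] by blast
    obtain e where e: "bij_betw e {..<card D} D" using D(1) ex_bij_betw_nat_finite[of D] by (auto simp: atLeast0LessThan)
    define U where "U k = (if k < card D then ball (e k) r else {})" for k
    have cov: "sphere 0 1 \<subseteq> (\<Union>k. U k)"
    proof
      fix x :: "real ^ 'n" assume "x \<in> sphere 0 1"
      then obtain d where "d \<in> D" "x \<in> ball d r" using D(2) by blast
      moreover obtain k where "k < card D" "d = e k" using e \<open>d \<in> D\<close> by (auto simp: bij_betw_def)
      ultimately have "x \<in> U k" by (simp add: U_def)
      then show "x \<in> (\<Union>k. U k)" by blast
    qed
    have "hausdorff_pre (?N - 1) \<delta> (sphere (0::real ^ 'n) 1) \<le> (\<Sum>k. hausdorff_gauge (?N - 1) (U k))"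
      unfolding hausdorff_pre_def using cov r \<delta> by (intro INF_lower) (auto simp: U_def)
    also have "\<dots> = (\<Sum>k<card D. hausdorff_gauge (?N - 1) (U k))"
      by (rule suminf_finite) (auto simp: U_def hausdorff_gauge_def)
    also have "\<dots> \<le> (\<Sum>k<card D. ennreal (unit_ball_vol (real (?N - 1)) * r ^ (?N - 1)))"
      using r by (intro sum_mono) (auto simp: U_def hausdorff_gauge_def)
    also have "\<dots> = ennreal (real (card D) * (unit_ball_vol (real (?N - 1)) * r ^ (?N - 1)))"
      using r by (simp add: ennreal_of_nat_eq_real_of_nat ennreal_mult')
    also have "\<dots> \<le> ennreal C"
      using mult_left_mono[OF D(3), of "unit_ball_vol (real (?N - 1))"] unfolding C_def
      by (intro ennreal_leI) (simp add: mult_ac)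
    finally show ?thesis .
  qed
  then have "hausdorff_outer (?N - 1) (sphere (0::real ^ 'n) 1) \<le> ennreal C"
    unfolding hausdorff_outer_def by (intro SUP_least) auto
  also have "\<dots> < \<infinity>" by simp
  finally show "emeasure (sphere_measure :: (real ^ 'n) measure) (space sphere_measure) \<noteq> \<infinity>"
    by (subst emeasure_sphere_measure) (auto intro!: sets_sphere_measureI)
qed

text \<open>Sweeping a cover of the cap in the direction of the axis gives a cover of a box of positive Lebesgue measure by
  boxes of volume at most a constant times the power \<open>n - 1\<close> of the diameter.\<close>

lemma sphere_cap_pos:
  fixes i :: "'n::finite"
  assumes c: "c < 1"
  shows "emeasure (sphere_measure :: (real ^ 'n) measure) {x \<in> sphere 0 1. c < x $ i} > 0"
proof -
  let ?N = "CARD('n)"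
  let ?cap = "{x :: real ^ 'n. x \<in> sphere 0 1 \<and> c < x $ i}"
  \<comment> \<open>Raising c to at least 1/2 shrinks the cap. The points of the cap found below
    then have height z > 1/2, so a shift by at most 1 along the axis reaches every height between 1
    and 3/2.\<close>
  define b where "b = max c (1 / 2)"
  have b: "1 / 2 \<le> b" "b < 1" "c \<le> b" using c by (auto simp: b_def)
  \<comment> \<open>Chosen so that the transversal coordinates together contribute at most (1 - b) /
    2 to the squared norm.\<close>
  define q where "q = sqrt ((1 - b) / (2 * real ?N))"
  have q: "q > 0" "real ?N * q\<^sup>2 = (1 - b) / 2" using b by (auto simp: q_def)
  define lo hi where "lo = (\<chi> j. if j = i then 1 else - q)" and "hi = (\<chi> j. if j = i then 3 / 2 else q)"
  define T where "T = cbox lo hi"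
  have T_pos: "emeasure lborel T > 0"
  proof -
    have "0 < measure lborel T" unfolding T_def
      by (subst content_cbox_cart) (auto simp: lo_def hi_def interval_eq_empty_cart intro!: prod_pos, (use q in \<open>simp split: if_splits\<close>)+)
    then show ?thesis by (auto simp: measure_def zero_less_iff_neq_zero)
  qed
  have T_shift: "\<exists>x \<in> ?cap. \<exists>s. 0 \<le> s \<and> s \<le> 1 \<and> y = x + axis i s" if y: "y \<in> T" for y
  proof -
    have yi: "1 \<le> y $ i" "y $ i \<le> 3 / 2" and yj: "\<And>j. j \<noteq> i \<Longrightarrow> (y $ j)\<^sup>2 \<le> q\<^sup>2"
      using y q by (auto simp: T_def mem_box_cart lo_def hi_def power2_le_iff_abs_le abs_le_iff split: if_splits)
    define Q where "Q = (\<Sum>j\<in>UNIV - {i}. (y $ j)\<^sup>2)"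
    have "Q \<le> (\<Sum>j\<in>UNIV - {i}. q\<^sup>2)" unfolding Q_def by (intro sum_mono yj) auto
    also have "\<dots> \<le> real ?N * q\<^sup>2" by (simp add: mult_right_mono)
    also have "\<dots> < 1 - b" using q b by simp
    finally have Q: "0 \<le> Q" "Q < 1 - b" by (auto simp: Q_def sum_nonneg)
    define z where "z = sqrt (1 - Q)"
    have z2: "z\<^sup>2 = 1 - Q" using Q b by (simp add: z_def)
    have "b\<^sup>2 \<le> b" using b by (simp add: power2_eq_square mult_left_le)
    then have z: "b < z" "z \<le> 1" using Q unfolding z_def by (auto intro!: real_less_rsqrt)
    define x where "x = (\<chi> j. if j = i then z else y $ j)"
    have "(norm x)\<^sup>2 = (\<Sum>j\<in>UNIV. (x $ j)\<^sup>2)" by (simp add: norm_vec_def L2_set_def sum_nonneg)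
    also have "\<dots> = (x $ i)\<^sup>2 + (\<Sum>j\<in>UNIV - {i}. (x $ j)\<^sup>2)" by (subst sum.remove[of _ i]) auto
    also have "(\<Sum>j\<in>UNIV - {i}. (x $ j)\<^sup>2) = Q" unfolding Q_def by (intro sum.cong) (auto simp: x_def)
    finally have "norm x = 1" using z2 by (simp add: x_def abs_square_eq_1)
    then have "x \<in> ?cap" using z b by (simp add: x_def)
    moreover have "y = x + axis i (y $ i - z)" by (auto simp: vec_eq_iff x_def axis_def)
    moreover have "0 \<le> y $ i - z" "y $ i - z \<le> 1" using yi z b by auto
    ultimately show ?thesis by blast
  qed
  define \<omega> where "\<omega> = unit_ball_vol (real (?N - 1))"
  have ub: "\<omega> > 0" unfolding \<omega>_def by (rule unit_ball_vol_pos) simp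
  \<comment> \<open>A set of diameter d \<le> 1, swept over length 1 along the axis, lies in a box
    with one side \<open>2 * d + 1 \<le> 3\<close> and all other sides
    \<open>2 * d = 4 * (d / 2)\<close>. K bounds the ratio of its volume to the gauge of the
    set.\<close>
  define K where "K = 3 * 4 ^ (?N - 1) / \<omega>"
  have K: "K > 0" unfolding K_def using ub by (intro divide_pos_pos) auto
  have "ennreal (1 / K) * emeasure lborel T \<le> hausdorff_pre (?N - 1) 1 ?cap"
    unfolding hausdorff_pre_def
  proof (rule INF_greatest, clarify)
    fix U :: "nat \<Rightarrow> (real ^ 'n) set"
    assume cov: "?cap \<subseteq> (\<Union>k. U k)" and U: "\<forall>k. bounded (U k) \<and> diameter (U k) \<le> 1"
    define p where "p k = (SOME x. x \<in> U k)" for k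
    define d where "d k = diameter (U k)" for k
    have d: "0 \<le> d k" "d k \<le> 1" for k using U diameter_ge_0 by (auto simp: d_def)
    define lo' where "lo' k = (\<chi> j. p k $ j - d k)" for k
    define hi' where "hi' k = (\<chi> j. p k $ j + d k + (if j = i then 1 else 0))" for k
    define E where "E k = (if U k = {} then {} else cbox (lo' k) (hi' k))" for k
    have sub: "T \<subseteq> (\<Union>k. E k)"
    proof
      fix y assume "y \<in> T"
      then obtain x s where xs: "x \<in> ?cap" "0 \<le> s" "s \<le> 1" "y = x + axis i s" using T_shift by blast
      then obtain k where k: "x \<in> U k" using cov by blast
      have "p k \<in> U k" unfolding p_def using k by (rule someI)
      then have "dist x (p k) \<le> d k" unfolding d_def using k U by (intro diameter_bounded_bound) auto
      then have "\<bar>x $ j - p k $ j\<bar> \<le> d k" for j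
        using component_le_norm_cart[of "x - p k" j] by (simp add: dist_norm)
      then have "p k $ j - d k \<le> x $ j \<and> x $ j \<le> p k $ j + d k" for j by (simp add: abs_le_iff) (smt (verit))
      then have "y \<in> cbox (lo' k) (hi' k)" using xs
        by (auto simp: mem_box_cart lo'_def hi'_def axis_def intro: add_mono order_trans) (smt (verit))+
      then show "y \<in> (\<Union>k. E k)" using k by (auto simp: E_def)
    qed
    have Ek: "emeasure lborel (E k) \<le> ennreal K * hausdorff_gauge (?N - 1) (U k)" for k
    proof (cases "U k = {}")
      case True
      then show ?thesis by (simp add: E_def)
    next
      case False
      have ne: "cbox (lo' k) (hi' k) \<noteq> {}" using d[of k] by (auto simp: interval_ne_empty_cart lo'_def hi'_def)
      have "measure lborel (cbox (lo' k) (hi' k)) = (\<Prod>j\<in>UNIV. 2 * d k + (if j = i then 1 else 0))"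
        unfolding content_cbox_cart[OF ne] by (intro prod.cong) (auto simp: lo'_def hi'_def)
      also have "\<dots> = (2 * d k + 1) * (\<Prod>j\<in>UNIV - {i}. 2 * d k)"
        by (subst prod.remove[of _ i]) (auto intro!: prod.cong)
      also have "\<dots> = (2 * d k + 1) * (2 * d k) ^ (?N - 1)" by (simp add: card_Diff_singleton)
      also have "\<dots> \<le> 3 * (2 * d k) ^ (?N - 1)" using d[of k] by (intro mult_right_mono) auto
      also have "2 * d k = 4 * (d k / 2)" by simp
      also have "(4 * (d k / 2)) ^ (?N - 1) = 4 ^ (?N - 1) * (d k / 2) ^ (?N - 1)" by (rule power_mult_distrib)
      finally have "measure lborel (cbox (lo' k) (hi' k)) \<le> K * (\<omega> * (d k / 2) ^ (?N - 1))"
        using ub by (simp add: K_def)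
      then have "ennreal (measure lborel (cbox (lo' k) (hi' k))) \<le> ennreal K * ennreal (\<omega> * (d k / 2) ^ (?N - 1))"
        using K ub d[of k] by (subst ennreal_mult[symmetric]) (auto intro!: ennreal_leI)
      then show ?thesis using False
        unfolding hausdorff_gauge_def \<omega>_def[symmetric] d_def[symmetric]
        using emeasure_eq_ennreal_measure[of lborel "cbox (lo' k) (hi' k)"] emeasure_bounded_finite[OF bounded_cbox, of "lo' k" "hi' k"]
        by (simp add: E_def less_top)
    qed
    have "emeasure lborel T \<le> emeasure lborel (\<Union>k. E k)" using sub by (intro emeasure_mono) (auto simp: E_def)
    also have "\<dots> \<le> (\<Sum>k. emeasure lborel (E k))" by (intro emeasure_subadditive_countably) (auto simp: E_def)
    also have "\<dots> \<le> (\<Sum>k. ennreal K * hausdorff_gauge (?N - 1) (U k))" by (intro suminf_le Ek summableI)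
    also have "\<dots> = ennreal K * (\<Sum>k. hausdorff_gauge (?N - 1) (U k))" by (rule ennreal_suminf_cmult)
    finally have "ennreal (1 / K) * emeasure lborel T \<le> ennreal (1 / K) * (ennreal K * (\<Sum>k. hausdorff_gauge (?N - 1) (U k)))"
      by (intro mult_left_mono) auto
    also have "\<dots> = (\<Sum>k. hausdorff_gauge (?N - 1) (U k))"
      using K by (subst mult.assoc[symmetric], subst ennreal_mult[symmetric]) auto
    finally show "ennreal (1 / K) * emeasure lborel T \<le> (\<Sum>k. hausdorff_gauge (?N - 1) (U k))" .
  qed
  also have "\<dots> \<le> hausdorff_outer (?N - 1) ?cap"
    unfolding hausdorff_outer_def by (intro SUP_upper) auto
  also have "\<dots> = emeasure sphere_measure ?cap"
  proof (rule emeasure_sphere_measure[symmetric], rule sets_sphere_measureI)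
    have "?cap = sphere 0 1 \<inter> {x. c < x $ i}" by auto
    moreover have "open {x :: real ^ 'n. c < x $ i}" by (intro open_Collect_less continuous_intros)
    ultimately show "?cap \<in> sets borel" by auto
  qed auto
  finally show ?thesis using T_pos K by (auto simp: ennreal_zero_less_mult_iff intro: less_le_trans[rotated])
qed

subsection \<open>Integration by parts on the sphere\<close>

text \<open>Carrying the gradient along explicitly gives tangency and continuity at once;
  \<open>sphere_gradient\<close>, a definite description, is identified with it by
  uniqueness.\<close>

definition sphere_C1 :: "('a::euclidean_space \<Rightarrow> real) \<Rightarrow> ('a \<Rightarrow> 'a) \<Rightarrow> bool" where
  "sphere_C1 u g \<longleftrightarrow> continuous_on (sphere 0 1) g \<and>
     (\<forall>x\<in>sphere 0 1. g x \<bullet> x = 0 \<and> (u has_derivative (\<lambda>v. g x \<bullet> v)) (at x within sphere 0 1))"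

lemma sphere_C1D:
  assumes "sphere_C1 u g" "norm x = 1"
  shows "g x \<bullet> x = 0" "(u has_derivative (\<lambda>v. g x \<bullet> v)) (at x within sphere 0 1)"
  using assms by (auto simp: sphere_C1_def)

lemma sphere_C1_continuous:
  assumes "sphere_C1 u g"
  shows "continuous_on (sphere 0 1) g" "continuous_on (sphere 0 1) u"
  using assms has_derivative_continuous unfolding sphere_C1_def continuous_on_eq_continuous_within by blast+

lemma sphere_gradient_eq:
  assumes "sphere_C1 u g" "norm x = 1"
  shows "sphere_gradient u x = g x"
  unfolding sphere_gradient_def
proof (rule the_equality)
  show "g x \<bullet> x = 0 \<and> (u has_derivative (\<lambda>v. g x \<bullet> v)) (at x within sphere 0 1)"
    using sphere_C1D[OF assms] by blast
  show "h = g x" if "h \<bullet> x = 0 \<and> (u has_derivative (\<lambda>v. h \<bullet> v)) (at x within sphere 0 1)" for h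
    using sphere_gradient_unique[of x h u "g x"] that sphere_C1D[OF assms] assms(2) by simp
qed

lemma sphere_C1_cong:
  assumes "sphere_C1 u g" "\<And>x. norm x = 1 \<Longrightarrow> u x = v x" "\<And>x. norm x = 1 \<Longrightarrow> g x = h x"
  shows "sphere_C1 v h"
proof -
  have "continuous_on (sphere 0 1) h" using sphere_C1_continuous(1)[OF assms(1)] assms(3)
    by (subst continuous_on_cong[OF refl, of _ h g]) auto
  moreover have "(v has_derivative (\<lambda>w. g x \<bullet> w)) (at x within sphere 0 1)" if "norm x = 1" for x
    by (rule has_derivative_transform[OF _ _ sphere_C1D(2)[OF assms(1) that]]) (use that assms(2) in auto)
  ultimately show ?thesis unfolding sphere_C1_def using sphere_C1D(1)[OF assms(1)] assms(3) by auto
qed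

lemma sphere_C1_mult:
  assumes "sphere_C1 u g" "sphere_C1 v h"
  shows "sphere_C1 (\<lambda>x. u x * v x) (\<lambda>x. u x *\<^sub>R h x + v x *\<^sub>R g x)"
  unfolding sphere_C1_def
proof (intro conjI ballI)
  show "continuous_on (sphere 0 1) (\<lambda>x. u x *\<^sub>R h x + v x *\<^sub>R g x)"
    by (intro continuous_intros sphere_C1_continuous(2)[OF assms(1)] sphere_C1_continuous(2)[OF assms(2)]
      sphere_C1_continuous(1)[OF assms(1)] sphere_C1_continuous(1)[OF assms(2)])
  fix x :: 'a assume "x \<in> sphere 0 1"
  then have x: "norm x = 1" by simp
  show "(u x *\<^sub>R h x + v x *\<^sub>R g x) \<bullet> x = 0"
    using sphere_C1D(1)[OF assms(1) x] sphere_C1D(1)[OF assms(2) x] by (simp add: inner_add_left)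
  show "((\<lambda>x. u x * v x) has_derivative (\<lambda>w. (u x *\<^sub>R h x + v x *\<^sub>R g x) \<bullet> w)) (at x within sphere 0 1)"
    by (rule has_derivative_eq_rhs[OF has_derivative_mult[OF sphere_C1D(2)[OF assms(1) x] sphere_C1D(2)[OF assms(2) x]]])
      (simp add: fun_eq_iff inner_add_left mult_ac)
qed

text \<open>Subtracting a multiple of \<open>y \<bullet> y - 1\<close>, which vanishes on the sphere, makes an ambient
  derivative tangential.\<close>

lemma has_derivative_within_sphere:
  fixes F :: "'a::euclidean_space \<Rightarrow> real"
  assumes F: "(F has_derivative D) (at x)" and x: "norm x = 1"
  defines "g \<equiv> (\<Sum>b\<in>Basis. D b *\<^sub>R b) - D x *\<^sub>R x"
  shows "g \<bullet> x = 0" "(F has_derivative (\<lambda>v. g \<bullet> v)) (at x within sphere 0 1)"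
proof -
  have lin: "linear D" using F has_derivative_linear by blast
  have D: "(\<Sum>b\<in>Basis. D b *\<^sub>R b) \<bullet> v = D v" for v
  proof -
    have "D v = D (\<Sum>b\<in>Basis. (v \<bullet> b) *\<^sub>R b)" by (simp add: euclidean_representation)
    also have "\<dots> = (\<Sum>b\<in>Basis. (v \<bullet> b) * D b)" by (simp add: linear_sum[OF lin] linear_scale[OF lin])
    finally show ?thesis by (simp add: inner_sum_left inner_commute[of v] mult.commute)
  qed
  have xx: "x \<bullet> x = 1" using x by (simp add: norm_eq_1)
  show "g \<bullet> x = 0" by (simp add: g_def inner_diff_left D xx)
  have "((\<lambda>y. F y - D x * ((y \<bullet> y - 1) / 2)) has_derivative (\<lambda>v. D v - D x * (x \<bullet> v))) (at x)"
    by (auto intro!: derivative_eq_intros F simp: fun_eq_iff inner_commute)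
  moreover have "(\<lambda>v. D v - D x * (x \<bullet> v)) = (\<lambda>v. g \<bullet> v)"
    by (simp add: g_def inner_diff_left D)
  ultimately have "((\<lambda>y. F y - D x * ((y \<bullet> y - 1) / 2)) has_derivative (\<lambda>v. g \<bullet> v)) (at x within sphere 0 1)"
    by (simp add: has_derivative_at_withinI)
  then show "(F has_derivative (\<lambda>v. g \<bullet> v)) (at x within sphere 0 1)"
    by (rule has_derivative_transform[rotated 2]) (use x in \<open>auto simp: norm_eq_1\<close>)
qed

lemma sphere_C1_ambient:
  fixes F :: "'a::euclidean_space \<Rightarrow> real"
  assumes F: "\<And>x. norm x = 1 \<Longrightarrow> (F has_derivative D x) (at x)"
    and D: "\<And>v. continuous_on (sphere 0 1) (\<lambda>x. D x v)"
  shows "sphere_C1 F (\<lambda>x. (\<Sum>b\<in>Basis. D x b *\<^sub>R b) - D x x *\<^sub>R x)"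
  unfolding sphere_C1_def
proof (intro conjI ballI)
  have "continuous_on (sphere 0 1) (\<lambda>x. \<Sum>b\<in>Basis. (x \<bullet> b) * D x b)"
    by (intro continuous_intros D)
  moreover have "(\<Sum>b\<in>Basis. (x \<bullet> b) * D x b) = D x x" if "x \<in> sphere 0 1" for x
  proof -
    have lin: "linear (D x)" using F[of x] has_derivative_linear that by auto
    have "D x x = D x (\<Sum>b\<in>Basis. (x \<bullet> b) *\<^sub>R b)" by (simp add: euclidean_representation)
    also have "\<dots> = (\<Sum>b\<in>Basis. (x \<bullet> b) * D x b)" by (simp add: linear_sum[OF lin] linear_scale[OF lin])
    finally show ?thesis by simp
  qed
  ultimately have "continuous_on (sphere 0 1) (\<lambda>x. D x x)"
    by (subst continuous_on_cong[OF refl, of _ _ "\<lambda>x. \<Sum>b\<in>Basis. (x \<bullet> b) * D x b"]) auto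
  then show "continuous_on (sphere 0 1) (\<lambda>x. (\<Sum>b\<in>Basis. D x b *\<^sub>R b) - D x x *\<^sub>R x)"
    by (intro continuous_intros D)
qed (use has_derivative_within_sphere[OF F] in auto)

lemma sphere_C1_inner: "sphere_C1 (\<lambda>x. p \<bullet> x) (\<lambda>x. p - (p \<bullet> x) *\<^sub>R x)"
proof -
  have "sphere_C1 (\<lambda>x. p \<bullet> x) (\<lambda>x. (\<Sum>b\<in>Basis. (p \<bullet> b) *\<^sub>R b) - (p \<bullet> x) *\<^sub>R x)"
    by (rule sphere_C1_ambient) (auto intro!: derivative_eq_intros continuous_intros)
  then show ?thesis by (simp add: euclidean_representation)
qed

lemma sphere_inner_range:
  assumes "norm p = 1" "norm x = 1" shows "p \<bullet> x \<in> {-1..1}"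
  using Cauchy_Schwarz_ineq2[of p x] assms by (simp add: abs_le_iff)

lemma sphere_C1_zonal:
  fixes \<psi> \<psi>' :: "real \<Rightarrow> real"
  assumes p: "norm p = 1" and d: "\<And>z. z \<in> {-1..1} \<Longrightarrow> (\<psi> has_real_derivative \<psi>' z) (at z)" and c: "continuous_on {-1..1} \<psi>'"
  shows "sphere_C1 (\<lambda>x. \<psi> (p \<bullet> x)) (\<lambda>x. \<psi>' (p \<bullet> x) *\<^sub>R (p - (p \<bullet> x) *\<^sub>R x))"
  unfolding sphere_C1_def
proof (intro conjI ballI)
  have "continuous_on (sphere 0 1) (\<lambda>x. \<psi>' (p \<bullet> x))"
    by (rule continuous_on_compose2[OF c]) (use sphere_inner_range[OF p] in \<open>auto intro!: continuous_intros\<close>)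
  then show "continuous_on (sphere 0 1) (\<lambda>x. \<psi>' (p \<bullet> x) *\<^sub>R (p - (p \<bullet> x) *\<^sub>R x))"
    by (intro continuous_intros)
  fix x :: 'a assume "x \<in> sphere 0 1"
  then have x: "norm x = 1" by simp
  show "\<psi>' (p \<bullet> x) *\<^sub>R (p - (p \<bullet> x) *\<^sub>R x) \<bullet> x = 0" using sphere_C1D(1)[OF sphere_C1_inner x, of p] by simp
  have "(\<psi> has_derivative (\<lambda>h. h * \<psi>' (p \<bullet> x))) (at (p \<bullet> x))"
    using d[OF sphere_inner_range[OF p x]] by (simp add: has_field_derivative_def mult_commute_abs)
  from has_derivative_compose[OF sphere_C1D(2)[OF sphere_C1_inner x, of p] this]
  show "((\<lambda>x. \<psi> (p \<bullet> x)) has_derivative (\<lambda>v. \<psi>' (p \<bullet> x) *\<^sub>R (p - (p \<bullet> x) *\<^sub>R x) \<bullet> v)) (at x within sphere 0 1)"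
    by (simp add: mult.commute)
qed

lemma smooth_on_sphere_C1:
  fixes X :: "'a::euclidean_space \<Rightarrow> 'b::euclidean_space"
  assumes "smooth_on_sphere X"
  shows "\<exists>g. sphere_C1 (\<lambda>x. X x \<bullet> b) g"
proof -
  obtain W F where W: "open W" "sphere 0 1 \<subseteq> W" "\<And>k. Ck_on k W F" "\<And>x. x \<in> sphere 0 1 \<Longrightarrow> X x = F x"
    using assms unfolding smooth_on_sphere_def by blast
  define D where "D x v = frechet_derivative F (at x) v \<bullet> b" for x v
  have d: "F differentiable (at x)" if "x \<in> W" for x using W(3)[of "Suc 0"] that by simp
  have c: "continuous_on W (\<lambda>x. frechet_derivative F (at x) v)" for v using W(3)[of "Suc 0"] by simp
  have "sphere_C1 (\<lambda>x. F x \<bullet> b) (\<lambda>x. (\<Sum>b\<in>Basis. D x b *\<^sub>R b) - D x x *\<^sub>R x)"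
  proof (rule sphere_C1_ambient)
    fix x :: 'a assume "norm x = 1"
    then have "x \<in> W" using W(2) by auto
    then have "(F has_derivative frechet_derivative F (at x)) (at x)" using d frechet_derivative_works by blast
    then show "((\<lambda>x. F x \<bullet> b) has_derivative D x) (at x)" unfolding D_def by (rule has_derivative_inner_left)
  next
    show "continuous_on (sphere 0 1) (\<lambda>x. D x v)" for v
      unfolding D_def by (intro continuous_intros continuous_on_subset[OF c W(2)])
  qed
  then have "sphere_C1 (\<lambda>x. X x \<bullet> b) (\<lambda>x. (\<Sum>b\<in>Basis. D x b *\<^sub>R b) - D x x *\<^sub>R x)"
    by (rule sphere_C1_cong) (use W(4) in auto)
  then show ?thesis by blast
qed

lemma sphere_C1_components:
  fixes X :: "real ^ 'n \<Rightarrow> real ^ 'n"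
  assumes "smooth_on_sphere X"
  shows "\<exists>H. \<forall>j. sphere_C1 (\<lambda>x. X x $ j) (H j)"
proof -
  have "\<forall>j. \<exists>H. sphere_C1 (\<lambda>x. X x \<bullet> axis j 1) H" using smooth_on_sphere_C1[OF assms] by blast
  then show ?thesis unfolding choice_iff by (simp add: inner_axis)
qed

text \<open>\<open>Q\<close> and the complement of \<open>K\<close> are open and cover the space,
  and derivatives within the sphere are local. In this way a quotient whose denominator vanishes on
  the boundary of the cap becomes a C1 function on the whole sphere.\<close>

lemma sphere_C1_extend_zero:
  fixes f :: "'a::euclidean_space \<Rightarrow> real"
  assumes Op: "open Q" and K: "closed K" "K \<subseteq> Q"
    and f: "\<And>x. x \<in> Q \<Longrightarrow> norm x = 1 \<Longrightarrow> g x \<bullet> x = 0 \<and> (f has_derivative (\<lambda>v. g x \<bullet> v)) (at x within sphere 0 1)"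
    and g: "continuous_on (sphere 0 1 \<inter> Q) g"
    and z: "\<And>x. x \<in> Q - K \<Longrightarrow> norm x = 1 \<Longrightarrow> f x = 0 \<and> g x = 0"
  shows "sphere_C1 (\<lambda>x. if x \<in> Q then f x else 0) (\<lambda>x. if x \<in> Q then g x else 0)"
proof -
  define F where "F x = (if x \<in> Q then f x else 0)" for x
  define G where "G x = (if x \<in> Q then g x else 0)" for x
  have "G x \<bullet> x = 0 \<and> (F has_derivative (\<lambda>v. G x \<bullet> v)) (at x within sphere 0 1) \<and> continuous (at x within sphere 0 1) G"
    if x: "x \<in> sphere 0 1" for x
  proof (cases "x \<in> Q")
    case True
    have nx: "norm x = 1" using x by simp
    have eq: "at x within sphere 0 1 = at x within (sphere 0 1 \<inter> Q)" by (rule at_within_nhd[OF True Op]) auto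
    have "(F has_derivative (\<lambda>v. g x \<bullet> v)) (at x within (sphere 0 1 \<inter> Q))"
      by (rule has_derivative_transform[where f = f]) (use f[OF True nx] x True in \<open>auto simp: F_def eq\<close>)
    moreover have "(G \<longlongrightarrow> g x) (at x within (sphere 0 1 \<inter> Q))"
    proof (rule tendsto_cong[THEN iffD1])
      show "(g \<longlongrightarrow> g x) (at x within (sphere 0 1 \<inter> Q))"
        using g True x by (auto simp: continuous_on_def)
      show "\<forall>\<^sub>F y in at x within (sphere 0 1 \<inter> Q). g y = G y"
        by (auto simp: eventually_at_filter G_def)
    qed
    ultimately show ?thesis using f[OF True nx] True by (simp add: G_def continuous_within eq)
  next
    case False
    then have xK: "x \<in> - K" "open (- K)" using K by auto
    have eq: "at x within sphere 0 1 = at x within (sphere 0 1 \<inter> - K)" by (rule at_within_nhd[OF xK]) auto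
    have FG: "F y = 0" "G y = 0" if "y \<in> sphere 0 1 \<inter> - K" for y
      using z[of y] that by (auto simp: F_def G_def)
    have "(F has_derivative (\<lambda>v. 0)) (at x within (sphere 0 1 \<inter> - K))"
      by (rule has_derivative_transform[where f = "\<lambda>_. 0"]) (use x xK FG in auto)
    moreover have "(G \<longlongrightarrow> 0) (at x within (sphere 0 1 \<inter> - K))"
      by (rule tendsto_eventually) (use FG in \<open>auto simp: eventually_at_filter\<close>)
    ultimately show ?thesis using FG[of x] x xK by (simp add: continuous_within eq)
  qed
  then show ?thesis unfolding sphere_C1_def continuous_on_eq_continuous_within F_def[symmetric] G_def[symmetric] by blast
qed


section \<open>Rotations and the divergence theorem\<close>

lemma integrable_sphere_continuous:
  fixes u :: "real ^ 'n \<Rightarrow> real"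
  assumes "continuous_on (sphere 0 1) u"
  shows "integrable sphere_measure u"
proof -
  interpret finite_measure "sphere_measure :: (real ^ 'n) measure" by (rule finite_measure_sphere)
  have "compact (u ` sphere 0 1)" by (intro compact_continuous_image assms) auto
  then obtain M where "\<And>y. y \<in> u ` sphere 0 1 \<Longrightarrow> norm y \<le> M" using compact_imp_bounded bounded_iff by metis
  then show ?thesis using borel_measurable_sphere_continuous[OF assms]
    by (intro integrable_const_bound[of _ M]) auto
qed

definition plane_rotation :: "'a::real_inner \<Rightarrow> 'a \<Rightarrow> real \<Rightarrow> 'a \<Rightarrow> 'a" where
  "plane_rotation a b t x = x + (cos t - 1) *\<^sub>R ((x \<bullet> a) *\<^sub>R a + (x \<bullet> b) *\<^sub>R b) + sin t *\<^sub>R ((x \<bullet> a) *\<^sub>R b - (x \<bullet> b) *\<^sub>R a)"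

lemma orthogonal_plane_rotation:
  fixes a b :: "'a::euclidean_space"
  assumes ab: "norm a = 1" "norm b = 1" "a \<bullet> b = 0"
  shows "orthogonal_transformation (plane_rotation a b t)"
  unfolding orthogonal_transformation
proof (intro conjI allI)
  show "linear (plane_rotation a b t)"
    by (rule linearI) (simp_all add: plane_rotation_def algebra_simps)
  fix x
  define \<rho> where "\<rho> = (x \<bullet> a)\<^sup>2 + (x \<bullet> b)\<^sup>2"
  \<comment> \<open>P is the projection of x to the plane of a and b, and R is P turned by a right
    angle; both have squared norm \<rho>.\<close>
  define P where "P = (x \<bullet> a) *\<^sub>R a + (x \<bullet> b) *\<^sub>R b"
  define R where "R = (x \<bullet> a) *\<^sub>R b - (x \<bullet> b) *\<^sub>R a"
  have u: "a \<bullet> a = 1" "b \<bullet> b = 1" "b \<bullet> a = 0" using ab by (auto simp: norm_eq_1 inner_commute)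
  have i: "P \<bullet> P = \<rho>" "R \<bullet> R = \<rho>" "P \<bullet> R = 0" "x \<bullet> P = \<rho>" "x \<bullet> R = 0"
    using u ab(3) by (simp_all add: P_def R_def \<rho>_def inner_add_left inner_add_right inner_diff_left inner_diff_right power2_eq_square)
  have "plane_rotation a b t x \<bullet> plane_rotation a b t x
     = x \<bullet> x + 2 * (cos t - 1) * (x \<bullet> P) + 2 * sin t * (x \<bullet> R) + (cos t - 1)\<^sup>2 * (P \<bullet> P) + 2 * (cos t - 1) * sin t * (P \<bullet> R) + (sin t)\<^sup>2 * (R \<bullet> R)"
    unfolding plane_rotation_def P_def[symmetric] R_def[symmetric]
    by (simp add: inner_add_left inner_add_right inner_commute[of P x] inner_commute[of R x] inner_commute[of R P] power2_eq_square algebra_simps)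
  also have "\<dots> = x \<bullet> x + \<rho> * (2 * (cos t - 1) + (cos t - 1)\<^sup>2 + (sin t)\<^sup>2)"
    unfolding i by (simp add: algebra_simps)
  also have "2 * (cos t - 1) + (cos t - 1)\<^sup>2 + (sin t)\<^sup>2 = 0"
    using sin_cos_squared_add[of t] by (simp add: power2_eq_square algebra_simps)
  also have "x \<bullet> x + \<rho> * 0 = x \<bullet> x" by simp
  finally show "norm (plane_rotation a b t x) = norm x" by (simp add: norm_eq_sqrt_inner)
qed

text \<open>The derivative of the integral of \<open>u\<close> over the rotated sphere, which does not depend on the angle.\<close>

lemma sphere_rotation_integral:
  fixes a b :: "real ^ 'n"
  assumes ab: "norm a = 1" "norm b = 1" "a \<bullet> b = 0" and u: "sphere_C1 u g"
  shows "(LINT x|sphere_measure. (x \<bullet> a) * (g x \<bullet> b) - (x \<bullet> b) * (g x \<bullet> a)) = 0"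
proof -
  interpret finite_measure "sphere_measure :: (real ^ 'n) measure" by (rule finite_measure_sphere)
  let ?R = "plane_rotation a b"
  note gc = sphere_C1_continuous(1)[OF u] and uc = sphere_C1_continuous(2)[OF u]
  have "compact (g ` sphere 0 1)" by (intro compact_continuous_image gc) auto
  then obtain M where M: "\<And>x. norm x = 1 \<Longrightarrow> norm (g x) \<le> M" using compact_imp_bounded bounded_iff by (metis imageI mem_sphere_0)
  have Rn: "norm (?R t x) = norm x" for t x
    using orthogonal_transformation_norm[OF orthogonal_plane_rotation[OF ab]] .
  define R' where "R' t x = (- sin t) *\<^sub>R ((x \<bullet> a) *\<^sub>R a + (x \<bullet> b) *\<^sub>R b) + cos t *\<^sub>R ((x \<bullet> a) *\<^sub>R b - (x \<bullet> b) *\<^sub>R a)" for t x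
  have R'n: "norm (R' t x) \<le> 4" if "norm x = 1" for t x
  proof -
    have "\<bar>x \<bullet> a\<bar> \<le> 1" "\<bar>x \<bullet> b\<bar> \<le> 1"
      using Cauchy_Schwarz_ineq2[of x a] Cauchy_Schwarz_ineq2[of x b] ab that by auto
    then have "norm ((x \<bullet> a) *\<^sub>R a + (x \<bullet> b) *\<^sub>R b) \<le> 2" "norm ((x \<bullet> a) *\<^sub>R b - (x \<bullet> b) *\<^sub>R a) \<le> 2"
      using norm_triangle_ineq[of "(x \<bullet> a) *\<^sub>R a" "(x \<bullet> b) *\<^sub>R b"] norm_triangle_ineq4[of "(x \<bullet> a) *\<^sub>R b" "(x \<bullet> b) *\<^sub>R a"] ab by auto
    then have "\<bar>sin t\<bar> * norm ((x \<bullet> a) *\<^sub>R a + (x \<bullet> b) *\<^sub>R b) \<le> 1 * 2" "\<bar>cos t\<bar> * norm ((x \<bullet> a) *\<^sub>R b - (x \<bullet> b) *\<^sub>R a) \<le> 1 * 2"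
      by (intro mult_mono; simp)+
    then show ?thesis unfolding R'_def
      using norm_triangle_ineq[of "(- sin t) *\<^sub>R ((x \<bullet> a) *\<^sub>R a + (x \<bullet> b) *\<^sub>R b)" "cos t *\<^sub>R ((x \<bullet> a) *\<^sub>R b - (x \<bullet> b) *\<^sub>R a)"] by simp
  qed
  have d: "((\<lambda>t. u (?R t x)) has_real_derivative g (?R t x) \<bullet> R' t x) (at t)" if x: "norm x = 1" for t x
  proof -
    have 1: "((\<lambda>t. ?R t x) has_derivative (\<lambda>h. h *\<^sub>R R' t x)) (at t)"
      unfolding plane_rotation_def R'_def by (auto intro!: derivative_eq_intros simp: fun_eq_iff algebra_simps)
    \<comment> \<open>The derivative of u exists only within the sphere, so the chain rule is
      applied within the orbit of x.\<close>
    have "range (\<lambda>t. ?R t x) \<subseteq> sphere 0 1" using x Rn by auto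
    then have "(u has_derivative (\<lambda>v. g (?R t x) \<bullet> v)) (at (?R t x) within range (\<lambda>t. ?R t x))"
      using sphere_C1D(2)[OF u, of "?R t x"] x Rn has_derivative_subset by auto
    from has_derivative_in_compose[OF 1 this]
    show ?thesis by (simp add: has_field_derivative_def mult_commute_abs)
  qed
  define \<tau> where "\<tau> k = 1 / real (Suc k)" for k
  have \<tau>: "\<tau> k > 0" "\<tau> \<longlonglongrightarrow> 0" for k
    unfolding \<tau>_def[abs_def] using LIMSEQ_inverse_real_of_nat by (auto simp: inverse_eq_divide)
  define s where "s k x = (u (?R (\<tau> k) x) - u x) / \<tau> k" for k x
  have R0: "?R 0 x = x" for x by (simp add: plane_rotation_def)
  have uR: "continuous_on (sphere 0 1) (\<lambda>x. u (?R t x))" for t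
    by (rule continuous_on_compose2[OF uc]) (use Rn in \<open>auto simp: plane_rotation_def intro!: continuous_intros\<close>)
  have s0: "integral\<^sup>L sphere_measure (s k) = 0" for k
    unfolding s_def[abs_def] using integral_sphere_orthogonal[OF orthogonal_plane_rotation[OF ab] borel_measurable_sphere_continuous[OF uc]]
    by (simp add: integrable_sphere_continuous uR uc)
  \<comment> \<open>Each difference quotient has integral 0 because rotations preserve the measure.
    By the mean value theorem the constant \<open>M * 4\<close> dominates all of them.\<close>
  have "(\<lambda>k. integral\<^sup>L sphere_measure (s k)) \<longlonglongrightarrow> (LINT x|sphere_measure. g x \<bullet> R' 0 x)"
  proof (rule integral_dominated_convergence[where w = "\<lambda>_. M * 4"])
    show "(\<lambda>x. g x \<bullet> R' 0 x) \<in> borel_measurable sphere_measure"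
      unfolding R'_def by (intro borel_measurable_sphere_continuous continuous_intros gc)
    show "s k \<in> borel_measurable sphere_measure" for k
      unfolding s_def[abs_def] by (intro borel_measurable_sphere_continuous continuous_intros uc uR) (use \<tau>(1)[of k] in auto)
    show "AE x in sphere_measure. (\<lambda>k. s k x) \<longlonglongrightarrow> g x \<bullet> R' 0 x"
    proof (rule AE_I2)
      fix x :: "real ^ 'n" assume "x \<in> space sphere_measure"
      then have "((\<lambda>t. (u (?R (0 + t) x) - u (?R 0 x)) / t) \<longlongrightarrow> g x \<bullet> R' 0 x) (at 0)"
        using d[of x 0] by (simp add: DERIV_def R0)
      then have "((\<lambda>t. (u (?R t x) - u x) / t) \<longlongrightarrow> g x \<bullet> R' 0 x) (at 0)" by (simp add: R0)
      moreover have "filterlim \<tau> (at 0) sequentially" using \<tau> by (auto simp: filterlim_at intro!: always_eventually less_imp_neq[symmetric])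
      ultimately show "(\<lambda>k. s k x) \<longlonglongrightarrow> g x \<bullet> R' 0 x" unfolding s_def by (rule filterlim_compose)
    qed
    show "AE x in sphere_measure. norm (s k x) \<le> M * 4" for k
    proof (rule AE_I2)
      fix x :: "real ^ 'n" assume "x \<in> space sphere_measure"
      then have x: "norm x = 1" by simp
      obtain z where z: "u (?R (\<tau> k) x) - u (?R 0 x) = (\<tau> k - 0) * (g (?R z x) \<bullet> R' z x)"
        using MVT2[OF \<tau>(1)[of k], of "\<lambda>t. u (?R t x)" "\<lambda>t. g (?R t x) \<bullet> R' t x"] d[OF x] by blast
      have "s k x = g (?R z x) \<bullet> R' z x" using z \<tau>(1)[of k] by (simp add: s_def R0)
      also have "\<bar>\<dots>\<bar> \<le> norm (g (?R z x)) * norm (R' z x)" by (rule Cauchy_Schwarz_ineq2)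
      also have "\<dots> \<le> M * 4" using M[of "?R z x"] R'n[OF x, of z] x Rn[of z x] by (intro mult_mono) (auto intro: order_trans[OF norm_ge_zero])
      finally show "norm (s k x) \<le> M * 4" by simp
    qed
  qed simp
  then have "(LINT x|sphere_measure. g x \<bullet> R' 0 x) = 0" by (simp add: s0 LIMSEQ_const_iff)
  then show ?thesis by (simp add: R'_def inner_diff_right)
qed

text \<open>On the sphere, the component \<open>j\<close> of the tangential gradient is the sum over \<open>i\<close> of \<open>x\<^sub>i\<close> times the
  derivative along the rotation in the plane of the axes \<open>i\<close> and \<open>j\<close>.\<close>

theorem sphere_divergence:
  fixes h :: "'n::finite \<Rightarrow> real ^ 'n \<Rightarrow> real"
  assumes h: "\<And>j. sphere_C1 (h j) (G j)" and tan: "\<And>x. norm x = 1 \<Longrightarrow> (\<Sum>j\<in>UNIV. x $ j * h j x) = 0"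
  shows "(LINT x|sphere_measure. (\<Sum>j\<in>UNIV. G j x $ j)) = 0"
proof -
  define e where "e j = (axis j 1 :: real ^ 'n)" for j
  have ie: "x \<bullet> e j = x $ j" for x j by (simp add: e_def inner_axis)
  have ee: "norm (e j) = 1" "i \<noteq> j \<Longrightarrow> e i \<bullet> e j = 0" for i j by (auto simp: e_def inner_axis norm_axis_1) (simp add: axis_def)
  have eij: "e i $ j = (if i = j then 1 else 0)" for i j by (auto simp: e_def axis_def)
  define D where "D i j x = (x $ i) *\<^sub>R G j x + h j x *\<^sub>R (e i - (x $ i) *\<^sub>R x)" for i j x
  have D: "sphere_C1 (\<lambda>x. x $ i * h j x) (D i j)" for i j
    using sphere_C1_mult[OF sphere_C1_inner[of "e i"] h[of j]] unfolding inner_commute[of "e i"] ie D_def[abs_def] by simp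
  define I where "I i j x = x $ i * (D i j x $ j) - x $ j * (D i j x $ i)" for i j x
  have zero: "integral\<^sup>L sphere_measure (I i j) = 0" for i j
  proof (cases "i = j")
    case True
    then show ?thesis by (simp add: I_def[abs_def])
  next
    case False
    then show ?thesis using sphere_rotation_integral[OF ee(1,1) ee(2)[OF False] D[of i j]] by (simp add: I_def[abs_def] ie)
  qed
  have int: "integrable sphere_measure (I i j)" for i j
    unfolding I_def[abs_def] by (intro integrable_sphere_continuous continuous_intros sphere_C1_continuous(1)[OF D])
  have "(LINT x|sphere_measure. (\<Sum>j\<in>UNIV. \<Sum>i\<in>UNIV. I i j x)) = 0"
    using int by (simp add: zero)
  moreover have "(\<Sum>j\<in>UNIV. \<Sum>i\<in>UNIV. I i j x) = (\<Sum>j\<in>UNIV. G j x $ j)" if x: "norm x = 1" for x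
  proof -
    have xx: "(\<Sum>i\<in>UNIV. x $ i * x $ i) = 1" using x by (simp add: norm_eq_1 inner_vec_def)
    \<comment> \<open>In the sum over i the squares of the coordinates add up to 1, the radial part
      of the gradient drops out by tangency, and n - 1 copies of \<open>x $ j * h j x\<close>
      remain. They vanish after summation over j, by \<open>tan\<close>.\<close>
    have "(\<Sum>i\<in>UNIV. I i j x) = G j x $ j - (real CARD('n) - 1) * (x $ j * h j x)" for j
    proof -
      have xG: "(\<Sum>i\<in>UNIV. x $ i * G j x $ i) = 0"
        using sphere_C1D(1)[OF h[of j] x] by (simp add: inner_vec_def mult.commute)
      have "I i j x = (x $ i * x $ i) * G j x $ j + x $ j * h j x * (if i = j then 1 else 0) - x $ j * (x $ i * G j x $ i) - x $ j * h j x" for i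
        unfolding I_def D_def by (auto simp: eij algebra_simps)
      then have "(\<Sum>i\<in>UNIV. I i j x) = (\<Sum>i\<in>UNIV. x $ i * x $ i) * G j x $ j + x $ j * h j x * (\<Sum>i\<in>UNIV. if i = j then 1 else 0)
          - x $ j * (\<Sum>i\<in>UNIV. x $ i * G j x $ i) - (\<Sum>i\<in>(UNIV::'n set). x $ j * h j x)"
        by (simp only: sum.distrib sum_subtractf sum_distrib_left sum_distrib_right)
      then show ?thesis unfolding xx xG by (simp add: algebra_simps)
    qed
    then have "(\<Sum>j\<in>UNIV. \<Sum>i\<in>UNIV. I i j x) = (\<Sum>j\<in>UNIV. G j x $ j) - (real CARD('n) - 1) * (\<Sum>j\<in>UNIV. x $ j * h j x)"
      by (simp add: sum_subtractf sum_distrib_left)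
    then show ?thesis using tan[OF x] by simp
  qed
  ultimately show ?thesis
    using Bochner_Integration.integral_cong[of sphere_measure sphere_measure "\<lambda>x. \<Sum>j\<in>UNIV. \<Sum>i\<in>UNIV. I i j x" "\<lambda>x. \<Sum>j\<in>UNIV. G j x $ j"] by simp
qed

text \<open>The divergence theorem for the tangential field u X.\<close>

lemma sphere_C1_weak_gradient:
  fixes u :: "real ^ 'n \<Rightarrow> real"
  assumes u: "sphere_C1 u g"
  shows "has_weak_gradient u g"
  unfolding has_weak_gradient_def
proof (intro conjI allI impI)
  show "AE x in sphere_measure. g x \<bullet> x = 0" by (rule AE_I2) (use sphere_C1D(1)[OF u] in auto)
  fix X :: "real ^ 'n \<Rightarrow> real ^ 'n" assume X: "smooth_on_sphere X" "\<forall>x\<in>sphere 0 1. X x \<bullet> x = 0"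
  obtain H where H: "\<And>j. sphere_C1 (\<lambda>x. X x $ j) (H j)" using sphere_C1_components[OF X(1)] by blast
  have div: "sphere_div X x = (\<Sum>j\<in>UNIV. H j x $ j)" if "norm x = 1" for x
    unfolding sphere_div_def using sphere_gradient_eq[OF H that] by simp
  have 0: "(LINT x|sphere_measure. (\<Sum>j\<in>UNIV. (u x *\<^sub>R H j x + X x $ j *\<^sub>R g x) $ j)) = 0"
  proof (rule sphere_divergence[where h = "\<lambda>j x. u x * X x $ j"])
    show "(\<Sum>j\<in>UNIV. x $ j * (u x * X x $ j)) = 0" if "norm x = 1" for x
    proof -
      have "(\<Sum>j\<in>UNIV. x $ j * (u x * X x $ j)) = u x * (X x \<bullet> x)"
        by (simp add: inner_vec_def sum_distrib_left mult_ac)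
      then show ?thesis using X(2) that by simp
    qed
  qed (rule sphere_C1_mult[OF u H])
  have eq: "(\<Sum>j\<in>UNIV. (u x *\<^sub>R H j x + X x $ j *\<^sub>R g x) $ j) = u x * sphere_div X x + g x \<bullet> X x" if "norm x = 1" for x
    using div[OF that] by (simp add: sum.distrib sum_distrib_left inner_vec_def mult.commute)
  have c1: "continuous_on (sphere 0 1) (\<lambda>x. \<Sum>j\<in>UNIV. H j x $ j)"
    by (intro continuous_intros sphere_C1_continuous(1)[OF H])
  have c2: "continuous_on (sphere 0 1) (sphere_div X)"
    by (subst continuous_on_cong[OF refl, of _ _ "\<lambda>x. \<Sum>j\<in>UNIV. H j x $ j"]) (use div c1 in auto)
  have "continuous_on (sphere 0 1) (\<lambda>x. \<Sum>j\<in>UNIV. g x $ j * X x $ j)"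
    by (intro continuous_intros sphere_C1_continuous(1)[OF u] sphere_C1_continuous(2)[OF H])
  then have i2: "integrable sphere_measure (\<lambda>x. g x \<bullet> X x)"
    unfolding inner_vec_def inner_real_def by (rule integrable_sphere_continuous)
  have i1: "integrable sphere_measure (\<lambda>x. u x * sphere_div X x)"
    by (intro integrable_sphere_continuous continuous_intros c2 sphere_C1_continuous(2)[OF u])
  have "(LINT x|sphere_measure. u x * sphere_div X x + g x \<bullet> X x) = 0"
    using 0 eq Bochner_Integration.integral_cong[of sphere_measure sphere_measure "\<lambda>x. \<Sum>j\<in>UNIV. (u x *\<^sub>R H j x + X x $ j *\<^sub>R g x) $ j" "\<lambda>x. u x * sphere_div X x + g x \<bullet> X x"] by simp
  then show "(LINT x|sphere_measure. g x \<bullet> X x) = - (LINT x|sphere_measure. u x * sphere_div X x)"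
    using i1 i2 by simp
qed

section \<open>Calculus of smooth functions\<close>

lemma Ck_on_cong_imp:
  assumes "open W" "\<And>x. x \<in> W \<Longrightarrow> f x = g x" "Ck_on k W f"
  shows "Ck_on k W g"
  using assms(2,3)
proof (induction k arbitrary: f g)
  case 0
  then show ?case by (simp cong: continuous_on_cong)
next
  case (Suc k)
  have d: "(g has_derivative frechet_derivative f (at x)) (at x)" if "x \<in> W" for x
    using Suc.prems that assms(1)
    by (intro has_derivative_transform_within_open[of f _ x UNIV W g]) (auto simp: frechet_derivative_works[symmetric])
  have "frechet_derivative g (at x) = frechet_derivative f (at x)" if "x \<in> W" for x
    using frechet_derivative_at[OF d[OF that]] by simp
  moreover have "Ck_on k W (\<lambda>x. frechet_derivative f (at x) v)" for v
    using Suc.prems(2) by simp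
  ultimately have "Ck_on k W (\<lambda>x. frechet_derivative g (at x) v)" for v
    by (intro Suc.IH[of "\<lambda>x. frechet_derivative f (at x) v" "\<lambda>x. frechet_derivative g (at x) v"]) simp_all
  moreover have "g differentiable (at x)" if "x \<in> W" for x
    using d[OF that] unfolding differentiable_def by blast
  ultimately show ?case by simp
qed

lemma Ck_on_SucI:
  assumes W: "open W" and d: "\<And>x. x \<in> W \<Longrightarrow> (f has_derivative D x) (at x)" and D: "\<And>v. Ck_on k W (\<lambda>x. D x v)"
  shows "Ck_on (Suc k) W f"
proof -
  have "Ck_on k W (\<lambda>x. frechet_derivative f (at x) v)" for v
    by (rule Ck_on_cong_imp[OF W _ D[of v]]) (use frechet_derivative_at[OF d] in auto)
  then show ?thesis using d by (auto simp: differentiable_def)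
qed

lemma Ck_on_SucD:
  assumes "Ck_on (Suc k) W f" shows "Ck_on k W f"
  using assms
proof (induction k arbitrary: f)
  case 0
  then show ?case by (auto simp: continuous_on_eq_continuous_within intro!: differentiable_imp_continuous_within[OF differentiable_at_withinI])
next
  case (Suc k)
  then show ?case by (metis Ck_on.simps(2))
qed

lemma Ck_on_add:
  assumes "open W" "Ck_on k W f" "Ck_on k W g"
  shows "Ck_on k W (\<lambda>x. f x + g x)"
  using assms(2,3)
proof (induction k arbitrary: f g)
  case 0
  then show ?case by (auto intro: continuous_on_add)
next
  case (Suc k)
  show ?case
  proof (rule Ck_on_SucI[OF assms(1), where D = "\<lambda>x v. frechet_derivative f (at x) v + frechet_derivative g (at x) v"])
    show "((\<lambda>x. f x + g x) has_derivative (\<lambda>v. frechet_derivative f (at x) v + frechet_derivative g (at x) v)) (at x)" if "x \<in> W" for x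
      using Suc.prems that by (intro has_derivative_add) (auto simp: frechet_derivative_works[symmetric])
    show "Ck_on k W (\<lambda>x. frechet_derivative f (at x) v + frechet_derivative g (at x) v)" for v
      using Suc.prems by (intro Suc.IH) auto
  qed
qed

lemma Ck_on_mult:
  fixes f g :: "'a::real_normed_vector \<Rightarrow> real"
  assumes "open W" "Ck_on k W f" "Ck_on k W g"
  shows "Ck_on k W (\<lambda>x. f x * g x)"
  using assms(2,3)
proof (induction k arbitrary: f g)
  case 0
  then show ?case by (auto intro: continuous_on_mult)
next
  case (Suc k)
  show ?case
  proof (rule Ck_on_SucI[OF assms(1), where D = "\<lambda>x v. f x * frechet_derivative g (at x) v + frechet_derivative f (at x) v * g x"])
    show "((\<lambda>x. f x * g x) has_derivative (\<lambda>v. f x * frechet_derivative g (at x) v + frechet_derivative f (at x) v * g x)) (at x)" if "x \<in> W" for x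
      using Suc.prems that by (intro has_derivative_mult) (auto simp: frechet_derivative_works[symmetric])
    show "Ck_on k W (\<lambda>x. f x * frechet_derivative g (at x) v + frechet_derivative f (at x) v * g x)" for v
      using Suc.prems Ck_on_SucD[OF Suc.prems(1)] Ck_on_SucD[OF Suc.prems(2)]
      by (intro Ck_on_add[OF assms(1)] Suc.IH) auto
  qed
qed

lemma Ck_on_Un:
  assumes "open S" "open T" "Ck_on k S f" "Ck_on k T f"
  shows "Ck_on k (S \<union> T) f"
  using assms(3,4)
proof (induction k arbitrary: f)
  case 0
  then show ?case using assms by (simp add: continuous_on_open_Un)
qed auto

lemma Ck_on_zero: "open W \<Longrightarrow> Ck_on k W (\<lambda>x. 0)"
  by (induction k) (auto intro!: Ck_on_SucI[where D = "\<lambda>_ _. 0"] simp del: Ck_on.simps(2))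

text \<open>A class \<open>P\<close> closed under differentiation gives smoothness of all orders by
  induction, without formulas for higher derivatives. The factor c belongs to the induction because
  the chain rule contributes \<beta> times the inner product of p with the direction.\<close>

lemma Ck_on_affine_family:
  fixes p :: "'a::real_inner" and P :: "(real \<Rightarrow> real) set"
  assumes I: "open I" and P: "\<And>\<psi>. \<psi> \<in> P \<Longrightarrow> \<exists>\<psi>'\<in>P. \<forall>z\<in>I. (\<psi> has_real_derivative \<psi>' z) (at z)"
    and \<psi>: "\<psi> \<in> P"
  shows "Ck_on k {x. \<alpha> + \<beta> * (p \<bullet> x) \<in> I} (\<lambda>x. c * \<psi> (\<alpha> + \<beta> * (p \<bullet> x)))"
  using \<psi>
proof (induction k arbitrary: \<psi> c)
  let ?W = "{x. \<alpha> + \<beta> * (p \<bullet> x) \<in> I}"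
  have "open ((\<lambda>x. \<alpha> + \<beta> * (p \<bullet> x)) -` I)" by (intro open_vimage I continuous_intros)
  then have W: "open ?W" by (simp add: vimage_def)
  have d: "((\<lambda>x. c * \<psi> (\<alpha> + \<beta> * (p \<bullet> x))) has_derivative (\<lambda>v. (c * \<beta> * (p \<bullet> v)) * \<psi>' (\<alpha> + \<beta> * (p \<bullet> x)))) (at x)"
    if "x \<in> ?W" "\<forall>z\<in>I. (\<psi> has_real_derivative \<psi>' z) (at z)" for \<psi> \<psi>' c x
  proof -
    have "(\<psi> has_derivative (\<lambda>h. h * \<psi>' (\<alpha> + \<beta> * (p \<bullet> x)))) (at (\<alpha> + \<beta> * (p \<bullet> x)))"
      using that by (auto simp: has_field_derivative_def mult_commute_abs)
    moreover have "((\<lambda>x. \<alpha> + \<beta> * (p \<bullet> x)) has_derivative (\<lambda>v. \<beta> * (p \<bullet> v))) (at x)"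
      by (auto intro!: derivative_eq_intros)
    ultimately have "((\<lambda>x. \<psi> (\<alpha> + \<beta> * (p \<bullet> x))) has_derivative (\<lambda>v. \<beta> * (p \<bullet> v) * \<psi>' (\<alpha> + \<beta> * (p \<bullet> x)))) (at x)"
      using has_derivative_compose by fastforce
    then have "((\<lambda>x. c * \<psi> (\<alpha> + \<beta> * (p \<bullet> x))) has_derivative (\<lambda>v. c * (\<beta> * (p \<bullet> v) * \<psi>' (\<alpha> + \<beta> * (p \<bullet> x))))) (at x)"
      by (rule has_derivative_mult_right)
    then show ?thesis by (simp add: mult_ac)
  qed
  {
    case 0
    then obtain \<psi>' where "\<forall>z\<in>I. (\<psi> has_real_derivative \<psi>' z) (at z)" using P by blast
    then have "isCont (\<lambda>x. c * \<psi> (\<alpha> + \<beta> * (p \<bullet> x))) x" if "x \<in> ?W" for x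
      using has_derivative_continuous[OF d[OF that]] by blast
    then show ?case by (simp add: continuous_at_imp_continuous_on)
  next
    case (Suc k)
    then obtain \<psi>' where "\<psi>' \<in> P" "\<forall>z\<in>I. (\<psi> has_real_derivative \<psi>' z) (at z)" using P by blast
    then show ?case by (intro Ck_on_SucI[OF W d] Suc.IH) auto
  }
qed

lemma real_polynomial_function_derivative:
  fixes f :: "'a::euclidean_space \<Rightarrow> real"
  assumes "real_polynomial_function f"
  shows "\<exists>f'. (\<forall>x. (f has_derivative f' x) (at x)) \<and> (\<forall>v. real_polynomial_function (\<lambda>x. f' x v))"
  using assms
proof induction
  case (linear f)
  then show ?case
    by (intro exI[of _ "\<lambda>x. f"]) (auto intro: bounded_linear_imp_has_derivative real_polynomial_function.intros)
next
  case (const c)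
  then show ?case by (intro exI[of _ "\<lambda>x v. 0"]) (auto intro: real_polynomial_function.intros)
next
  case (add f g)
  then obtain f' g' where "\<forall>x. (f has_derivative f' x) (at x)" "\<forall>v. real_polynomial_function (\<lambda>x. f' x v)"
    "\<forall>x. (g has_derivative g' x) (at x)" "\<forall>v. real_polynomial_function (\<lambda>x. g' x v)" by blast
  then show ?case by (intro exI[of _ "\<lambda>x v. f' x v + g' x v"]) (auto intro: has_derivative_add real_polynomial_function.intros)
next
  case (mult f g)
  then obtain f' g' where "\<forall>x. (f has_derivative f' x) (at x)" "\<forall>v. real_polynomial_function (\<lambda>x. f' x v)"
    "\<forall>x. (g has_derivative g' x) (at x)" "\<forall>v. real_polynomial_function (\<lambda>x. g' x v)" by blast
  then show ?case using mult.hyps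
    by (intro exI[of _ "\<lambda>x v. f x * g' x v + f' x v * g x"] conjI allI has_derivative_mult
        real_polynomial_function.intros(3)[OF real_polynomial_function.intros(4) real_polynomial_function.intros(4)]) auto
qed

text \<open>Supplies the smooth test fields. Differentiating a polynomial map in a fixed direction
  gives a polynomial map, which is what the recursion in \<open>Ck_on\<close> asks for.\<close>

lemma Ck_on_polynomial:
  fixes f :: "'a::euclidean_space \<Rightarrow> 'b::euclidean_space"
  assumes "polynomial_function f"
  shows "Ck_on k UNIV f"
  using assms
proof (induction k arbitrary: f)
  case 0
  then show ?case by (simp add: continuous_on_polymonial_function)
next
  case (Suc k)
  have "\<forall>b\<in>Basis. \<exists>f'. (\<forall>x. ((\<lambda>x. f x \<bullet> b) has_derivative f' x) (at x)) \<and> (\<forall>v. real_polynomial_function (\<lambda>x. f' x v))"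
    using Suc.prems real_polynomial_function_derivative unfolding polynomial_function_iff_Basis_inner by blast
  then obtain f' where f': "\<And>b x. b \<in> Basis \<Longrightarrow> ((\<lambda>x. f x \<bullet> b) has_derivative f' b x) (at x)"
    "\<And>b v. b \<in> Basis \<Longrightarrow> real_polynomial_function (\<lambda>x. f' b x v)" by metis
  show ?case
  proof (rule Ck_on_SucI[where D = "\<lambda>x v. \<Sum>b\<in>Basis. f' b x v *\<^sub>R b"])
    show "(f has_derivative (\<lambda>v. \<Sum>b\<in>Basis. f' b x v *\<^sub>R b)) (at x)" for x
      by (subst has_derivative_componentwise_within) (simp add: f'(1))
    show "Ck_on k UNIV (\<lambda>x. \<Sum>b\<in>Basis. f' b x v *\<^sub>R b)" for v
      by (rule Suc.IH, unfold polynomial_function_iff_Basis_inner)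
        (simp add: f'(2))
  qed simp
qed

lemma smooth_on_sphere_polynomial:
  fixes f :: "'a::euclidean_space \<Rightarrow> 'b::euclidean_space"
  shows "polynomial_function f \<Longrightarrow> smooth_on_sphere f"
  unfolding smooth_on_sphere_def using Ck_on_polynomial by (intro exI[of _ UNIV] exI[of _ f]) auto

lemma enn2real_inj: "enn2real a = enn2real b \<Longrightarrow> a \<noteq> top \<Longrightarrow> b \<noteq> top \<Longrightarrow> a = b"
  by (cases a; cases b) auto

text \<open>Stone-Weierstrass passes from polynomials to continuous functions, and bump functions
  pass to indicators of closed sets, which generate the Borel sets and are stable under
  intersection. So the positive and the negative part of f are densities of the same finite measure,
  which forces f = 0 almost everywhere.\<close>

lemma sphere_integral_polynomials_zero:
  fixes f :: "real ^ 'n \<Rightarrow> real"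
  assumes f: "integrable sphere_measure f"
    and z: "\<And>\<phi>. real_polynomial_function \<phi> \<Longrightarrow> (LINT x|sphere_measure. \<phi> x * f x) = 0"
  shows "AE x in sphere_measure. f x = 0"
proof -
  let ?M = "sphere_measure :: (real ^ 'n) measure"
  interpret finite_measure ?M by (rule finite_measure_sphere)
  have fm: "f \<in> borel_measurable ?M" using f by simp
  have int: "integrable ?M (\<lambda>x. \<phi> x * f x)" if c: "continuous_on (sphere 0 1) \<phi>" for \<phi>
  proof -
    have "compact (\<phi> ` sphere 0 1)" by (intro compact_continuous_image c) auto
    then obtain K where "\<And>y. y \<in> \<phi> ` sphere 0 1 \<Longrightarrow> norm y \<le> K" using compact_imp_bounded bounded_iff by metis
    then have K: "\<bar>\<phi> x\<bar> \<le> K" if "norm x = 1" for x using that by simp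
    show ?thesis
    proof (rule Bochner_Integration.integrable_bound[where f = "\<lambda>x. K * f x"])
      show "integrable ?M (\<lambda>x. K * f x)" using f by simp
      show "(\<lambda>x. \<phi> x * f x) \<in> borel_measurable ?M" using borel_measurable_sphere_continuous[OF c] fm by simp
      show "AE x in ?M. norm (\<phi> x * f x) \<le> norm (K * f x)"
        by (rule AE_I2) (use K in \<open>auto simp: abs_mult intro!: mult_right_mono order_trans[OF K abs_ge_self]\<close>)
    qed
  qed
  have cont: "(LINT x|?M. \<phi> x * f x) = 0" if c: "continuous_on (sphere 0 1) \<phi>" for \<phi>
  proof -
    have "\<bar>LINT x|?M. \<phi> x * f x\<bar> \<le> e" if e: "e > 0" for e
    proof -
      define I where "I = (LINT x|?M. \<bar>f x\<bar>)"
      have I: "I \<ge> 0" unfolding I_def by (intro integral_nonneg_AE) auto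
      have "e / (I + 1) > 0" using e I by simp
      then obtain g where g: "real_polynomial_function g" "\<And>x. x \<in> sphere 0 1 \<Longrightarrow> \<bar>\<phi> x - g x\<bar> < e / (I + 1)"
        using Stone_Weierstrass_real_polynomial_function[OF _ c] by (metis compact_sphere)
      have gc: "continuous_on (sphere 0 1) g"
        using continuous_on_polymonial_function g(1) by (auto simp: real_polynomial_function_eq)
      have "(LINT x|?M. \<phi> x * f x) = (LINT x|?M. (\<phi> x - g x) * f x)"
        using int[OF c] int[OF gc] z[OF g(1)] by (simp add: left_diff_distrib)
      also have "\<bar>\<dots>\<bar> \<le> (LINT x|?M. \<bar>(\<phi> x - g x) * f x\<bar>)" by (rule integral_abs_bound)
      also have "\<dots> \<le> (LINT x|?M. e / (I + 1) * \<bar>f x\<bar>)"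
      proof (rule integral_mono)
        show "integrable ?M (\<lambda>x. \<bar>(\<phi> x - g x) * f x\<bar>)" by (intro integrable_abs int continuous_intros c gc)
        show "\<bar>(\<phi> x - g x) * f x\<bar> \<le> e / (I + 1) * \<bar>f x\<bar>" if "x \<in> space ?M" for x
          using mult_right_mono[of "\<bar>\<phi> x - g x\<bar>" "e / (I + 1)" "\<bar>f x\<bar>"] g(2)[of x] that by (simp add: abs_mult)
      qed (use f in simp)
      also have "\<dots> = e * (I / (I + 1))" by (simp add: I_def)
      also have "\<dots> \<le> e" using e I by (simp add: field_simps)
      finally show ?thesis .
    qed
    then have "\<bar>LINT x|?M. \<phi> x * f x\<bar> \<le> 0" by (rule field_le_epsilon[of _ 0, simplified])
    then show ?thesis by simp
  qed
  have intC: "integrable ?M (\<lambda>x. indicator C x * f x)" if C: "closed C" for C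
  proof (rule Bochner_Integration.integrable_bound[OF f])
    have "C \<inter> sphere 0 1 \<in> sets ?M" using C by (intro sets_sphere_measureI) auto
    then have "(indicator (C \<inter> sphere 0 1) :: _ \<Rightarrow> real) \<in> borel_measurable ?M" by (intro borel_measurable_indicator) auto
    then have "(indicator C :: _ \<Rightarrow> real) \<in> borel_measurable ?M"
      by (rule measurable_cong[THEN iffD1, rotated]) (auto simp: indicator_def)
    then show "(\<lambda>x. indicator C x * f x) \<in> borel_measurable ?M" using fm by simp
    show "AE x in ?M. norm (indicator C x * f x) \<le> norm (f x)" by (rule AE_I2) (auto simp: indicator_def)
  qed
  have closed: "(LINT x|?M. indicator C x * f x) = 0" if C: "closed C" for C
  proof (cases "C = {}")
    case True
    then show ?thesis by simp
  next
    case ne: False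
    \<comment> \<open>Equal to 1 on C and, at each point off C, zero for all large k.\<close>
    define \<phi> where "\<phi> k x = max 0 (1 - real k * infdist x C)" for k and x :: "real ^ 'n"
    have \<phi>c: "continuous_on (sphere 0 1) (\<phi> k)" for k
      unfolding \<phi>_def[abs_def] by (intro continuous_intros)
    have "(\<lambda>k. LINT x|?M. \<phi> k x * f x) \<longlonglongrightarrow> (LINT x|?M. indicator C x * f x)"
    proof (rule integral_dominated_convergence[where w = "\<lambda>x. \<bar>f x\<bar>"])
      show "(\<lambda>x. indicator C x * f x) \<in> borel_measurable ?M" using intC[OF C] by simp
      show "(\<lambda>x. \<phi> k x * f x) \<in> borel_measurable ?M" for k
        using borel_measurable_sphere_continuous[OF \<phi>c[of k]] fm by simp
      show "AE x in ?M. (\<lambda>k. \<phi> k x * f x) \<longlonglongrightarrow> indicator C x * f x"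
      proof (intro AE_I2 tendsto_mult tendsto_const)
        fix x :: "real ^ 'n"
        show "(\<lambda>k. \<phi> k x) \<longlonglongrightarrow> indicator C x"
        proof (cases "x \<in> C")
          case True
          then show ?thesis by (simp add: \<phi>_def)
        next
          case False
          then have d: "infdist x C > 0" using C ne by (simp add: infdist_pos_not_in_closed)
          obtain K where K: "1 / infdist x C < real K" using reals_Archimedean2 by blast
          have "\<phi> k x = 0" if "k \<ge> K" for k
          proof -
            have "1 < real K * infdist x C" using K d by (simp add: field_simps)
            also have "\<dots> \<le> real k * infdist x C" using that d by (intro mult_right_mono) auto
            finally show ?thesis by (simp add: \<phi>_def)
          qed
          then have "\<forall>\<^sub>F k in sequentially. \<phi> k x = 0" unfolding eventually_sequentially by blast
          then show ?thesis using False by (simp add: tendsto_eventually)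
        qed
      qed
      show "AE x in ?M. norm (\<phi> k x * f x) \<le> \<bar>f x\<bar>" for k
        by (rule AE_I2) (auto simp: \<phi>_def abs_mult infdist_nonneg intro!: mult_left_le_one_le)
    qed (use f in simp)
    then show ?thesis using cont[OF \<phi>c] by (simp add: LIMSEQ_const_iff)
  qed
  let ?E = "(\<inter>) (sphere 0 1) ` Collect (closed :: (real ^ 'n) set \<Rightarrow> bool)"
  \<comment> \<open>\<open>ennreal\<close> sends negative numbers to 0, so the two densities are the
    positive and the negative part of f.\<close>
  have dens_eq: "density ?M (\<lambda>x. ennreal (f x)) = density ?M (\<lambda>x. ennreal (- f x))"
  proof (rule measure_eqI_generator_eq[where E = ?E and \<Omega> = "sphere 0 1" and A = "\<lambda>_. sphere 0 1"])
    show "Int_stable ?E"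
    proof (rule Int_stableI)
      fix a b assume "a \<in> ?E" "b \<in> ?E"
      then obtain C D where "closed C" "closed D" "a = sphere 0 1 \<inter> C" "b = sphere 0 1 \<inter> D" by blast
      then show "a \<inter> b \<in> ?E" by (intro image_eqI[of _ _ "C \<inter> D"]) auto
    qed
    have "sphere (0 :: real ^ 'n) 1 \<in> sigma_sets UNIV (Collect closed)" by (rule sigma_sets.Basic) auto
    then have "sets ?M = sigma_sets (sphere 0 1) ?E"
      unfolding sets_sphere_measure sets_restrict_space borel_eq_closed
      by (subst sigma_sets_Int[symmetric]) auto
    then show "sets (density ?M (\<lambda>x. ennreal (f x))) = sigma_sets (sphere 0 1) ?E"
      "sets (density ?M (\<lambda>x. ennreal (- f x))) = sigma_sets (sphere 0 1) ?E" by auto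
    have sphereE: "sphere 0 1 \<in> ?E" by (rule image_eqI[of _ _ UNIV]) auto
    then show "range (\<lambda>_::nat. sphere 0 1) \<subseteq> ?E" by auto
    have eq: "emeasure (density ?M (\<lambda>x. ennreal (f x))) X = emeasure (density ?M (\<lambda>x. ennreal (- f x))) X
       \<and> emeasure (density ?M (\<lambda>x. ennreal (f x))) X \<noteq> \<infinity>" if "X \<in> ?E" for X
    proof -
      from that obtain C where "X = sphere 0 1 \<inter> C" "C \<in> Collect closed" by (rule imageE)
      then have C: "closed C" "X = sphere 0 1 \<inter> C" by simp_all
      have X: "X \<in> sets ?M" using C by (intro sets_sphere_measureI) auto
      let ?P = "\<integral>\<^sup>+x. ennreal (indicator C x * f x) \<partial>?M" and ?N = "\<integral>\<^sup>+x. ennreal (- (indicator C x * f x)) \<partial>?M"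
      have fin: "?P \<noteq> \<infinity>" "?N \<noteq> \<infinity>" using intC[OF C(1)] unfolding real_integrable_def by auto
      have "enn2real ?P = enn2real ?N"
        using closed[OF C(1)] real_lebesgue_integral_def[OF intC[OF C(1)]] by simp
      then have "?P = ?N" using fin by (intro enn2real_inj) auto
      moreover have "emeasure (density ?M (\<lambda>x. ennreal (f x))) X = ?P"
        using X fm by (subst emeasure_density, simp, simp, intro nn_integral_cong) (simp add: C(2) indicator_def)
      moreover have "emeasure (density ?M (\<lambda>x. ennreal (- f x))) X = ?N"
        using X fm by (subst emeasure_density, simp, simp, intro nn_integral_cong) (simp add: C(2) indicator_def)
      ultimately show ?thesis using fin by simp
    qed
    show "emeasure (density ?M (\<lambda>x. ennreal (f x))) X = emeasure (density ?M (\<lambda>x. ennreal (- f x))) X" if "X \<in> ?E" for X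
      using eq[OF that] by blast
    show "emeasure (density ?M (\<lambda>x. ennreal (f x))) (sphere 0 1) \<noteq> \<infinity>" using eq[OF sphereE] by blast
    show "?E \<subseteq> Pow (sphere 0 1)" by auto
  qed auto
  have "(\<integral>\<^sup>+x. ennreal (f x) \<partial>?M) \<noteq> \<infinity>" using f unfolding real_integrable_def by auto
  then have "AE x in ?M. ennreal (f x) = ennreal (- f x)"
    using finite_density_unique[of "\<lambda>x. ennreal (f x)" ?M "\<lambda>x. ennreal (- f x)"] dens_eq fm by auto
  then show ?thesis
  proof (rule AE_mp, intro AE_I2 impI)
    fix x assume "ennreal (f x) = ennreal (- f x)"
    then show "f x = 0" by (cases "f x \<ge> 0") (auto simp: ennreal_neg ennreal_eq_0_iff)
  qed
qed

subsection \<open>Weak gradients\<close>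

lemma L2_sphereD:
  assumes "f \<in> L2_sphere"
  shows "f \<in> borel_measurable sphere_measure" "integrable sphere_measure (\<lambda>x. (norm (f x))\<^sup>2)"
  using assms by (auto simp: L2_sphere_def)

lemma bounded_on_sphere:
  fixes X :: "'a::euclidean_space \<Rightarrow> 'b::real_normed_vector"
  assumes "continuous_on (sphere 0 1) X"
  shows "\<exists>K\<ge>0. \<forall>x. norm x = 1 \<longrightarrow> norm (X x) \<le> K"
proof -
  have "compact (X ` sphere 0 1)" by (intro compact_continuous_image assms) auto
  then obtain K where "\<And>y. y \<in> X ` sphere 0 1 \<Longrightarrow> norm y \<le> K" using compact_imp_bounded bounded_iff by metis
  then show ?thesis by (intro exI[of _ "max K 0"]) (auto simp: le_max_iff_disj)
qed

lemma L2_sphere_bounded: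
  fixes f :: "real ^ 'n \<Rightarrow> 'b::euclidean_space"
  assumes f: "f \<in> borel_measurable sphere_measure" and K: "\<And>x. norm x = 1 \<Longrightarrow> norm (f x) \<le> K"
  shows "f \<in> L2_sphere"
proof -
  interpret finite_measure "sphere_measure :: (real ^ 'n) measure" by (rule finite_measure_sphere)
  have "integrable sphere_measure (\<lambda>x. (norm (f x))\<^sup>2)"
    using f by (intro integrable_const_bound[of _ "K\<^sup>2"]) (auto intro!: AE_I2 power_mono K)
  then show ?thesis using f by (simp add: L2_sphere_def)
qed

lemma L2_sphere_continuous:
  fixes f :: "real ^ 'n \<Rightarrow> 'b::euclidean_space"
  assumes "continuous_on (sphere 0 1) f" shows "f \<in> L2_sphere"
  using bounded_on_sphere[OF assms] L2_sphere_bounded[OF borel_measurable_sphere_continuous[OF assms]] by blast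

lemma integrable_L2_inner:
  fixes f g :: "real ^ 'n \<Rightarrow> 'b::euclidean_space"
  assumes f: "f \<in> L2_sphere" and g: "g \<in> L2_sphere"
  shows "integrable sphere_measure (\<lambda>x. f x \<bullet> g x)"
proof (rule Bochner_Integration.integrable_bound)
  show "integrable sphere_measure (\<lambda>x. (norm (f x))\<^sup>2 + (norm (g x))\<^sup>2)"
    by (intro Bochner_Integration.integrable_add L2_sphereD f g)
  show "(\<lambda>x. f x \<bullet> g x) \<in> borel_measurable sphere_measure"
    using L2_sphereD(1)[OF f] L2_sphereD(1)[OF g] by simp
  show "AE x in sphere_measure. norm (f x \<bullet> g x) \<le> norm ((norm (f x))\<^sup>2 + (norm (g x))\<^sup>2)"
  proof (rule AE_I2)
    fix x
    have "\<bar>f x \<bullet> g x\<bar> \<le> norm (f x) * norm (g x)" by (rule Cauchy_Schwarz_ineq2)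
    also have "\<dots> \<le> (norm (f x))\<^sup>2 + (norm (g x))\<^sup>2"
    proof -
      have "0 \<le> norm (f x) * norm (g x)" by simp
      then show ?thesis using sum_squares_bound[of "norm (f x)" "norm (g x)"] by linarith
    qed
    finally show "norm (f x \<bullet> g x) \<le> norm ((norm (f x))\<^sup>2 + (norm (g x))\<^sup>2)" by simp
  qed
qed

lemma L2_sphere_diff:
  fixes f g :: "real ^ 'n \<Rightarrow> 'b::euclidean_space"
  assumes f: "f \<in> L2_sphere" and g: "g \<in> L2_sphere"
  shows "(\<lambda>x. f x - g x) \<in> L2_sphere"
proof -
  have "(\<lambda>x. f x - g x) \<in> borel_measurable sphere_measure"
    using L2_sphereD(1)[OF f] L2_sphereD(1)[OF g] by simp
  moreover have "(\<lambda>x. (norm (f x - g x))\<^sup>2) = (\<lambda>x. (norm (f x))\<^sup>2 - 2 * (f x \<bullet> g x) + (norm (g x))\<^sup>2)"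
    by (rule ext) (simp add: power2_norm_eq_inner inner_diff_left inner_diff_right inner_commute)
  moreover have "integrable sphere_measure (\<lambda>x. (norm (f x))\<^sup>2 - 2 * (f x \<bullet> g x) + (norm (g x))\<^sup>2)"
    using L2_sphereD(2)[OF f] L2_sphereD(2)[OF g] integrable_L2_inner[OF f g] by simp
  ultimately show ?thesis by (simp add: L2_sphere_def)
qed

lemma smooth_on_sphere_continuous:
  assumes "smooth_on_sphere X" shows "continuous_on (sphere 0 1) X"
proof -
  obtain W F where W: "open W" "sphere 0 1 \<subseteq> W" "\<And>k. Ck_on k W F" "\<And>x. x \<in> sphere 0 1 \<Longrightarrow> X x = F x"
    using assms unfolding smooth_on_sphere_def by blast
  have "continuous_on (sphere 0 1) F" using W(3)[of 0] W(2) continuous_on_subset by auto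
  then show ?thesis by (rule continuous_on_cong[THEN iffD1, rotated -1]) (auto simp: W(4))
qed

lemma sphere_div_continuous:
  fixes X :: "real ^ 'n \<Rightarrow> real ^ 'n"
  assumes "smooth_on_sphere X"
  shows "continuous_on (sphere 0 1) (sphere_div X)"
proof -
  obtain H where H: "\<And>j. sphere_C1 (\<lambda>x. X x $ j) (H j)" using sphere_C1_components[OF assms] by blast
  have "continuous_on (sphere 0 1) (\<lambda>x. \<Sum>j\<in>UNIV. H j x $ j)"
    by (intro continuous_intros sphere_C1_continuous(1)[OF H])
  then show ?thesis
    by (rule continuous_on_cong[THEN iffD1, rotated -1]) (auto simp: sphere_div_def sphere_gradient_eq[OF H])
qed

lemma tangential_polynomial:
  fixes v :: "real ^ 'n"
  assumes "real_polynomial_function \<phi>"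
  shows "polynomial_function (\<lambda>x. \<phi> x *\<^sub>R (v - (v \<bullet> x) *\<^sub>R x))"
proof -
  have "polynomial_function (\<lambda>x::real ^ 'n. v \<bullet> x)" by (intro polynomial_function_bounded_linear bounded_linear_inner_right)
  then show ?thesis using assms
    by (intro polynomial_function_mult polynomial_function_diff polynomial_function_const) (auto simp: real_polynomial_function_eq)
qed

text \<open>The difference D of two weak gradients is tangential and integrates to zero against
  every smooth tangential field. A polynomial times the tangential part of the axis j isolates
  \<open>D x $ j\<close>, since D is orthogonal to the normal part.\<close>

lemma weak_gradient_unique:
  fixes u :: "real ^ 'n \<Rightarrow> real"
  assumes G: "G \<in> L2_sphere" "has_weak_gradient u G" and H: "H \<in> L2_sphere" "has_weak_gradient u H"
  shows "AE x in sphere_measure. G x = H x"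
proof -
  define D where "D x = G x - H x" for x
  have D2: "D \<in> L2_sphere" unfolding D_def[abs_def] by (intro L2_sphere_diff G H)
  have "AE x in sphere_measure. G x \<bullet> x = 0" "AE x in sphere_measure. H x \<bullet> x = 0"
    using G(2) H(2) by (auto simp: has_weak_gradient_def)
  then have Dx: "AE x in sphere_measure. D x \<bullet> x = 0"
    by eventually_elim (simp add: D_def inner_diff_left)
  have DX: "(LINT x|sphere_measure. D x \<bullet> X x) = 0"
    if X: "smooth_on_sphere X" "\<forall>x\<in>sphere 0 1. X x \<bullet> x = 0" for X
  proof -
    have X2: "X \<in> L2_sphere" by (intro L2_sphere_continuous smooth_on_sphere_continuous X)
    have "(LINT x|sphere_measure. D x \<bullet> X x) = (LINT x|sphere_measure. G x \<bullet> X x) - (LINT x|sphere_measure. H x \<bullet> X x)"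
      unfolding D_def inner_diff_left
      by (intro Bochner_Integration.integral_diff integrable_L2_inner G H X2)
    then show ?thesis using G(2) H(2) X by (auto simp: has_weak_gradient_def)
  qed
  have "AE x in sphere_measure. D x $ j = 0" for j
  proof (rule sphere_integral_polynomials_zero)
    have "integrable sphere_measure (\<lambda>x. D x \<bullet> axis j 1)"
      by (intro integrable_L2_inner D2 L2_sphere_continuous continuous_on_const)
    then show "integrable sphere_measure (\<lambda>x. D x $ j)" by (simp add: inner_axis)
    fix \<phi> :: "real ^ 'n \<Rightarrow> real" assume \<phi>: "real_polynomial_function \<phi>"
    define X where "X x = \<phi> x *\<^sub>R (axis j 1 - (axis j 1 \<bullet> x) *\<^sub>R x)" for x
    have X: "smooth_on_sphere X" "\<forall>x\<in>sphere 0 1. X x \<bullet> x = 0"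
      using smooth_on_sphere_polynomial[OF tangential_polynomial[OF \<phi>]]
      by (auto simp: X_def[abs_def] inner_diff_left norm_eq_1)
    have "\<phi> \<in> L2_sphere" using \<phi> by (intro L2_sphere_continuous) (auto simp: real_polynomial_function_eq continuous_on_polymonial_function)
    have "(LINT x|sphere_measure. \<phi> x * D x $ j) = (LINT x|sphere_measure. D x \<bullet> X x)"
    proof (rule integral_cong_AE)
      have "D \<in> borel_measurable sphere_measure" by (rule L2_sphereD(1)[OF D2])
      moreover have "X \<in> borel_measurable sphere_measure"
        by (intro borel_measurable_sphere_continuous smooth_on_sphere_continuous X)
      ultimately show "(\<lambda>x. D x \<bullet> X x) \<in> borel_measurable sphere_measure" by simp
      show "(\<lambda>x. \<phi> x * D x $ j) \<in> borel_measurable sphere_measure"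
        using \<open>integrable sphere_measure (\<lambda>x. D x $ j)\<close> L2_sphereD(1)[OF \<open>\<phi> \<in> L2_sphere\<close>] by simp
      show "AE x in sphere_measure. \<phi> x * D x $ j = D x \<bullet> X x"
        using Dx by eventually_elim (simp add: X_def inner_diff_right inner_axis)
    qed
    then show "(LINT x|sphere_measure. \<phi> x * D x $ j) = 0" using DX[OF X] by simp
  qed
  then have "AE x in sphere_measure. \<forall>j\<in>UNIV. D x $ j = 0" by (intro AE_finite_allI) auto
  then show ?thesis by eventually_elim (simp add: D_def vec_eq_iff)
qed

lemma weak_gradient_props:
  assumes "G \<in> L2_sphere" "has_weak_gradient u G"
  shows "weak_gradient u \<in> L2_sphere" "has_weak_gradient u (weak_gradient u)"
    "AE x in sphere_measure. weak_gradient u x = G x"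
proof -
  have "weak_gradient u \<in> L2_sphere \<and> has_weak_gradient u (weak_gradient u)"
    unfolding weak_gradient_def by (rule someI[of _ G]) (use assms in auto)
  then show "weak_gradient u \<in> L2_sphere" "has_weak_gradient u (weak_gradient u)" by auto
  then show "AE x in sphere_measure. weak_gradient u x = G x" using weak_gradient_unique assms by blast
qed

lemma H1_sphere_weak_gradient:
  assumes "u \<in> H1_sphere"
  shows "u \<in> L2_sphere" "weak_gradient u \<in> L2_sphere" "has_weak_gradient u (weak_gradient u)"
  using assms weak_gradient_props unfolding H1_sphere_def by blast+

lemma weak_gradient_norm_integral:
  fixes u :: "real ^ 'n \<Rightarrow> real"
  assumes "G \<in> L2_sphere" "has_weak_gradient u G"
  shows "(LINT x|sphere_measure. (norm (weak_gradient u x))\<^sup>2) = (LINT x|sphere_measure. (norm (G x))\<^sup>2)"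
proof (rule integral_cong_AE)
  show "AE x in sphere_measure. (norm (weak_gradient u x))\<^sup>2 = (norm (G x))\<^sup>2"
    using weak_gradient_props(3)[OF assms] by eventually_elim simp
qed (use L2_sphereD(1)[OF weak_gradient_props(1)[OF assms]] L2_sphereD(1)[OF assms(1)] in auto)

lemma has_weak_gradient_diff:
  fixes u v :: "real ^ 'n \<Rightarrow> real"
  assumes u: "u \<in> L2_sphere" "G \<in> L2_sphere" "has_weak_gradient u G"
    and v: "v \<in> L2_sphere" "H \<in> L2_sphere" "has_weak_gradient v H"
  shows "has_weak_gradient (\<lambda>x. u x - v x) (\<lambda>x. G x - H x)"
  unfolding has_weak_gradient_def
proof (intro conjI allI impI)
  have "AE x in sphere_measure. G x \<bullet> x = 0" "AE x in sphere_measure. H x \<bullet> x = 0"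
    using u(3) v(3) by (auto simp: has_weak_gradient_def)
  then show "AE x in sphere_measure. (G x - H x) \<bullet> x = 0"
    by eventually_elim (simp add: inner_diff_left)
  fix X :: "real ^ 'n \<Rightarrow> real ^ 'n" assume X: "smooth_on_sphere X" "\<forall>x\<in>sphere 0 1. X x \<bullet> x = 0"
  have X2: "X \<in> L2_sphere" by (intro L2_sphere_continuous smooth_on_sphere_continuous X)
  have d2: "sphere_div X \<in> L2_sphere" by (intro L2_sphere_continuous sphere_div_continuous X)
  have "(LINT x|sphere_measure. (G x - H x) \<bullet> X x) = (LINT x|sphere_measure. G x \<bullet> X x) - (LINT x|sphere_measure. H x \<bullet> X x)"
    unfolding inner_diff_left by (intro Bochner_Integration.integral_diff integrable_L2_inner u v X2)
  also have "\<dots> = - ((LINT x|sphere_measure. u x * sphere_div X x) - (LINT x|sphere_measure. v x * sphere_div X x))"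
    using u(3) v(3) X by (auto simp: has_weak_gradient_def)
  also have "(LINT x|sphere_measure. u x * sphere_div X x) - (LINT x|sphere_measure. v x * sphere_div X x) = (LINT x|sphere_measure. (u x - v x) * sphere_div X x)"
    unfolding left_diff_distrib
    using integrable_L2_inner[OF u(1) d2] integrable_L2_inner[OF v(1) d2]
    by (intro Bochner_Integration.integral_diff[symmetric]) auto
  finally show "(LINT x|sphere_measure. (G x - H x) \<bullet> X x) = - (LINT x|sphere_measure. (u x - v x) * sphere_div X x)" .
qed

lemma H1_norm_diff:
  fixes u v :: "real ^ 'n \<Rightarrow> real"
  assumes u: "u \<in> L2_sphere" "G \<in> L2_sphere" "has_weak_gradient u G"
    and v: "v \<in> L2_sphere" "H \<in> L2_sphere" "has_weak_gradient v H"
  shows "H1_norm (\<lambda>x. u x - v x) = sqrt ((LINT x|sphere_measure. (u x - v x)\<^sup>2) + (LINT x|sphere_measure. (norm (G x - H x))\<^sup>2))"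
  unfolding H1_norm_def
  by (subst weak_gradient_norm_integral[OF L2_sphere_diff[OF u(2) v(2)] has_weak_gradient_diff[OF u v]]) simp

lemma sphere_C1_L2:
  fixes u :: "real ^ 'n \<Rightarrow> real"
  assumes "sphere_C1 u g" shows "u \<in> L2_sphere" "g \<in> L2_sphere"
  using sphere_C1_continuous[OF assms] by (auto intro: L2_sphere_continuous)

lemma sphere_C1_const_diff:
  assumes "sphere_C1 u g" shows "sphere_C1 (\<lambda>x. c - u x) (\<lambda>x. - g x)"
  using assms unfolding sphere_C1_def
  by (auto intro!: continuous_intros derivative_eq_intros simp: fun_eq_iff)

text \<open>The tangential part of p is the gradient of the height \<open>p \<bullet> x\<close>, and
  its divergence is - (n - 1) times the height. Testing q against this field gives the formula; as G
  is tangential, it may be paired with p itself.\<close>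

lemma zonal_divergence:
  fixes p :: "real ^ 'n"
  assumes q: "sphere_C1 q G"
  shows "(LINT x|sphere_measure. G x \<bullet> p - real (CARD('n) - 1) * (p \<bullet> x) * q x) = 0"
proof -
  define X where "X x = p - (p \<bullet> x) *\<^sub>R x" for x
  have "polynomial_function X"
    using tangential_polynomial[of "\<lambda>_. 1" p] by (simp add: X_def[abs_def] real_polynomial_function.intros)
  then have X: "smooth_on_sphere X" "\<forall>x\<in>sphere 0 1. X x \<bullet> x = 0"
    by (auto intro!: smooth_on_sphere_polynomial simp: X_def inner_diff_left norm_eq_1)
  have "(axis j 1 :: real ^ 'n) \<bullet> x = x $ j" for x j by (simp add: inner_axis')
  then have cj: "sphere_C1 (\<lambda>x::real ^ 'n. x $ j) (\<lambda>x. axis j 1 - (x $ j) *\<^sub>R x)" for j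
    using sphere_C1_inner[of "axis j (1::real) :: real ^ 'n"] by simp
  have Xj: "sphere_C1 (\<lambda>x. X x $ j) (\<lambda>x. - ((p \<bullet> x) *\<^sub>R (axis j 1 - (x $ j) *\<^sub>R x) + x $ j *\<^sub>R (p - (p \<bullet> x) *\<^sub>R x)))" for j
    using sphere_C1_const_diff[OF sphere_C1_mult[OF sphere_C1_inner[of p] cj[of j]], of "p $ j"] by (simp add: X_def)
  have div: "sphere_div X x = - (real (CARD('n) - 1) * (p \<bullet> x))" if x: "norm x = 1" for x
  proof -
    have xx: "(\<Sum>j\<in>UNIV. x $ j * x $ j) = 1" using x by (simp add: norm_eq_1 inner_vec_def)
    have px: "(\<Sum>j\<in>UNIV. x $ j * p $ j) = p \<bullet> x" by (simp add: inner_vec_def mult.commute)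
    have "sphere_div X x = (\<Sum>j\<in>UNIV. 2 * (p \<bullet> x) * (x $ j * x $ j) - (p \<bullet> x) - x $ j * p $ j)"
      unfolding sphere_div_def sphere_gradient_eq[OF Xj x] by (intro sum.cong) (auto simp: algebra_simps axis_def)
    also have "\<dots> = 2 * (p \<bullet> x) * (\<Sum>j\<in>UNIV. x $ j * x $ j) - (\<Sum>j\<in>(UNIV :: 'n set). p \<bullet> x) - (\<Sum>j\<in>UNIV. x $ j * p $ j)"
      by (simp only: sum_subtractf sum_distrib_left)
    also have "\<dots> = - (real (CARD('n) - 1) * (p \<bullet> x))" unfolding xx px by (simp add: of_nat_diff algebra_simps)
    finally show ?thesis .
  qed
  have "(LINT x|sphere_measure. G x \<bullet> X x) = - (LINT x|sphere_measure. q x * sphere_div X x)"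
    using sphere_C1_weak_gradient[OF q] X by (auto simp: has_weak_gradient_def)
  moreover have "(LINT x|sphere_measure. G x \<bullet> X x) = (LINT x|sphere_measure. G x \<bullet> p)"
    by (rule Bochner_Integration.integral_cong) (use sphere_C1D(1)[OF q] in \<open>auto simp: X_def inner_diff_right\<close>)
  moreover have "- (LINT x|sphere_measure. q x * sphere_div X x) = (LINT x|sphere_measure. real (CARD('n) - 1) * (p \<bullet> x) * q x)"
    unfolding Bochner_Integration.integral_minus[symmetric]
    by (rule Bochner_Integration.integral_cong) (auto simp: div)
  moreover have "integrable sphere_measure (\<lambda>x. G x \<bullet> p)" "integrable sphere_measure (\<lambda>x. real (CARD('n) - 1) * (p \<bullet> x) * q x)"
    by (intro integrable_sphere_continuous continuous_intros sphere_C1_continuous[OF q])+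
  ultimately show ?thesis by simp
qed

text \<open>Dominated convergence passes to the limit both in the weak formula and in the H1 norm.
  The limit may have a kink, as the eigenfunction extended by zero does.\<close>

lemma weak_gradient_limit:
  fixes u :: "nat \<Rightarrow> real ^ 'n \<Rightarrow> real"
  assumes C1: "\<And>k. sphere_C1 (u k) (g k)"
    and bd: "\<And>k x. norm x = 1 \<Longrightarrow> \<bar>u k x\<bar> \<le> K" "\<And>k x. norm x = 1 \<Longrightarrow> norm (g k x) \<le> K"
    and lim: "\<And>x. norm x = 1 \<Longrightarrow> (\<lambda>k. u k x) \<longlonglongrightarrow> U x" "\<And>x. norm x = 1 \<Longrightarrow> (\<lambda>k. g k x) \<longlonglongrightarrow> G x"
  shows "U \<in> L2_sphere" "G \<in> L2_sphere" "has_weak_gradient U G"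
    "(\<lambda>k. H1_norm (\<lambda>x. U x - u k x)) \<longlonglongrightarrow> 0"
proof -
  let ?M = "sphere_measure :: (real ^ 'n) measure"
  interpret finite_measure ?M by (rule finite_measure_sphere)
  note L2k = sphere_C1_L2[OF C1] and wk = sphere_C1_weak_gradient[OF C1]
  have Um: "U \<in> borel_measurable ?M"
    by (rule borel_measurable_LIMSEQ_metric[OF L2_sphereD(1)[OF L2k(1)]]) (use lim in auto)
  have Gm: "G \<in> borel_measurable ?M"
    by (rule borel_measurable_LIMSEQ_metric[OF L2_sphereD(1)[OF L2k(2)]]) (use lim in auto)
  have Ub: "\<bar>U x\<bar> \<le> K" if "norm x = 1" for x
    by (rule Lim_bounded[OF tendsto_rabs[OF lim(1)[OF that]], of 0]) (use bd(1)[OF that] in auto)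
  have Gb: "norm (G x) \<le> K" if "norm x = 1" for x
    by (rule Lim_bounded[OF tendsto_norm[OF lim(2)[OF that]], of 0]) (use bd(2)[OF that] in auto)
  show UL: "U \<in> L2_sphere" by (rule L2_sphere_bounded[OF Um]) (use Ub in auto)
  show GL: "G \<in> L2_sphere" by (rule L2_sphere_bounded[OF Gm Gb])
  show W: "has_weak_gradient U G"
    unfolding has_weak_gradient_def
  proof (intro conjI allI impI)
    show "AE x in ?M. G x \<bullet> x = 0"
    proof (rule AE_I2)
      fix x assume "x \<in> space ?M"
      then have x: "norm x = 1" by simp
      have "(\<lambda>k. g k x \<bullet> x) \<longlonglongrightarrow> G x \<bullet> x" by (intro tendsto_inner tendsto_const lim(2) x)
      then show "G x \<bullet> x = 0" using sphere_C1D(1)[OF C1 x] by (simp add: LIMSEQ_const_iff)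
    qed
    fix X :: "real ^ 'n \<Rightarrow> real ^ 'n" assume X: "smooth_on_sphere X" "\<forall>x\<in>sphere 0 1. X x \<bullet> x = 0"
    have Xc: "continuous_on (sphere 0 1) X" by (rule smooth_on_sphere_continuous[OF X(1)])
    have Dc: "continuous_on (sphere 0 1) (sphere_div X)" by (rule sphere_div_continuous[OF X(1)])
    obtain k1 where k1: "k1 \<ge> 0" "\<And>x. norm x = 1 \<Longrightarrow> norm (X x) \<le> k1" using bounded_on_sphere[OF Xc] by blast
    obtain k2 where k2: "k2 \<ge> 0" "\<And>x. norm x = 1 \<Longrightarrow> norm (sphere_div X x) \<le> k2" using bounded_on_sphere[OF Dc] by blast
    have Xm: "X \<in> borel_measurable ?M" "sphere_div X \<in> borel_measurable ?M"
      by (intro borel_measurable_sphere_continuous Xc Dc)+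
    have "(\<lambda>k. LINT x|?M. g k x \<bullet> X x) \<longlonglongrightarrow> (LINT x|?M. G x \<bullet> X x)"
    proof (rule integral_dominated_convergence[where w = "\<lambda>_. K * k1"])
      show "AE x in ?M. (\<lambda>k. g k x \<bullet> X x) \<longlonglongrightarrow> G x \<bullet> X x"
        by (intro AE_I2 tendsto_inner tendsto_const lim(2)) simp
      show "AE x in ?M. norm (g k x \<bullet> X x) \<le> K * k1" for k
      proof (rule AE_I2)
        fix x assume "x \<in> space ?M"
        then have x: "norm x = 1" by simp
        have "\<bar>g k x \<bullet> X x\<bar> \<le> norm (g k x) * norm (X x)" by (rule Cauchy_Schwarz_ineq2)
        also have "\<dots> \<le> K * k1" using bd(2)[OF x] k1(2)[OF x] by (intro mult_mono) (auto intro: order_trans[OF norm_ge_zero])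
        finally show "norm (g k x \<bullet> X x) \<le> K * k1" by simp
      qed
    qed (use Gm Xm L2_sphereD(1)[OF L2k(2)] in auto)
    moreover have "(\<lambda>k. LINT x|?M. u k x * sphere_div X x) \<longlonglongrightarrow> (LINT x|?M. U x * sphere_div X x)"
    proof (rule integral_dominated_convergence[where w = "\<lambda>_. K * k2"])
      show "AE x in ?M. (\<lambda>k. u k x * sphere_div X x) \<longlonglongrightarrow> U x * sphere_div X x"
        by (intro AE_I2 tendsto_mult tendsto_const lim(1)) simp
      show "AE x in ?M. norm (u k x * sphere_div X x) \<le> K * k2" for k
      proof (rule AE_I2)
        fix x assume "x \<in> space ?M"
        then have x: "norm x = 1" by simp
        have "\<bar>u k x\<bar> * \<bar>sphere_div X x\<bar> \<le> K * k2" using bd(1)[OF x] k2(2)[OF x] by (intro mult_mono) (auto intro: order_trans[OF abs_ge_zero])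
        then show "norm (u k x * sphere_div X x) \<le> K * k2" by (simp add: abs_mult)
      qed
    qed (use Um Xm L2_sphereD(1)[OF L2k(1)] in auto)
    then have "(\<lambda>k. - (LINT x|?M. u k x * sphere_div X x)) \<longlonglongrightarrow> - (LINT x|?M. U x * sphere_div X x)" by (rule tendsto_minus)
    moreover have "(LINT x|?M. g k x \<bullet> X x) = - (LINT x|?M. u k x * sphere_div X x)" for k
      using wk[of k] X by (auto simp: has_weak_gradient_def)
    ultimately show "(LINT x|?M. G x \<bullet> X x) = - (LINT x|?M. U x * sphere_div X x)"
      using LIMSEQ_unique by simp
  qed
  have "(\<lambda>k. LINT x|?M. (U x - u k x)\<^sup>2) \<longlonglongrightarrow> (LINT x|?M. 0)"
  proof (rule integral_dominated_convergence[where w = "\<lambda>_. (2 * K)\<^sup>2"])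
    show "AE x in ?M. (\<lambda>k. (U x - u k x)\<^sup>2) \<longlonglongrightarrow> 0"
      by (rule AE_I2) (auto intro!: tendsto_eq_intros lim(1))
    show "AE x in ?M. norm ((U x - u k x)\<^sup>2) \<le> (2 * K)\<^sup>2" for k
    proof (rule AE_I2)
      fix x assume "x \<in> space ?M"
      then have x: "norm x = 1" by simp
      have "\<bar>U x - u k x\<bar> \<le> 2 * K" using Ub[OF x] bd(1)[OF x, of k] by linarith
      then have "\<bar>U x - u k x\<bar>\<^sup>2 \<le> (2 * K)\<^sup>2" by (intro power_mono) auto
      then show "norm ((U x - u k x)\<^sup>2) \<le> (2 * K)\<^sup>2" by simp
    qed
  qed (use Um L2_sphereD(1)[OF L2k(1)] in auto)
  moreover have "(\<lambda>k. LINT x|?M. (norm (G x - g k x))\<^sup>2) \<longlonglongrightarrow> (LINT x|?M. 0)"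
  proof (rule integral_dominated_convergence[where w = "\<lambda>_. (2 * K)\<^sup>2"])
    show "AE x in ?M. (\<lambda>k. (norm (G x - g k x))\<^sup>2) \<longlonglongrightarrow> 0"
      by (rule AE_I2) (auto intro!: tendsto_eq_intros lim(2))
    show "AE x in ?M. norm ((norm (G x - g k x))\<^sup>2) \<le> (2 * K)\<^sup>2" for k
    proof (rule AE_I2)
      fix x assume "x \<in> space ?M"
      then have x: "norm x = 1" by simp
      have "norm (G x - g k x) \<le> 2 * K" using Gb[OF x] bd(2)[OF x, of k] norm_triangle_ineq4[of "G x" "g k x"] by linarith
      then have "(norm (G x - g k x))\<^sup>2 \<le> (2 * K)\<^sup>2" by (intro power_mono) auto
      then show "norm ((norm (G x - g k x))\<^sup>2) \<le> (2 * K)\<^sup>2" by simp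
    qed
  qed (use Gm L2_sphereD(1)[OF L2k(2)] in auto)
  ultimately have "(\<lambda>k. sqrt ((LINT x|?M. (U x - u k x)\<^sup>2) + (LINT x|?M. (norm (G x - g k x))\<^sup>2))) \<longlonglongrightarrow> sqrt (0 + 0)"
    by (intro tendsto_real_sqrt tendsto_add) simp_all
  then show "(\<lambda>k. H1_norm (\<lambda>x. U x - u k x)) \<longlonglongrightarrow> 0"
    unfolding H1_norm_diff[OF UL GL W L2k wk] by simp
qed

subsection \<open>Cutoff functions and Barta's inequality\<close>

text \<open>A family closed under differentiation, made to serve as the class in
  \<open>Ck_on_affine_family\<close>. \<open>flat 1\<close> is the cutoff profile and
  \<open>flat [:0, 0, 1:]\<close> its derivative.\<close>

definition flat :: "real poly \<Rightarrow> real \<Rightarrow> real" where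
  "flat q t = (if 0 < t then poly q (1 / t) * exp (- (1 / t)) else 0)"

lemma poly_times_exp_tendsto_0:
  fixes r :: "real poly"
  shows "((\<lambda>s. poly r s * exp (- s)) \<longlongrightarrow> 0) at_top"
proof -
  have "((\<lambda>s. \<Sum>i\<le>degree r. coeff r i * (s ^ i / exp s)) \<longlongrightarrow> (\<Sum>i\<le>degree r. coeff r i * 0)) at_top"
    by (intro tendsto_sum tendsto_mult tendsto_const tendsto_power_div_exp_0)
  moreover have "(\<lambda>s. \<Sum>i\<le>degree r. coeff r i * (s ^ i / exp s)) = (\<lambda>s. poly r s * exp (- s))"
    by (rule ext) (simp add: poly_altdef sum_distrib_right exp_minus divide_inverse mult.assoc)
  ultimately show ?thesis by simp
qed

text \<open>In terms of the variable 1 / t, differentiation replaces q by q - q' times the square of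
  the variable. At 0 the right difference quotient is again a polynomial in 1 / t times the
  exponential, which tends to 0.\<close>

lemma flat_deriv: "(flat q has_real_derivative flat ((q - pderiv q) * [:0, 0, 1:]) t) (at t)"
proof -
  consider "t > 0" | "t < 0" | "t = 0" by linarith
  then show ?thesis
  proof cases
    case 1
    have "((\<lambda>t. poly q (1 / t) * exp (- (1 / t))) has_real_derivative
        (poly q (1 / t) * (exp (- (1 / t)) * (1 / t\<^sup>2)) + - (1 / t\<^sup>2) * poly (pderiv q) (1 / t) * exp (- (1 / t)))) (at t)"
      using 1 by (auto intro!: derivative_eq_intros simp: power2_eq_square field_simps)
    moreover have "poly q (1 / t) * (exp (- (1 / t)) * (1 / t\<^sup>2)) + - (1 / t\<^sup>2) * poly (pderiv q) (1 / t) * exp (- (1 / t))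
      = flat ((q - pderiv q) * [:0, 0, 1:]) t"
      using 1 by (simp add: flat_def power2_eq_square field_simps)
    ultimately have "((\<lambda>t. poly q (1 / t) * exp (- (1 / t))) has_real_derivative flat ((q - pderiv q) * [:0, 0, 1:]) t) (at t)" by simp
    then show ?thesis
      by (rule has_field_derivative_transform_within_open[of _ _ _ "{0<..}"]) (use 1 in \<open>auto simp: flat_def\<close>)
  next
    case 2
    have "((\<lambda>t. 0) has_real_derivative 0) (at t)" by simp
    then have "(flat q has_real_derivative 0) (at t)"
      by (rule has_field_derivative_transform_within_open[of _ _ _ "{..<0}"]) (use 2 in \<open>auto simp: flat_def\<close>)
    then show ?thesis using 2 by (simp add: flat_def)
  next
    case 3
    have "((\<lambda>h. poly (pCons 0 q) (1 / h) * exp (- (1 / h))) \<longlongrightarrow> 0) (at_right 0)"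
      using filterlim_compose[OF poly_times_exp_tendsto_0 filterlim_inverse_at_top_right, of "pCons 0 q"] by (simp add: inverse_eq_divide)
    then have r: "((\<lambda>h. flat q h / h) \<longlongrightarrow> 0) (at_right 0)"
      by (rule Lim_transform_eventually) (auto simp: eventually_at_filter flat_def)
    have l: "((\<lambda>h. flat q h / h) \<longlongrightarrow> 0) (at_left 0)"
      by (rule tendsto_eventually) (auto simp: eventually_at_filter flat_def)
    have "((\<lambda>h. flat q h / h) \<longlongrightarrow> 0) (at 0)" using r l by (simp add: filterlim_split_at)
    then show ?thesis using 3 by (simp add: DERIV_def flat_def)
  qed
qed

lemma flat_continuous: "isCont (flat q) t"
  by (rule DERIV_isCont[OF flat_deriv])

lemma flat_1_bounds: "0 \<le> flat 1 t" "flat 1 t \<le> 1"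
  by (auto simp: flat_def)

text \<open>The bound that keeps the gradients of the cutoffs below bounded: a function vanishing linearly at \<open>z0\<close> is
  multiplied by a cutoff at distance \<open>1 / (k + 1)\<close> from \<open>z0\<close>.\<close>

lemma flat_2_bound: "0 \<le> flat [:0, 0, 1:] t" "(t + 1) * flat [:0, 0, 1:] t \<le> 2"
proof -
  show "0 \<le> flat [:0, 0, 1:] t" by (simp add: flat_def)
  show "(t + 1) * flat [:0, 0, 1:] t \<le> 2"
  proof (cases "t > 0")
    case True
    define s where "s = 1 / t"
    have s: "s > 0" using True by (simp add: s_def)
    have "(t + 1) * flat [:0, 0, 1:] t = (s + s\<^sup>2) * exp (- s)"
      using True by (simp add: flat_def s_def power2_eq_square field_simps)
    \<comment> \<open>By exp s \<ge> 1 + s + s^2 / 2 for nonnegative s.\<close>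
    also have "\<dots> \<le> 2 * exp s * exp (- s)"
      using exp_lower_Taylor_quadratic[of s] s by (intro mult_right_mono) auto
    also have "\<dots> = 2" by (simp add: exp_minus)
    finally show ?thesis .
  qed (simp add: flat_def)
qed

text \<open>The factor vanishes up to z0 + 1 / (k + 1) and has no plateau at 1. Since exp (- 1 / t)
  tends to 1 for large t, it converges to 1 at every fixed z > z0 as k grows.\<close>

definition cutoff :: "nat \<Rightarrow> real \<Rightarrow> (real \<Rightarrow> real) \<Rightarrow> real \<Rightarrow> real" where
  "cutoff k z0 F z = (if z0 < z then F z * flat 1 (real (Suc k) * (z - z0) - 1) else 0)"

definition cutoff' :: "nat \<Rightarrow> real \<Rightarrow> (real \<Rightarrow> real) \<Rightarrow> (real \<Rightarrow> real) \<Rightarrow> real \<Rightarrow> real" where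
  "cutoff' k z0 F F' z = (if z0 < z then F' z * flat 1 (real (Suc k) * (z - z0) - 1)
     + F z * (real (Suc k) * flat [:0, 0, 1:] (real (Suc k) * (z - z0) - 1)) else 0)"

lemma cutoff_zero:
  assumes "z < z0 + 1 / real (Suc k)"
  shows "cutoff k z0 F z = 0" "cutoff' k z0 F F' z = 0"
proof -
  have "real (Suc k) * (z - z0) < 1" using assms by (simp add: field_simps)
  then show "cutoff k z0 F z = 0" "cutoff' k z0 F F' z = 0" by (auto simp: cutoff_def cutoff'_def flat_def)
qed

lemma cutoff_cover: "z0 < z \<or> z < z0 + 1 / real (Suc k)"
proof -
  have "0 < 1 / real (Suc k)" by simp
  then show ?thesis by linarith
qed

text \<open>The bound 3 is the right end of the interval |1 - z| < 2 on which the power series in 1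
  - z converge; it leaves room to differentiate at z = 1. At z \<le> z0 the cutoff is zero in a
  neighbourhood.\<close>

lemma cutoff_deriv:
  assumes F: "\<And>z. z0 < z \<Longrightarrow> z < 3 \<Longrightarrow> (F has_real_derivative F' z) (at z)" and z: "z < 3"
  shows "(cutoff k z0 F has_real_derivative cutoff' k z0 F F' z) (at z)"
proof (cases "z0 < z")
  case True
  have "((\<lambda>z. real (Suc k) * (z - z0) - 1) has_real_derivative real (Suc k)) (at z)"
    by (auto intro!: derivative_eq_intros)
  from DERIV_chain2[OF flat_deriv[of 1] this]
  have "((\<lambda>z. F z * flat 1 (real (Suc k) * (z - z0) - 1)) has_real_derivative
     F' z * flat 1 (real (Suc k) * (z - z0) - 1) + flat [:0, 0, 1:] (real (Suc k) * (z - z0) - 1) * real (Suc k) * F z) (at z)"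
    by (intro DERIV_mult F True z) simp
  then have "((\<lambda>z. F z * flat 1 (real (Suc k) * (z - z0) - 1)) has_real_derivative cutoff' k z0 F F' z) (at z)"
    using True by (simp add: cutoff'_def mult_ac)
  then show ?thesis
    by (rule has_field_derivative_transform_within_open[of _ _ _ "{z0<..}"]) (use True in \<open>auto simp: cutoff_def\<close>)
next
  case False
  then have z': "z < z0 + 1 / real (Suc k)" using cutoff_cover by blast
  have "((\<lambda>z. 0) has_real_derivative 0) (at z)" by simp
  then have "(cutoff k z0 F has_real_derivative 0) (at z)"
    by (rule has_field_derivative_transform_within_open[of _ _ _ "{..<z0 + 1 / real (Suc k)}"]) (use z' in \<open>auto simp: cutoff_zero\<close>)
  then show ?thesis using cutoff_zero(2)[OF z'] by simp
qed

lemma cutoff'_continuous: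
  assumes F: "\<And>z. z0 < z \<Longrightarrow> z < 3 \<Longrightarrow> (F has_real_derivative F' z) (at z)"
    and F': "\<And>z. z0 < z \<Longrightarrow> z < 3 \<Longrightarrow> isCont F' z"
  shows "continuous_on {..<3} (cutoff' k z0 F F')"
proof -
  have 1: "continuous_on {z0<..<3} (cutoff' k z0 F F')"
  proof (rule continuous_on_cong[THEN iffD1, OF refl])
    show "continuous_on {z0<..<3} (\<lambda>z. F' z * flat 1 (real (Suc k) * (z - z0) - 1)
     + F z * (real (Suc k) * flat [:0, 0, 1:] (real (Suc k) * (z - z0) - 1)))"
    proof (intro continuous_at_imp_continuous_on ballI)
      fix z assume "z \<in> {z0<..<3}"
      then have z: "z0 < z" "z < 3" by auto
      have fl: "isCont (\<lambda>z. flat q (real (Suc k) * (z - z0) - 1)) z" for q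
        by (rule isCont_o2[OF _ flat_continuous]) (intro continuous_intros)
      show "isCont (\<lambda>z. F' z * flat 1 (real (Suc k) * (z - z0) - 1)
         + F z * (real (Suc k) * flat [:0, 0, 1:] (real (Suc k) * (z - z0) - 1))) z"
        by (intro continuous_intros fl F' DERIV_isCont[OF F] z)
    qed
  qed (simp add: cutoff'_def)
  have 2: "continuous_on {..<z0 + 1 / real (Suc k)} (cutoff' k z0 F F')"
    by (rule continuous_on_cong[THEN iffD1, OF refl _ continuous_on_const[of _ 0]]) (simp add: cutoff_zero)
  have "continuous_on ({z0<..<3} \<union> {..<z0 + 1 / real (Suc k)}) (cutoff' k z0 F F')"
    by (intro continuous_on_open_Un 1 2) auto
  moreover have "{..<3} \<subseteq> {z0<..<3} \<union> {..<z0 + 1 / real (Suc k)}"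
  proof
    fix z :: real assume "z \<in> {..<3}"
    then show "z \<in> {z0<..<3} \<union> {..<z0 + 1 / real (Suc k)}" using cutoff_cover[of z0 z k] by auto
  qed
  ultimately show ?thesis by (rule continuous_on_subset)
qed

lemma cutoff_C1:
  assumes p: "norm p = 1"
    and F: "\<And>z. z0 < z \<Longrightarrow> z < 3 \<Longrightarrow> (F has_real_derivative F' z) (at z)"
    and F': "\<And>z. z0 < z \<Longrightarrow> z < 3 \<Longrightarrow> isCont F' z"
  shows "sphere_C1 (\<lambda>x. cutoff k z0 F (p \<bullet> x)) (\<lambda>x. cutoff' k z0 F F' (p \<bullet> x) *\<^sub>R (p - (p \<bullet> x) *\<^sub>R x))"
proof (rule sphere_C1_zonal[OF p])
  show "(cutoff k z0 F has_real_derivative cutoff' k z0 F F' z) (at z)" if "z \<in> {-1..1}" for z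
    using that by (intro cutoff_deriv F) auto
  show "continuous_on {-1..1} (cutoff' k z0 F F')"
    by (rule continuous_on_subset[OF cutoff'_continuous[OF F F']]) auto
qed

lemma C1_linear_bound:
  assumes z0: "z0 < 1" and F: "\<And>z. z0 \<le> z \<Longrightarrow> z < 3 \<Longrightarrow> (F has_real_derivative F' z) (at z)"
    and F': "\<And>z. z0 \<le> z \<Longrightarrow> z < 3 \<Longrightarrow> isCont F' z" and 0: "F z0 = 0"
  shows "\<exists>K\<ge>0. \<forall>z. z0 \<le> z \<longrightarrow> z \<le> 1 \<longrightarrow> \<bar>F z\<bar> \<le> K \<and> \<bar>F' z\<bar> \<le> K \<and> \<bar>F z\<bar> \<le> K * (z - z0)"
proof -
  have "continuous_on {z0..1} F'" using F' by (intro continuous_at_imp_continuous_on) auto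
  then have "compact (F' ` {z0..1})" by (intro compact_continuous_image) auto
  then obtain M where "\<forall>y\<in>F' ` {z0..1}. norm y \<le> M" using compact_imp_bounded bounded_iff by metis
  then have M: "\<bar>F' z\<bar> \<le> M" if "z \<in> {z0..1}" for z using that by simp
  have M0: "M \<ge> 0" using M[of z0] z0 by auto
  have lin: "\<bar>F z\<bar> \<le> M * (z - z0)" if z: "z0 \<le> z" "z \<le> 1" for z
  proof (cases "z = z0")
    case False
    then have "z0 < z" using z by simp
    then obtain y where y: "z0 < y" "y < z" "F z - F z0 = (z - z0) * F' y"
      using MVT2[of z0 z F F'] F z by auto
    then have "\<bar>F z\<bar> = (z - z0) * \<bar>F' y\<bar>" using 0 z by (simp add: abs_mult)
    also have "\<dots> \<le> (z - z0) * M" using M[of y] y z by (intro mult_left_mono) auto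
    finally show ?thesis by (simp add: mult.commute)
  qed (simp add: 0)
  define K where "K = M * (1 - z0) + M"
  have K: "K \<ge> M" "K \<ge> 0" using M0 z0 by (auto simp: K_def)
  have "\<bar>F z\<bar> \<le> K \<and> \<bar>F' z\<bar> \<le> K \<and> \<bar>F z\<bar> \<le> K * (z - z0)" if z: "z0 \<le> z" "z \<le> 1" for z
  proof (intro conjI)
    have "M * (z - z0) \<le> M * (1 - z0)" using M0 z by (intro mult_left_mono) auto
    then show "\<bar>F z\<bar> \<le> K" using lin[OF z] M0 by (simp add: K_def)
    show "\<bar>F' z\<bar> \<le> K" using M[of z] z K by auto
    have "M * (z - z0) \<le> K * (z - z0)" using K z by (intro mult_right_mono) auto
    then show "\<bar>F z\<bar> \<le> K * (z - z0)" using lin[OF z] by linarith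
  qed
  then show ?thesis using K(2) by blast
qed

text \<open>The delicate term contains the derivative of the factor, of size k + 1. With t + 1 = (k
  + 1) (z - z0) the linear vanishing of F bounds it by K (t + 1) times
  \<open>flat [:0, 0, 1:] t\<close>, at most 2 K; the other term contributes K.\<close>

lemma cutoff_bounds:
  assumes K: "K \<ge> 0" "\<And>z. z0 \<le> z \<Longrightarrow> z \<le> 1 \<Longrightarrow> \<bar>F z\<bar> \<le> K \<and> \<bar>F' z\<bar> \<le> K \<and> \<bar>F z\<bar> \<le> K * (z - z0)"
    and z: "z \<le> 1"
  shows "\<bar>cutoff k z0 F z\<bar> \<le> K" "\<bar>cutoff' k z0 F F' z\<bar> \<le> 3 * K"
proof -
  define t where "t = real (Suc k) * (z - z0) - 1"
  show "\<bar>cutoff k z0 F z\<bar> \<le> K"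
  proof (cases "z0 < z")
    case True
    have "\<bar>F z\<bar> * flat 1 t \<le> K * 1" using K(2)[of z] True z flat_1_bounds[of t] by (intro mult_mono K) auto
    then show ?thesis using True flat_1_bounds[of t] by (simp add: cutoff_def t_def abs_mult)
  qed (use K in \<open>simp add: cutoff_def\<close>)
  show "\<bar>cutoff' k z0 F F' z\<bar> \<le> 3 * K"
  proof (cases "z0 < z")
    case True
    have 1: "\<bar>F' z * flat 1 t\<bar> \<le> K * 1" unfolding abs_mult using K(2)[of z] True z flat_1_bounds[of t] by (intro mult_mono K) auto
    have "\<bar>F z * (real (Suc k) * flat [:0, 0, 1:] t)\<bar> \<le> (K * (z - z0)) * (real (Suc k) * flat [:0, 0, 1:] t)"
      unfolding abs_mult using K(2)[of z] True z flat_2_bound(1)[of t] by (intro mult_mono) auto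
    also have "\<dots> = K * ((t + 1) * flat [:0, 0, 1:] t)" by (simp add: t_def algebra_simps)
    also have "\<dots> \<le> K * 2" using flat_2_bound(2)[of t] K by (intro mult_left_mono) auto
    finally show ?thesis using True 1 unfolding cutoff'_def t_def[symmetric] by simp
  qed (use K in \<open>simp add: cutoff'_def\<close>)
qed

lemma cutoff_limits:
  "(\<lambda>k. cutoff k z0 F z) \<longlonglongrightarrow> (if z0 < z then F z else 0)"
  "(\<lambda>k. cutoff' k z0 F F' z) \<longlonglongrightarrow> (if z0 < z then F' z else 0)"
proof -
  have lim: "(\<lambda>k. flat 1 (real (Suc k) * d - 1)) \<longlonglongrightarrow> 1" "(\<lambda>k. real (Suc k) * flat [:0, 0, 1:] (real (Suc k) * d - 1)) \<longlonglongrightarrow> 0" if d: "d > 0" for d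
  proof -
    have "filterlim (\<lambda>k. real (Suc k) * d - 1) at_top sequentially" using d by real_asymp
    then have ev: "\<forall>\<^sub>F k in sequentially. real (Suc k) * d - 1 > 0" unfolding filterlim_at_top_dense by blast
    have "(\<lambda>k. exp (- (1 / (real (Suc k) * d - 1)))) \<longlonglongrightarrow> 1" using d by real_asymp
    then show "(\<lambda>k. flat 1 (real (Suc k) * d - 1)) \<longlonglongrightarrow> 1"
      by (rule Lim_transform_eventually) (use ev in \<open>auto elim!: eventually_mono simp: flat_def\<close>)
    have "(\<lambda>k. real (Suc k) * ((1 / (real (Suc k) * d - 1)) * (1 / (real (Suc k) * d - 1)) * exp (- (1 / (real (Suc k) * d - 1))))) \<longlonglongrightarrow> 0" using d by real_asymp
    then show "(\<lambda>k. real (Suc k) * flat [:0, 0, 1:] (real (Suc k) * d - 1)) \<longlonglongrightarrow> 0"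
      by (rule Lim_transform_eventually) (use ev in \<open>auto elim!: eventually_mono simp: flat_def\<close>)
  qed
  show "(\<lambda>k. cutoff k z0 F z) \<longlonglongrightarrow> (if z0 < z then F z else 0)"
  proof (cases "z0 < z")
    case True
    then have "(\<lambda>k. F z * flat 1 (real (Suc k) * (z - z0) - 1)) \<longlonglongrightarrow> F z * 1" by (intro tendsto_mult tendsto_const lim) simp
    then show ?thesis using True by (simp add: cutoff_def)
  qed (simp add: cutoff_def)
  show "(\<lambda>k. cutoff' k z0 F F' z) \<longlonglongrightarrow> (if z0 < z then F' z else 0)"
  proof (cases "z0 < z")
    case True
    then have "(\<lambda>k. F' z * flat 1 (real (Suc k) * (z - z0) - 1) + F z * (real (Suc k) * flat [:0, 0, 1:] (real (Suc k) * (z - z0) - 1))) \<longlonglongrightarrow> F' z * 1 + F z * 0"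
      by (intro tendsto_add tendsto_mult[of "\<lambda>_. F' z"] tendsto_mult[of "\<lambda>_. F z"] tendsto_const lim) simp_all
    then show ?thesis using True by (simp add: cutoff'_def)
  qed (simp add: cutoff'_def)
qed

lemma Ck_on_subset: "Ck_on k W f \<Longrightarrow> V \<subseteq> W \<Longrightarrow> Ck_on k V f"
  by (induction k arbitrary: f) (auto intro: continuous_on_subset)

text \<open>On \<open>V1\<close> the cutoff is a product of smooth functions and on
  \<open>V2\<close> it is zero. These open sets overlap and together cover the sphere.\<close>

lemma cutoff_smooth:
  fixes p :: "'a::euclidean_space"
  assumes p: "norm p = 1" and z0: "- 1 < z0"
    and P: "\<And>\<psi>. \<psi> \<in> P \<Longrightarrow> \<exists>\<psi>'\<in>P. \<forall>z\<in>{-1<..<3}. (\<psi> has_real_derivative \<psi>' z) (at z)" and f: "f \<in> P"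
  shows "smooth_on_sphere (\<lambda>x. cutoff k z0 f (p \<bullet> x))"
proof -
  define V1 where "V1 = {x. z0 < p \<bullet> x} \<inter> {x. p \<bullet> x < 3}"
  define V2 where "V2 = {x. p \<bullet> x < z0 + 1 / real (Suc k)}"
  have V: "open V1" "open V2" unfolding V1_def V2_def
    by (intro open_Int open_Collect_less continuous_intros)+
  have Ck: "Ck_on j (V1 \<union> V2) (\<lambda>x. cutoff k z0 f (p \<bullet> x))" for j
  proof (rule Ck_on_Un[OF V])
    have "Ck_on j {x. 0 + 1 * (p \<bullet> x) \<in> {-1<..<3}} (\<lambda>x. 1 * f (0 + 1 * (p \<bullet> x)))"
      by (rule Ck_on_affine_family[OF _ P f]) auto
    then have "Ck_on j {x. p \<bullet> x \<in> {-1<..<3}} (\<lambda>x. f (p \<bullet> x))" by simp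
    then have 1: "Ck_on j V1 (\<lambda>x. f (p \<bullet> x))"
      by (rule Ck_on_subset) (use z0 in \<open>auto simp: V1_def\<close>)
    have "Ck_on j {x. (- real (Suc k) * z0 - 1) + real (Suc k) * (p \<bullet> x) \<in> UNIV} (\<lambda>x. 1 * flat 1 ((- real (Suc k) * z0 - 1) + real (Suc k) * (p \<bullet> x)))"
      by (rule Ck_on_affine_family[of UNIV "range flat"]) (auto intro: flat_deriv)
    moreover have eq: "(- real (Suc k) * z0 - 1) + real (Suc k) * (p \<bullet> x) = real (Suc k) * (p \<bullet> x - z0) - 1" for x
      by (simp add: algebra_simps)
    ultimately have "Ck_on j UNIV (\<lambda>x. flat 1 (real (Suc k) * (p \<bullet> x - z0) - 1))"
      unfolding eq mult_1 by simp
    then have 2: "Ck_on j V1 (\<lambda>x. flat 1 (real (Suc k) * (p \<bullet> x - z0) - 1))"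
      by (rule Ck_on_subset) simp
    show "Ck_on j V1 (\<lambda>x. cutoff k z0 f (p \<bullet> x))"
      by (rule Ck_on_cong_imp[OF V(1) _ Ck_on_mult[OF V(1) 1 2]]) (simp add: V1_def cutoff_def)
    show "Ck_on j V2 (\<lambda>x. cutoff k z0 f (p \<bullet> x))"
      by (rule Ck_on_cong_imp[OF V(2) _ Ck_on_zero[OF V(2)]]) (simp add: V2_def cutoff_zero)
  qed
  have "sphere 0 1 \<subseteq> V1 \<union> V2"
  proof
    fix x :: 'a assume "x \<in> sphere 0 1"
    then have "p \<bullet> x \<in> {-1..1}" by (intro sphere_inner_range p) simp
    then show "x \<in> V1 \<union> V2" using cutoff_cover[of z0 "p \<bullet> x" k] by (auto simp: V1_def V2_def)
  qed
  then show ?thesis unfolding smooth_on_sphere_def using Ck V by (intro exI[of _ "V1 \<union> V2"] exI) auto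
qed

lemma cutoff_Cc_smooth:
  fixes p :: "real ^ 'n"
  assumes p: "norm p = 1" and z0: "- 1 < z0"
    and P: "\<And>\<psi>. \<psi> \<in> P \<Longrightarrow> \<exists>\<psi>'\<in>P. \<forall>z\<in>{-1<..<3}. (\<psi> has_real_derivative \<psi>' z) (at z)" and f: "f \<in> P"
  shows "(\<lambda>x. cutoff k z0 f (p \<bullet> x)) \<in> Cc_smooth {x \<in> sphere 0 1. z0 < p \<bullet> x}"
proof -
  let ?C = "sphere 0 1 \<inter> {x. z0 + 1 / real (Suc k) \<le> p \<bullet> x}"
  have "{x \<in> sphere 0 1. cutoff k z0 f (p \<bullet> x) \<noteq> 0} \<subseteq> ?C"
    using cutoff_zero(1)[of _ z0 k f] by (auto simp: not_less[symmetric])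
  moreover have "closed ?C" by (intro closed_Int closed_Collect_le continuous_intros) auto
  ultimately have "closure {x \<in> sphere 0 1. cutoff k z0 f (p \<bullet> x) \<noteq> 0} \<subseteq> ?C" by (rule closure_minimal)
  moreover have "?C \<subseteq> {x \<in> sphere 0 1. z0 < p \<bullet> x}"
  proof
    fix x assume "x \<in> ?C"
    then have "x \<in> sphere 0 1" "z0 + 1 / real (Suc k) \<le> p \<bullet> x" by auto
    moreover have "0 < 1 / real (Suc k)" by simp
    ultimately show "x \<in> {x \<in> sphere 0 1. z0 < p \<bullet> x}" using less_le_trans[of z0 "z0 + 1 / real (Suc k)" "p \<bullet> x"] by (simp del: of_nat_Suc)
  qed
  ultimately show ?thesis using cutoff_smooth[OF assms] unfolding Cc_smooth_def by blast
qed

lemma zonal_tangent: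
  fixes p x :: "'a::real_inner"
  assumes "norm p = 1" "norm x = 1"
  shows "(p - (p \<bullet> x) *\<^sub>R x) \<bullet> p = 1 - (p \<bullet> x)\<^sup>2" "(norm (p - (p \<bullet> x) *\<^sub>R x))\<^sup>2 = 1 - (p \<bullet> x)\<^sup>2"
  unfolding power2_norm_eq_inner unfolding power2_eq_square
  using assms by (auto simp: inner_diff_left inner_diff_right norm_eq_1 inner_commute simp del: dot_square_norm)

text \<open>Green's identity for f on the cap: \<open>f * f'\<close> times the tangential part of p
  is f times its gradient, and there is no boundary term because f vanishes at z0. It is obtained
  from cutoffs of \<open>F = f * f'\<close>, whose linear vanishing keeps their derivatives
  bounded.\<close>

lemma zonal_eigen_identity:
  fixes p :: "real ^ 'n" and f f' f'' :: "real \<Rightarrow> real"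
  assumes p: "norm p = 1" and z0: "- 1 < z0" "z0 < 1"
    and d: "\<And>z. - 1 < z \<Longrightarrow> z < 3 \<Longrightarrow> (f has_real_derivative f' z) (at z)"
      "\<And>z. - 1 < z \<Longrightarrow> z < 3 \<Longrightarrow> (f' has_real_derivative f'' z) (at z)"
      "\<And>z. - 1 < z \<Longrightarrow> z < 3 \<Longrightarrow> isCont f'' z"
    and ode: "\<And>z. - 1 < z \<Longrightarrow> z < 3 \<Longrightarrow> (1 - z\<^sup>2) * f'' z - real (CARD('n) - 1) * z * f' z = - l * f z"
    and f0: "f z0 = 0"
  shows "(LINT x|sphere_measure. (if z0 < p \<bullet> x then (f' (p \<bullet> x))\<^sup>2 * (1 - (p \<bullet> x)\<^sup>2) - l * (f (p \<bullet> x))\<^sup>2 else 0)) = 0"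
proof -
  let ?M = "sphere_measure :: (real ^ 'n) measure"
  interpret finite_measure ?M by (rule finite_measure_sphere)
  define F where "F z = f z * f' z" for z
  define F' where "F' z = f' z * f' z + f z * f'' z" for z
  have dF: "(F has_real_derivative F' z) (at z)" if "- 1 < z" "z < 3" for z
    unfolding F_def[abs_def] F'_def by (rule DERIV_cong[OF DERIV_mult[OF d(1)[OF that] d(2)[OF that]]]) (simp add: mult.commute)
  have cF': "isCont F' z" if "- 1 < z" "z < 3" for z
    unfolding F'_def[abs_def] by (intro continuous_intros DERIV_isCont[OF d(1)] DERIV_isCont[OF d(2)] d(3) that)
  obtain K where K: "K \<ge> 0" "\<And>z. z0 \<le> z \<Longrightarrow> z \<le> 1 \<Longrightarrow> \<bar>F z\<bar> \<le> K \<and> \<bar>F' z\<bar> \<le> K \<and> \<bar>F z\<bar> \<le> K * (z - z0)"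
    using C1_linear_bound[of z0 F F'] z0 dF cF' f0 by (auto simp: F_def)
  have C1: "sphere_C1 (\<lambda>x. cutoff k z0 F (p \<bullet> x)) (\<lambda>x. cutoff' k z0 F F' (p \<bullet> x) *\<^sub>R (p - (p \<bullet> x) *\<^sub>R x))" for k
    by (rule cutoff_C1[OF p]) (use dF cF' z0 in auto)
  define I where "I k x = (cutoff' k z0 F F' (p \<bullet> x) *\<^sub>R (p - (p \<bullet> x) *\<^sub>R x)) \<bullet> p - real (CARD('n) - 1) * (p \<bullet> x) * cutoff k z0 F (p \<bullet> x)" for k and x :: "real ^ 'n"
  define J where "J x = (if z0 < p \<bullet> x then (f' (p \<bullet> x))\<^sup>2 * (1 - (p \<bullet> x)\<^sup>2) - l * (f (p \<bullet> x))\<^sup>2 else 0)" for x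
  have I0: "integral\<^sup>L ?M (I k) = 0" for k
    unfolding I_def[abs_def] by (rule zonal_divergence[OF C1])
  have Im: "I k \<in> borel_measurable ?M" for k
    unfolding I_def[abs_def] by (intro borel_measurable_sphere_continuous continuous_intros sphere_C1_continuous[OF C1])
  have lim: "(\<lambda>k. I k x) \<longlonglongrightarrow> J x" if x: "norm x = 1" for x
  proof -
    have "(\<lambda>k. (cutoff' k z0 F F' (p \<bullet> x) *\<^sub>R (p - (p \<bullet> x) *\<^sub>R x)) \<bullet> p - real (CARD('n) - 1) * (p \<bullet> x) * cutoff k z0 F (p \<bullet> x))
      \<longlonglongrightarrow> ((if z0 < p \<bullet> x then F' (p \<bullet> x) else 0) *\<^sub>R (p - (p \<bullet> x) *\<^sub>R x)) \<bullet> p - real (CARD('n) - 1) * (p \<bullet> x) * (if z0 < p \<bullet> x then F (p \<bullet> x) else 0)"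
      by (intro tendsto_intros cutoff_limits)
    also have "((if z0 < p \<bullet> x then F' (p \<bullet> x) else 0) *\<^sub>R (p - (p \<bullet> x) *\<^sub>R x)) \<bullet> p - real (CARD('n) - 1) * (p \<bullet> x) * (if z0 < p \<bullet> x then F (p \<bullet> x) else 0) = J x"
    proof (cases "z0 < p \<bullet> x")
      case True
      then have "- 1 < p \<bullet> x" "p \<bullet> x < 3" using z0 sphere_inner_range[OF p x] by auto
      note ode_z = ode[OF this]
      have "F' (p \<bullet> x) * (1 - (p \<bullet> x)\<^sup>2) - real (CARD('n) - 1) * (p \<bullet> x) * F (p \<bullet> x)
        = (f' (p \<bullet> x))\<^sup>2 * (1 - (p \<bullet> x)\<^sup>2) + f (p \<bullet> x) * ((1 - (p \<bullet> x)\<^sup>2) * f'' (p \<bullet> x) - real (CARD('n) - 1) * (p \<bullet> x) * f' (p \<bullet> x))"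
        by (simp add: F_def F'_def algebra_simps power2_eq_square)
      then have "F' (p \<bullet> x) * (1 - (p \<bullet> x)\<^sup>2) - real (CARD('n) - 1) * (p \<bullet> x) * F (p \<bullet> x)
        = (f' (p \<bullet> x))\<^sup>2 * (1 - (p \<bullet> x)\<^sup>2) - l * (f (p \<bullet> x))\<^sup>2"
        unfolding ode_z by (simp add: power2_eq_square)
      then show ?thesis using True by (simp add: J_def zonal_tangent(1)[OF p x])
    qed (simp add: J_def)
    finally show ?thesis by (simp add: I_def)
  qed
  have "(\<lambda>k. integral\<^sup>L ?M (I k)) \<longlonglongrightarrow> integral\<^sup>L ?M J"
  proof (rule integral_dominated_convergence[where w = "\<lambda>_. 3 * K + real (CARD('n) - 1) * K"])
    show "J \<in> borel_measurable ?M" by (rule borel_measurable_LIMSEQ_metric[OF Im]) (use lim in auto)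
    show "AE x in ?M. (\<lambda>k. I k x) \<longlonglongrightarrow> J x" by (rule AE_I2) (use lim in auto)
    show "AE x in ?M. norm (I k x) \<le> 3 * K + real (CARD('n) - 1) * K" for k
    proof (rule AE_I2)
      fix x assume "x \<in> space ?M"
      then have x: "norm x = 1" by simp
      define z where "z = p \<bullet> x"
      have z: "-1 \<le> z" "z \<le> 1" using sphere_inner_range[OF p x] by (auto simp: z_def)
      note cb = cutoff_bounds[OF K z(2), of k]
      have zz: "\<bar>1 - z\<^sup>2\<bar> \<le> 1" using z by (simp add: abs_square_le_1 abs_le_iff)
      have "\<bar>cutoff' k z0 F F' z * (1 - z\<^sup>2)\<bar> \<le> 3 * K * 1" unfolding abs_mult using cb zz K by (intro mult_mono) auto
      moreover have "\<bar>z * cutoff k z0 F z\<bar> \<le> 1 * K" unfolding abs_mult using cb z by (intro mult_mono) auto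
      then have "real (CARD('n) - 1) * \<bar>z * cutoff k z0 F z\<bar> \<le> real (CARD('n) - 1) * K" by (intro mult_left_mono) auto
      moreover have "I k x = cutoff' k z0 F F' z * (1 - z\<^sup>2) - real (CARD('n) - 1) * (z * cutoff k z0 F z)"
        using zonal_tangent(1)[OF p x] by (simp add: I_def z_def)
      ultimately show "norm (I k x) \<le> 3 * K + real (CARD('n) - 1) * K"
        using abs_triangle_ineq4[of "cutoff' k z0 F F' z * (1 - z\<^sup>2)" "real (CARD('n) - 1) * (z * cutoff k z0 F z)"]
        by (simp add: abs_mult)
    qed
  qed (use Im in auto)
  then show ?thesis by (simp add: I0 LIMSEQ_const_iff J_def[abs_def])
qed

text \<open>The field \<open>v^2 * f' / f\<close> times the tangential part of p is C1 on the whole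
  sphere because the support of v stays away from the zero of f. The gradient g is returned with its
  vanishing outside the cap, since the passage to \<open>H1_0\<close> uses both.\<close>

lemma zonal_barta:
  fixes p :: "real ^ 'n" and f f' f'' :: "real \<Rightarrow> real"
  assumes p: "norm p = 1" and z0: "- 1 < z0" "z0 < 1"
    and d: "\<And>z. - 1 < z \<Longrightarrow> z < 3 \<Longrightarrow> (f has_real_derivative f' z) (at z)"
      "\<And>z. - 1 < z \<Longrightarrow> z < 3 \<Longrightarrow> (f' has_real_derivative f'' z) (at z)"
      "\<And>z. - 1 < z \<Longrightarrow> z < 3 \<Longrightarrow> isCont f'' z"
    and ode: "\<And>z. - 1 < z \<Longrightarrow> z < 3 \<Longrightarrow> (1 - z\<^sup>2) * f'' z - real (CARD('n) - 1) * z * f' z = - l * f z"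
    and pos: "\<And>z. z0 < z \<Longrightarrow> z \<le> 1 \<Longrightarrow> 0 < f z"
    and v: "v \<in> Cc_smooth {x \<in> sphere 0 1. z0 < p \<bullet> x}"
  shows "\<exists>g. sphere_C1 v g \<and> (\<forall>x. norm x = 1 \<longrightarrow> p \<bullet> x \<le> z0 \<longrightarrow> v x = 0 \<and> g x = 0) \<and>
    l * (LINT x|sphere_measure. (v x)\<^sup>2) \<le> (LINT x|sphere_measure. (norm (g x))\<^sup>2)"
proof -
  let ?M = "sphere_measure :: (real ^ 'n) measure"
  have sm: "smooth_on_sphere v" using v by (simp add: Cc_smooth_def)
  obtain g where "sphere_C1 (\<lambda>x. v x \<bullet> 1) g" using smooth_on_sphere_C1[OF sm] by blast
  then have g: "sphere_C1 v g" by simp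
  define K where "K = closure {x \<in> sphere 0 1. v x \<noteq> 0}"
  define Q where "Q = {x :: real ^ 'n. z0 < p \<bullet> x}"
  have Q: "open Q" unfolding Q_def by (intro open_Collect_less continuous_intros)
  have K: "closed K" "K \<subseteq> Q" using v by (auto simp: K_def Q_def Cc_smooth_def)
  have vK: "v x = 0" if "norm x = 1" "x \<notin> K" for x
    using that closure_subset[of "{x \<in> sphere 0 1. v x \<noteq> 0}"] by (auto simp: K_def)
  \<comment> \<open>Off the support v is zero in a neighbourhood, so 0 is a tangential gradient
    there as well, and tangential gradients are unique.\<close>
  have gK: "g x = 0" if x: "norm x = 1" "x \<notin> K" for x
  proof -
    have xK: "x \<in> - K" "open (- K)" using K x by auto
    have eq: "at x within sphere 0 1 = at x within (sphere 0 1 \<inter> - K)" by (rule at_within_nhd[OF xK]) auto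
    have "(v has_derivative (\<lambda>w. 0)) (at x within (sphere 0 1 \<inter> - K))"
      by (rule has_derivative_transform[where f = "\<lambda>_. 0"]) (use x vK in auto)
    then have "(v has_derivative (\<lambda>w. 0 \<bullet> w)) (at x within sphere 0 1)" by (simp add: eq)
    then show "g x = 0" using sphere_gradient_unique[of x "g x" v 0] x sphere_C1D[OF g x(1)] by simp
  qed
  define \<phi> where "\<phi> z = f' z / f z" for z
  define \<phi>' where "\<phi>' z = (f'' z * f z - f' z * f' z) / (f z * f z)" for z
  have zr: "z0 < p \<bullet> x \<and> p \<bullet> x \<le> 1 \<and> - 1 < p \<bullet> x \<and> p \<bullet> x < 3 \<and> f (p \<bullet> x) > 0" if "x \<in> Q" "norm x = 1" for x
    using sphere_inner_range[OF p that(2)] that z0 pos by (auto simp: Q_def)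
  define q where "q x = v x * v x * \<phi> (p \<bullet> x)" for x
  define G where "G x = (v x * v x * \<phi>' (p \<bullet> x)) *\<^sub>R (p - (p \<bullet> x) *\<^sub>R x) + (2 * v x * \<phi> (p \<bullet> x)) *\<^sub>R g x" for x
  have C1: "sphere_C1 (\<lambda>x. if x \<in> Q then q x else 0) (\<lambda>x. if x \<in> Q then G x else 0)"
  proof (rule sphere_C1_extend_zero[OF Q K])
    fix x assume x: "x \<in> Q" "norm x = 1"
    note zx = zr[OF x]
    have d\<phi>: "(\<phi> has_real_derivative \<phi>' (p \<bullet> x)) (at (p \<bullet> x))"
      unfolding \<phi>_def[abs_def] \<phi>'_def using zx by (intro DERIV_divide d) auto
    then have "(\<phi> has_derivative (\<lambda>h. h * \<phi>' (p \<bullet> x))) (at (p \<bullet> x))"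
      by (simp add: has_field_derivative_def mult_commute_abs)
    from has_derivative_compose[OF sphere_C1D(2)[OF sphere_C1_inner x(2), of p] this]
    have 1: "((\<lambda>x. \<phi> (p \<bullet> x)) has_derivative (\<lambda>w. (p - (p \<bullet> x) *\<^sub>R x) \<bullet> w * \<phi>' (p \<bullet> x))) (at x within sphere 0 1)" .
    have "((\<lambda>x. v x * v x) has_derivative (\<lambda>w. (v x *\<^sub>R g x + v x *\<^sub>R g x) \<bullet> w)) (at x within sphere 0 1)"
      by (rule sphere_C1D(2)[OF sphere_C1_mult[OF g g] x(2)])
    then have 2: "((\<lambda>x. v x * v x) has_derivative (\<lambda>w. 2 * v x * (g x \<bullet> w))) (at x within sphere 0 1)"
      by (rule has_derivative_eq_rhs) (simp only: inner_add_left inner_scaleR_left, simp add: mult.assoc)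
    show "G x \<bullet> x = 0 \<and> (q has_derivative (\<lambda>w. G x \<bullet> w)) (at x within sphere 0 1)"
    proof
      show "G x \<bullet> x = 0"
        using sphere_C1D(1)[OF g x(2)] sphere_C1D(1)[OF sphere_C1_inner x(2), of p] by (simp add: G_def inner_add_left)
      show "(q has_derivative (\<lambda>w. G x \<bullet> w)) (at x within sphere 0 1)"
        unfolding q_def[abs_def]
        by (rule has_derivative_eq_rhs[OF has_derivative_mult[OF 2 1]]) (simp add: fun_eq_iff G_def inner_add_left mult_ac)
    qed
  next
    have c: "continuous_on (sphere 0 1 \<inter> Q) (\<lambda>x. h (p \<bullet> x))" if h: "\<And>z. z0 < z \<Longrightarrow> z \<le> 1 \<Longrightarrow> isCont h z" for h :: "real \<Rightarrow> real"
    proof (rule continuous_on_compose2[of "{z0<..1}" h])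
      show "continuous_on {z0<..1} h" by (intro continuous_at_imp_continuous_on) (use h in auto)
      show "(\<lambda>x. p \<bullet> x) ` (sphere 0 1 \<inter> Q) \<subseteq> {z0<..1}" using zr by auto
    qed (intro continuous_intros)
    have i: "isCont f z" "isCont f' z" "isCont f'' z" "f z \<noteq> 0" if "z0 < z" "z \<le> 1" for z
      using that z0 pos[of z] d(3)[of z] DERIV_isCont[OF d(1)[of z]] DERIV_isCont[OF d(2)[of z]] by auto
    have "continuous_on (sphere 0 1 \<inter> Q) (\<lambda>x. \<phi> (p \<bullet> x))" "continuous_on (sphere 0 1 \<inter> Q) (\<lambda>x. \<phi>' (p \<bullet> x))"
      unfolding \<phi>_def \<phi>'_def by (intro c[of "\<lambda>z. f' z / f z"] c[of "\<lambda>z. (f'' z * f z - f' z * f' z) / (f z * f z)"] continuous_intros i; use i in simp)+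
    then show "continuous_on (sphere 0 1 \<inter> Q) G"
      unfolding G_def[abs_def]
      by (intro continuous_intros continuous_on_subset[OF sphere_C1_continuous(1)[OF g]] continuous_on_subset[OF sphere_C1_continuous(2)[OF g]]) auto
    show "q x = 0 \<and> G x = 0" if "x \<in> Q - K" "norm x = 1" for x
      using vK[of x] that by (simp add: q_def G_def)
  qed
  define T where "T x = (if x \<in> Q then G x else 0) \<bullet> p - real (CARD('n) - 1) * (p \<bullet> x) * (if x \<in> Q then q x else 0)" for x
  have T0: "integral\<^sup>L ?M T = 0" unfolding T_def[abs_def] by (rule zonal_divergence[OF C1])
  have T_le: "T x \<le> (norm (g x))\<^sup>2 - l * (v x)\<^sup>2" if x: "norm x = 1" for x
  proof (cases "x \<in> Q")
    case True
    define z where "z = p \<bullet> x"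
    define t where "t = p - z *\<^sub>R x"
    have zx: "f z > 0" "- 1 < z" "z < 3" using zr[OF True x] by (auto simp: z_def)
    have tp: "t \<bullet> p = 1 - z\<^sup>2" "t \<bullet> t = 1 - z\<^sup>2"
      using zonal_tangent[OF p x] by (auto simp: t_def z_def power2_norm_eq_inner)
    have gt: "g x \<bullet> p = g x \<bullet> t" using sphere_C1D(1)[OF g x] by (simp add: t_def inner_diff_right)
    \<comment> \<open>The eigenvalue equation as a Riccati equation for the logarithmic derivative
      \<phi>.\<close>
    have ric: "\<phi>' z * (1 - z\<^sup>2) - real (CARD('n) - 1) * z * \<phi> z = - l - (\<phi> z)\<^sup>2 * (1 - z\<^sup>2)"
    proof -
      have "\<phi>' z * (1 - z\<^sup>2) - real (CARD('n) - 1) * z * \<phi> z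
        = ((1 - z\<^sup>2) * f'' z - real (CARD('n) - 1) * z * f' z) / f z - (\<phi> z)\<^sup>2 * (1 - z\<^sup>2)"
        unfolding \<phi>_def \<phi>'_def using zx by (simp add: field_simps power2_eq_square)
      then show ?thesis unfolding ode[OF zx(2,3)] using zx by simp
    qed
    have "T x = (v x)\<^sup>2 * (\<phi>' z * (1 - z\<^sup>2) - real (CARD('n) - 1) * z * \<phi> z) + 2 * (v x * \<phi> z) * (g x \<bullet> t)"
      using True unfolding T_def G_def q_def z_def[symmetric] t_def[symmetric]
      by (simp add: inner_add_left tp gt algebra_simps power2_eq_square)
    also have "\<dots> = - l * (v x)\<^sup>2 - (v x * \<phi> z)\<^sup>2 * (t \<bullet> t) + 2 * (v x * \<phi> z) * (g x \<bullet> t)"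
      unfolding ric tp by (simp add: algebra_simps power2_eq_square)
    \<comment> \<open>Completing the square, where \<open>t\<close> is the tangential part of p. The
      square that is then dropped is the norm of grad v - (v / f) grad f, squared.\<close>
    also have "\<dots> = (norm (g x))\<^sup>2 - l * (v x)\<^sup>2 - (norm (g x - (v x * \<phi> z) *\<^sub>R t))\<^sup>2"
    proof -
      have "(norm (g x - c *\<^sub>R t))\<^sup>2 = (norm (g x))\<^sup>2 - 2 * c * (g x \<bullet> t) + c\<^sup>2 * (t \<bullet> t)" for c
        unfolding power2_norm_eq_inner
        by (simp add: inner_diff_left inner_diff_right inner_commute[of t "g x"] power2_eq_square right_diff_distrib mult.assoc)
      then show ?thesis by simp
    qed
    also have "\<dots> \<le> (norm (g x))\<^sup>2 - l * (v x)\<^sup>2" by simp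
    finally show ?thesis .
  next
    case False
    then have "v x = 0" using vK[OF x] K(2) by blast
    then show ?thesis using False by (simp add: T_def)
  qed
  have gi: "integrable ?M (\<lambda>x. (norm (g x))\<^sup>2)" by (intro integrable_sphere_continuous continuous_intros sphere_C1_continuous[OF g])
  have vi: "integrable ?M (\<lambda>x. l * (v x)\<^sup>2)" by (intro integrable_sphere_continuous continuous_intros sphere_C1_continuous[OF g])
  have Ti: "integrable ?M T"
    unfolding T_def[abs_def] by (intro integrable_sphere_continuous continuous_intros sphere_C1_continuous[OF C1])
  have "integral\<^sup>L ?M T \<le> (LINT x|?M. (norm (g x))\<^sup>2 - l * (v x)\<^sup>2)"
    by (rule integral_mono[OF Ti]) (use gi vi T_le in auto)
  also have "\<dots> = (LINT x|?M. (norm (g x))\<^sup>2) - l * (LINT x|?M. (v x)\<^sup>2)"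
    using gi vi by simp
  finally have "l * (LINT x|?M. (v x)\<^sup>2) \<le> (LINT x|?M. (norm (g x))\<^sup>2)" using T0 by simp
  moreover have "v x = 0 \<and> g x = 0" if "norm x = 1" "p \<bullet> x \<le> z0" for x
  proof -
    have "x \<notin> K" using K(2) that by (auto simp: Q_def)
    then show ?thesis using vK gK that by simp
  qed
  ultimately show ?thesis using g by blast
qed

subsection \<open>The Dirichlet eigenvalue of a spherical cap\<close>

text \<open>The mixed term is split with weights d and 1 / d. The main term keeps a factor close to
  1, and the price 1 / d falls on the approximation error.\<close>

lemma norm_square_young:
  fixes x y :: "'a::real_inner"
  assumes d: "0 < d"
  shows "(norm x)\<^sup>2 \<le> (1 + d) * (norm y)\<^sup>2 + (1 + 1 / d) * (norm (x - y))\<^sup>2"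
proof -
  define z where "z = x - y"
  have x: "x = y + z" by (simp add: z_def)
  have "0 \<le> (norm (d *\<^sub>R y - z))\<^sup>2" by simp
  also have "\<dots> = d\<^sup>2 * (norm y)\<^sup>2 - 2 * d * (y \<bullet> z) + (norm z)\<^sup>2"
    unfolding power2_norm_eq_inner
    by (simp add: inner_diff_left inner_diff_right inner_commute[of z y] power2_eq_square algebra_simps)
  also have "\<dots> = d * (d * (norm y)\<^sup>2 + (norm z)\<^sup>2 / d) - d * (2 * (y \<bullet> z))"
    using d by (simp add: algebra_simps power2_eq_square)
  finally have "d * (2 * (y \<bullet> z)) \<le> d * (d * (norm y)\<^sup>2 + (norm z)\<^sup>2 / d)" by simp
  then have "2 * (y \<bullet> z) \<le> d * (norm y)\<^sup>2 + (norm z)\<^sup>2 / d" using d by (rule mult_left_le_imp_le)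
  moreover have "(norm x)\<^sup>2 = (norm y)\<^sup>2 + 2 * (y \<bullet> z) + (norm z)\<^sup>2"
    unfolding x power2_norm_eq_inner by (simp add: inner_add_left inner_add_right inner_commute[of z y])
  ultimately show ?thesis by (simp add: z_def[symmetric] algebra_simps)
qed

text \<open>The quotient sees only \<Gamma>, so two facts are drawn from test functions that vanish
  off \<Gamma> with their gradients: u vanishes almost everywhere off \<Gamma>, and the test
  gradients can be compared with \<open>w\<close> on \<Gamma> alone.\<close>

lemma H1_0_rayleigh_bound:
  fixes \<Gamma> :: "(real ^ 'n) set"
  assumes \<Gamma>: "\<Gamma> \<in> sets sphere_measure" and l: "0 \<le> l"
    and C: "\<And>v. v \<in> Cc_smooth \<Gamma> \<Longrightarrow> \<exists>g. sphere_C1 v g \<and> (\<forall>x. norm x = 1 \<longrightarrow> x \<notin> \<Gamma> \<longrightarrow> v x = 0 \<and> g x = 0) \<and>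
       l * (LINT x|sphere_measure. (v x)\<^sup>2) \<le> (LINT x|sphere_measure. (norm (g x))\<^sup>2)"
    and u: "u \<in> H1_0 \<Gamma>" and nz: "\<not> (AE x in sphere_measure. u x = 0)"
  shows "l \<le> (LINT x:\<Gamma>|sphere_measure. (norm (weak_gradient u x))\<^sup>2) / (LINT x:\<Gamma>|sphere_measure. (u x)\<^sup>2)"
proof -
  let ?M = "sphere_measure :: (real ^ 'n) measure"
  define w where "w = weak_gradient u"
  have u1: "u \<in> L2_sphere" "w \<in> L2_sphere" "has_weak_gradient u w"
    using u H1_sphere_weak_gradient unfolding H1_0_def w_def by auto
  define a where "a = (LINT x|?M. indicator \<Gamma> x * (u x)\<^sup>2)"
  define b where "b = (LINT x|?M. indicator \<Gamma> x * (norm (w x))\<^sup>2)"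
  have iu: "integrable ?M (\<lambda>x. (u x)\<^sup>2)" and iw: "integrable ?M (\<lambda>x. (norm (w x))\<^sup>2)"
    using L2_sphereD(2)[OF u1(1)] L2_sphereD(2)[OF u1(2)] by simp_all
  have iu\<Gamma>: "integrable ?M (\<lambda>x. indicator \<Gamma> x * (u x)\<^sup>2)" "integrable ?M (\<lambda>x. indicator \<Gamma> x * (norm (w x))\<^sup>2)"
    "integrable ?M (\<lambda>x. indicator (space ?M - \<Gamma>) x * (u x)\<^sup>2)"
    using integrable_mult_indicator[OF \<Gamma> iu] integrable_mult_indicator[OF \<Gamma> iw] integrable_mult_indicator[OF sets.compl_sets[OF \<Gamma>] iu]
    by simp_all
  have approx: "\<exists>v g. sphere_C1 v g \<and> (\<forall>x. norm x = 1 \<longrightarrow> x \<notin> \<Gamma> \<longrightarrow> v x = 0 \<and> g x = 0) \<and>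
       l * (LINT x|?M. (v x)\<^sup>2) \<le> (LINT x|?M. (norm (g x))\<^sup>2) \<and>
       (LINT x|?M. (u x - v x)\<^sup>2) \<le> e \<and> (LINT x|?M. (norm (w x - g x))\<^sup>2) \<le> e" if e: "e > 0" for e
  proof -
    obtain v where v: "v \<in> Cc_smooth \<Gamma>" "H1_norm (\<lambda>x. u x - v x) < sqrt e"
      using u e unfolding H1_0_def by (auto dest: spec[of _ "sqrt e"])
    obtain g where g: "sphere_C1 v g" "\<forall>x. norm x = 1 \<longrightarrow> x \<notin> \<Gamma> \<longrightarrow> v x = 0 \<and> g x = 0"
       "l * (LINT x|?M. (v x)\<^sup>2) \<le> (LINT x|?M. (norm (g x))\<^sup>2)" using C[OF v(1)] by blast
    have "sqrt ((LINT x|?M. (u x - v x)\<^sup>2) + (LINT x|?M. (norm (w x - g x))\<^sup>2)) < sqrt e"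
      using v(2) H1_norm_diff[OF u1 sphere_C1_L2[OF g(1)] sphere_C1_weak_gradient[OF g(1)]] by simp
    then have "(LINT x|?M. (u x - v x)\<^sup>2) + (LINT x|?M. (norm (w x - g x))\<^sup>2) < e" by simp
    moreover have "0 \<le> (LINT x|?M. (u x - v x)\<^sup>2)" "0 \<le> (LINT x|?M. (norm (w x - g x))\<^sup>2)" by simp_all
    ultimately have "(LINT x|?M. (u x - v x)\<^sup>2) \<le> e" "(LINT x|?M. (norm (w x - g x))\<^sup>2) \<le> e" by linarith+
    then show ?thesis using g by blast
  qed
  have off: "(LINT x|?M. indicator (space ?M - \<Gamma>) x * (u x)\<^sup>2) = 0"
  proof (rule antisym)
    show "(LINT x|?M. indicator (space ?M - \<Gamma>) x * (u x)\<^sup>2) \<le> 0"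
    proof (rule field_le_epsilon)
      fix e :: real assume "e > 0"
      then obtain v g where v: "sphere_C1 v g" "\<forall>x. norm x = 1 \<longrightarrow> x \<notin> \<Gamma> \<longrightarrow> v x = 0 \<and> g x = 0"
        "(LINT x|?M. (u x - v x)\<^sup>2) \<le> e" using approx by blast
      have "(LINT x|?M. indicator (space ?M - \<Gamma>) x * (u x)\<^sup>2) \<le> (LINT x|?M. (u x - v x)\<^sup>2)"
      proof (rule integral_mono[OF iu\<Gamma>(3)])
        show "integrable ?M (\<lambda>x. (u x - v x)\<^sup>2)"
          using L2_sphereD(2)[OF L2_sphere_diff[OF u1(1) sphere_C1_L2(1)[OF v(1)]]] by simp
        show "indicator (space ?M - \<Gamma>) x * (u x)\<^sup>2 \<le> (u x - v x)\<^sup>2" if "x \<in> space ?M" for x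
          using v(2) that by (cases "x \<in> \<Gamma>") auto
      qed
      then show "(LINT x|?M. indicator (space ?M - \<Gamma>) x * (u x)\<^sup>2) \<le> 0 + e" using v(3) by simp
    qed
  qed (intro integral_nonneg_AE, auto)
  have a_eq: "a = (LINT x|?M. (u x)\<^sup>2)"
  proof -
    have "(LINT x|?M. (u x)\<^sup>2) = (LINT x|?M. indicator \<Gamma> x * (u x)\<^sup>2 + indicator (space ?M - \<Gamma>) x * (u x)\<^sup>2)"
      by (rule Bochner_Integration.integral_cong) (auto simp: indicator_def)
    then show ?thesis using iu\<Gamma> off by (simp add: a_def)
  qed
  have a: "a > 0"
  proof -
    have "a \<ge> 0" unfolding a_eq by simp
    moreover have "a \<noteq> 0"
    proof
      assume "a = 0"
      then have "AE x in ?M. (u x)\<^sup>2 = 0" using integral_nonneg_eq_0_iff_AE[OF iu] a_eq by simp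
      then show False using nz by simp
    qed
    ultimately show ?thesis by simp
  qed
  have main: "l * a \<le> (1 + d)\<^sup>2 * b + ((1 + d) + l) * (1 + 1 / d) * e" if d: "d > 0" and e: "e > 0" for d e
  proof -
    obtain v g where vg: "sphere_C1 v g" "\<forall>x. norm x = 1 \<longrightarrow> x \<notin> \<Gamma> \<longrightarrow> v x = 0 \<and> g x = 0"
       "l * (LINT x|?M. (v x)\<^sup>2) \<le> (LINT x|?M. (norm (g x))\<^sup>2)"
       "(LINT x|?M. (u x - v x)\<^sup>2) \<le> e" "(LINT x|?M. (norm (w x - g x))\<^sup>2) \<le> e" using approx[OF e] by blast
    note L2 = sphere_C1_L2[OF vg(1)]
    have iv: "integrable ?M (\<lambda>x. (v x)\<^sup>2)" "integrable ?M (\<lambda>x. (norm (g x))\<^sup>2)"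
      "integrable ?M (\<lambda>x. (u x - v x)\<^sup>2)" "integrable ?M (\<lambda>x. (norm (w x - g x))\<^sup>2)"
      using L2_sphereD(2)[OF L2(1)] L2_sphereD(2)[OF L2(2)] L2_sphereD(2)[OF L2_sphere_diff[OF u1(1) L2(1)]] L2_sphereD(2)[OF L2_sphere_diff[OF u1(2) L2(2)]]
      by simp_all
    have "a \<le> (LINT x|?M. (1 + d) * (v x)\<^sup>2 + (1 + 1 / d) * (u x - v x)\<^sup>2)"
      unfolding a_eq
      by (rule integral_mono[OF iu]) (use iv norm_square_young[OF d, of "u _" "v _"] in auto)
    also have "\<dots> = (1 + d) * (LINT x|?M. (v x)\<^sup>2) + (1 + 1 / d) * (LINT x|?M. (u x - v x)\<^sup>2)" using iv by simp
    also have "\<dots> \<le> (1 + d) * (LINT x|?M. (v x)\<^sup>2) + (1 + 1 / d) * e"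
      using vg(4) d by (intro add_left_mono mult_left_mono) auto
    finally have "l * a \<le> l * ((1 + d) * (LINT x|?M. (v x)\<^sup>2) + (1 + 1 / d) * e)" using l by (rule mult_left_mono)
    also have "\<dots> = (1 + d) * (l * (LINT x|?M. (v x)\<^sup>2)) + l * (1 + 1 / d) * e" by (simp add: algebra_simps)
    also have "\<dots> \<le> (1 + d) * (LINT x|?M. (norm (g x))\<^sup>2) + l * (1 + 1 / d) * e"
      using vg(3) d by (intro add_right_mono mult_left_mono) auto
    finally have 1: "l * a \<le> (1 + d) * (LINT x|?M. (norm (g x))\<^sup>2) + l * (1 + 1 / d) * e" .
    \<comment> \<open>Off \<Gamma> the gradient g is zero, which permits the indicator in front of
      \<open>w\<close>.\<close>
    have "(LINT x|?M. (norm (g x))\<^sup>2) \<le> (LINT x|?M. (1 + d) * (indicator \<Gamma> x * (norm (w x))\<^sup>2) + (1 + 1 / d) * (norm (w x - g x))\<^sup>2)"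
    proof (rule integral_mono[OF iv(2)])
      show "integrable ?M (\<lambda>x. (1 + d) * (indicator \<Gamma> x * (norm (w x))\<^sup>2) + (1 + 1 / d) * (norm (w x - g x))\<^sup>2)"
        by (intro Bochner_Integration.integrable_add integrable_mult_right iu\<Gamma>(2) iv(4))
      show "(norm (g x))\<^sup>2 \<le> (1 + d) * (indicator \<Gamma> x * (norm (w x))\<^sup>2) + (1 + 1 / d) * (norm (w x - g x))\<^sup>2" if "x \<in> space ?M" for x
        using norm_square_young[OF d, of "g x" "w x"] vg(2) that d by (cases "x \<in> \<Gamma>") (auto simp: norm_minus_commute)
    qed
    also have "\<dots> = (1 + d) * b + (1 + 1 / d) * (LINT x|?M. (norm (w x - g x))\<^sup>2)"
      unfolding b_def
      by (subst Bochner_Integration.integral_add[OF integrable_mult_right[OF iu\<Gamma>(2)] integrable_mult_right[OF iv(4)]])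
        (simp only: Bochner_Integration.integral_mult_right_zero)
    also have "\<dots> \<le> (1 + d) * b + (1 + 1 / d) * e"
      using vg(5) d by (intro add_left_mono mult_left_mono) auto
    finally have F: "(1 + d) * (LINT x|?M. (norm (g x))\<^sup>2) \<le> (1 + d) * ((1 + d) * b + (1 + 1 / d) * e)"
      using d by (intro mult_left_mono) auto
    have eq: "(1 + d) * ((1 + d) * b + c * e) + l * c * e = (1 + d)\<^sup>2 * b + ((1 + d) + l) * c * e" for c
      by (simp add: algebra_simps power2_eq_square)
    show ?thesis using order_trans[OF 1 add_right_mono[OF F]] unfolding eq .
  qed
  \<comment> \<open>For fixed d the error e tends to 0 first, because it carries the factor 1 + 1 /
    d; afterwards d tends to 0.\<close>
  have "l * a \<le> (1 + d)\<^sup>2 * b" if d: "d > 0" for d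
  proof (rule tendsto_lowerbound)
    show "((\<lambda>e. (1 + d)\<^sup>2 * b + ((1 + d) + l) * (1 + 1 / d) * e) \<longlongrightarrow> (1 + d)\<^sup>2 * b) (at_right 0)"
      by (auto intro!: tendsto_eq_intros)
    show "\<forall>\<^sub>F e in at_right 0. l * a \<le> (1 + d)\<^sup>2 * b + ((1 + d) + l) * (1 + 1 / d) * e"
      unfolding eventually_at_filter using main[OF d] by (auto intro!: always_eventually)
  qed simp
  then have ev: "\<forall>\<^sub>F d in at_right 0. l * a \<le> (1 + d)\<^sup>2 * b"
    unfolding eventually_at_filter by (auto intro!: always_eventually)
  have "l * a \<le> b"
  proof (rule tendsto_lowerbound[OF _ ev])
    show "((\<lambda>d. (1 + d)\<^sup>2 * b) \<longlongrightarrow> b) (at_right 0)" by (auto intro!: tendsto_eq_intros)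
  qed simp
  then have "l \<le> b / a" using a by (simp add: field_simps)
  then show ?thesis by (simp add: a_def b_def w_def set_lebesgue_integral_def)
qed

text \<open>The minimizer is \<open>U\<close>, f extended by zero, and the cutoffs
  \<open>u k\<close> witness that it lies in \<open>H1_0\<close>. The class \<open>P\<close>
  expresses smoothness of f to all orders, which \<open>Cc_smooth\<close> demands of the cutoffs.
  Positive measure of the cap ensures that \<open>U\<close> is not almost everywhere zero.\<close>

theorem dirichlet_eigenvalue_zonal:
  fixes i :: "'n::finite" and f f' f'' :: "real \<Rightarrow> real"
  defines "p \<equiv> axis i 1 :: real ^ 'n"
  assumes z0: "- 1 < z0" "z0 < 1" and l: "0 < l"
    and P: "\<And>\<psi>. \<psi> \<in> P \<Longrightarrow> \<exists>\<psi>'\<in>P. \<forall>z\<in>{-1<..<3}. (\<psi> has_real_derivative \<psi>' z) (at z)" and f: "f \<in> P"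
    and d: "\<And>z. - 1 < z \<Longrightarrow> z < 3 \<Longrightarrow> (f has_real_derivative f' z) (at z)"
      "\<And>z. - 1 < z \<Longrightarrow> z < 3 \<Longrightarrow> (f' has_real_derivative f'' z) (at z)"
      "\<And>z. - 1 < z \<Longrightarrow> z < 3 \<Longrightarrow> isCont f'' z"
    and ode: "\<And>z. - 1 < z \<Longrightarrow> z < 3 \<Longrightarrow> (1 - z\<^sup>2) * f'' z - real (CARD('n) - 1) * z * f' z = - l * f z"
    and f0: "f z0 = 0" and pos: "\<And>z. z0 < z \<Longrightarrow> z \<le> 1 \<Longrightarrow> 0 < f z"
  shows "dirichlet_eigenvalue {x \<in> sphere 0 1. z0 < p \<bullet> x} = l"
proof -
  let ?M = "sphere_measure :: (real ^ 'n) measure"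
  define \<Gamma> where "\<Gamma> = {x \<in> sphere 0 1. z0 < p \<bullet> x}"
  have p: "norm p = 1" by (simp add: p_def norm_axis_1)
  have px: "p \<bullet> x = x $ i" for x by (simp add: p_def inner_axis')
  have \<Gamma>: "\<Gamma> \<in> sets ?M"
  proof (rule sets_sphere_measureI)
    have "\<Gamma> = sphere 0 1 \<inter> {x. z0 < p \<bullet> x}" by (auto simp: \<Gamma>_def)
    moreover have "open {x. z0 < p \<bullet> x}" by (intro open_Collect_less continuous_intros)
    ultimately show "\<Gamma> \<in> sets borel" by auto
  qed (auto simp: \<Gamma>_def)
  have \<Gamma>pos: "emeasure ?M \<Gamma> > 0"
    using sphere_cap_pos[OF z0(2), of i] unfolding \<Gamma>_def px .
  have df: "(f has_real_derivative f' z) (at z)" "isCont f' z" if "z0 \<le> z" "z < 3" for z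
    using d(1)[of z] DERIV_isCont[OF d(2)[of z]] that z0 by auto
  obtain K where K: "K \<ge> 0" "\<And>z. z0 \<le> z \<Longrightarrow> z \<le> 1 \<Longrightarrow> \<bar>f z\<bar> \<le> K \<and> \<bar>f' z\<bar> \<le> K \<and> \<bar>f z\<bar> \<le> K * (z - z0)"
    using C1_linear_bound[of z0 f f', OF z0(2) df f0] by blast
  define u where "u k x = cutoff k z0 f (p \<bullet> x)" for k x
  define g where "g k x = cutoff' k z0 f f' (p \<bullet> x) *\<^sub>R (p - (p \<bullet> x) *\<^sub>R x)" for k x
  define U where "U x = (if z0 < p \<bullet> x then f (p \<bullet> x) else 0)" for x
  define G where "G x = (if z0 < p \<bullet> x then f' (p \<bullet> x) else 0) *\<^sub>R (p - (p \<bullet> x) *\<^sub>R x)" for x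
  have C1: "sphere_C1 (u k) (g k)" for k
    unfolding u_def[abs_def] g_def[abs_def] by (rule cutoff_C1[OF p]) (use df in auto)
  have z1: "p \<bullet> x \<le> 1" if "norm x = 1" for x using sphere_inner_range[OF p that] by simp
  \<comment> \<open>The factor 3 comes from the bound on the gradients;
    \<open>weak_gradient_limit\<close> takes one constant for both.\<close>
  have ub: "\<bar>u k x\<bar> \<le> 3 * K" if "norm x = 1" for k x
    using cutoff_bounds(1)[OF K z1[OF that], of k] K(1) by (simp add: u_def)
  have gb: "norm (g k x) \<le> 3 * K" if x: "norm x = 1" for k x
  proof -
    have "(norm (p - (p \<bullet> x) *\<^sub>R x))\<^sup>2 \<le> 1\<^sup>2" using zonal_tangent(2)[OF p x] by simp
    then have "norm (p - (p \<bullet> x) *\<^sub>R x) \<le> 1" by (rule power2_le_imp_le) simp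
    then have "\<bar>cutoff' k z0 f f' (p \<bullet> x)\<bar> * norm (p - (p \<bullet> x) *\<^sub>R x) \<le> (3 * K) * 1"
      using cutoff_bounds(2)[OF K z1[OF x], of k] K(1) by (intro mult_mono) auto
    then show ?thesis by (simp add: g_def)
  qed
  have lim: "(\<lambda>k. u k x) \<longlonglongrightarrow> U x" "(\<lambda>k. g k x) \<longlonglongrightarrow> G x" for x
    unfolding u_def g_def U_def G_def by (intro tendsto_scaleR tendsto_const cutoff_limits)+
  have UG: "U \<in> L2_sphere" "G \<in> L2_sphere" "has_weak_gradient U G" "(\<lambda>k. H1_norm (\<lambda>x. U x - u k x)) \<longlonglongrightarrow> 0"
    by (rule weak_gradient_limit[OF C1 ub gb lim]; assumption)+
  have UH: "U \<in> H1_0 \<Gamma>"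
    unfolding H1_0_def
  proof (intro CollectI conjI allI impI)
    show "U \<in> H1_sphere" using UG by (auto simp: H1_sphere_def)
    fix e :: real assume "e > 0"
    with UG(4) have "\<forall>\<^sub>F k in sequentially. H1_norm (\<lambda>x. U x - u k x) < e"
      by (rule order_tendstoD(2))
    then obtain k where "H1_norm (\<lambda>x. U x - u k x) < e" unfolding eventually_sequentially by blast
    moreover have "u k \<in> Cc_smooth \<Gamma>"
      unfolding u_def[abs_def] \<Gamma>_def by (rule cutoff_Cc_smooth[OF p z0(1) P f])
    ultimately show "\<exists>v\<in>Cc_smooth \<Gamma>. H1_norm (\<lambda>x. U x - v x) < e" by blast
  qed
  have Upos: "U x > 0" if "x \<in> \<Gamma>" for x using that pos z1[of x] by (auto simp: U_def \<Gamma>_def)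
  have U0: "U x = 0" "G x = 0" if "x \<in> space ?M" "x \<notin> \<Gamma>" for x using that by (auto simp: U_def G_def \<Gamma>_def)
  have nz: "\<not> (AE x in ?M. U x = 0)"
  proof
    assume "AE x in ?M. U x = 0"
    moreover have "{x \<in> space ?M. \<not> U x = 0} = \<Gamma>" using Upos U0 by (force simp: \<Gamma>_def)
    ultimately have "emeasure ?M \<Gamma> = 0" using AE_iff_measurable[OF \<Gamma>, of "\<lambda>x. U x = 0"] by simp
    then show False using \<Gamma>pos by simp
  qed
  have iU: "integrable ?M (\<lambda>x. (U x)\<^sup>2)" "integrable ?M (\<lambda>x. (norm (G x))\<^sup>2)"
    using L2_sphereD(2)[OF UG(1)] L2_sphereD(2)[OF UG(2)] by simp_all
  have GU: "(LINT x|?M. (norm (G x))\<^sup>2) = l * (LINT x|?M. (U x)\<^sup>2)"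
  proof -
    have "(LINT x|?M. (norm (G x))\<^sup>2 - l * (U x)\<^sup>2)
      = (LINT x|?M. (if z0 < p \<bullet> x then (f' (p \<bullet> x))\<^sup>2 * (1 - (p \<bullet> x)\<^sup>2) - l * (f (p \<bullet> x))\<^sup>2 else 0))"
      by (rule Bochner_Integration.integral_cong) (auto simp: G_def U_def power_mult_distrib zonal_tangent(2)[OF p])
    also have "\<dots> = 0" by (rule zonal_eigen_identity[OF p z0 d ode f0])
    finally show ?thesis using iU by simp
  qed
  have Uint: "(LINT x|?M. (U x)\<^sup>2) > 0"
  proof -
    have "(LINT x|?M. (U x)\<^sup>2) \<noteq> 0"
      using integral_nonneg_eq_0_iff_AE[OF iU(1)] nz by simp
    moreover have "(LINT x|?M. (U x)\<^sup>2) \<ge> 0" by simp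
    ultimately show ?thesis by linarith
  qed
  have IU: "(LINT x:\<Gamma>|?M. (U x)\<^sup>2) = (LINT x|?M. (U x)\<^sup>2)"
    unfolding set_lebesgue_integral_def
    by (rule Bochner_Integration.integral_cong) (use U0 in \<open>auto simp: indicator_def\<close>)
  have IG: "(LINT x:\<Gamma>|?M. (norm (weak_gradient U x))\<^sup>2) = (LINT x|?M. (norm (G x))\<^sup>2)"
    unfolding set_lebesgue_integral_def
  proof (rule integral_cong_AE)
    have "weak_gradient U \<in> borel_measurable ?M"
      by (rule L2_sphereD(1)[OF weak_gradient_props(1)[OF UG(2,3)]])
    then show "(\<lambda>x. indicator \<Gamma> x *\<^sub>R (norm (weak_gradient U x))\<^sup>2) \<in> borel_measurable ?M"
      using \<Gamma> by simp
    show "(\<lambda>x. (norm (G x))\<^sup>2) \<in> borel_measurable ?M" using iU(2) by simp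
    show "AE x in ?M. indicator \<Gamma> x *\<^sub>R (norm (weak_gradient U x))\<^sup>2 = (norm (G x))\<^sup>2"
      using weak_gradient_props(3)[OF UG(2,3)] AE_space
      by eventually_elim (use U0(2) in \<open>auto simp: indicator_def\<close>)
  qed
  have barta: "\<exists>g. sphere_C1 v g \<and> (\<forall>x. norm x = 1 \<longrightarrow> x \<notin> \<Gamma> \<longrightarrow> v x = 0 \<and> g x = 0) \<and>
       l * (LINT x|?M. (v x)\<^sup>2) \<le> (LINT x|?M. (norm (g x))\<^sup>2)" if "v \<in> Cc_smooth \<Gamma>" for v
    using zonal_barta[OF p z0 d ode pos that[unfolded \<Gamma>_def]] by (auto simp: \<Gamma>_def not_less)
  have "dirichlet_eigenvalue \<Gamma> = l"
    unfolding dirichlet_eigenvalue_def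
  proof (rule Least_equality)
    show "\<exists>u\<in>H1_0 \<Gamma>. \<not> (AE x in sphere_measure. u x = 0) \<and>
        l = (LINT x:\<Gamma>|sphere_measure. (norm (weak_gradient u x))\<^sup>2) / (LINT x:\<Gamma>|sphere_measure. (u x)\<^sup>2)"
      using UH nz Uint by (intro bexI[of _ U]) (auto simp: IU IG GU)
    show "l \<le> r" if "\<exists>u\<in>H1_0 \<Gamma>. \<not> (AE x in sphere_measure. u x = 0) \<and>
        r = (LINT x:\<Gamma>|sphere_measure. (norm (weak_gradient u x))\<^sup>2) / (LINT x:\<Gamma>|sphere_measure. (u x)\<^sup>2)" for r
      using that H1_0_rayleigh_bound[OF \<Gamma> less_imp_le[OF l] barta] by blast
  qed
  then show ?thesis by (simp add: \<Gamma>_def)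
qed

lemma spherical_cap_eq:
  assumes p: "norm p = 1" and t: "0 < t" "t < pi"
  shows "spherical_cap p t = {x \<in> sphere 0 1. cos t < p \<bullet> x}"
proof -
  have "0 \<le> arccos (p \<bullet> x) \<and> (arccos (p \<bullet> x) < t \<longleftrightarrow> cos t < p \<bullet> x)" if x: "norm x = 1" for x
  proof -
    have b: "- 1 \<le> p \<bullet> x" "p \<bullet> x \<le> 1" using sphere_inner_range[OF p x] by auto
    have "arccos (p \<bullet> x) < t \<longleftrightarrow> cos t < cos (arccos (p \<bullet> x))"
      using arccos_lbound[OF b] arccos_ubound[OF b] t by (simp add: cos_mono_less_eq)
    then show ?thesis using b arccos_lbound[OF b] by (simp add: cos_arccos)
  qed
  then show ?thesis unfolding spherical_cap_def by auto
qed

text \<open>In the height z = cos \<theta> the radial solution is a power series in 1 - z,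
  convergent for - 1 < z < 3, and the radial equation becomes the zonal one with n - 1 = m + 1. All
  such series form the class closed under differentiation that the cutoffs require.\<close>

theorem dirichlet_eigenvalue_spherical_cap:
  fixes i :: "'n::finite"
  assumes N: "2 \<le> CARD('n)" and t: "0 < t" "t < pi"
  shows "dirichlet_eigenvalue (spherical_cap (axis i 1 :: real ^ 'n) t) = cap_eigenvalue (CARD('n) - 2) t"
proof -
  define m where "m = CARD('n) - 2"
  have mN: "real (CARD('n) - 1) = real (m + 1)" using N by (simp add: m_def)
  define l where "l = cap_eigenvalue m t"
  have l: "0 < l" "first_zero m l t" using cap_eigenvalue[OF t] by (auto simp: l_def)
  define P where "P = {\<lambda>z. pow_series c (1 - z) |c. \<forall>s. \<bar>s\<bar> < 2 \<longrightarrow> summable (\<lambda>k. c k * s ^ k)}"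
  define c0 where "c0 = radial_coeff m l"
  \<comment> \<open>The signs come from differentiating 1 - z.\<close>
  define c1 where "c1 k = - diffs c0 k" for k
  define c2 where "c2 k = - diffs c1 k" for k
  have s_neg_diffs: "summable (\<lambda>k. - diffs c k * s ^ k)"
    if "\<And>s. \<bar>s\<bar> < 2 \<Longrightarrow> summable (\<lambda>k. c k * s ^ k)" "\<bar>s\<bar> < 2" for c :: "nat \<Rightarrow> real" and s
    using summable_minus[OF summable_diffs[OF that]] by simp
  have pow_series_neg: "pow_series (\<lambda>k. - c k) s = - pow_series c s" if "summable (\<lambda>k. c k * s ^ k)" for c s
    using suminf_minus[OF that] by (simp add: pow_series_def)
  have der: "((\<lambda>z. pow_series c (1 - z)) has_real_derivative pow_series (\<lambda>k. - diffs c k) (1 - z)) (at z)"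
    if c: "\<And>s. \<bar>s\<bar> < 2 \<Longrightarrow> summable (\<lambda>k. c k * s ^ k)" and z: "- 1 < z" "z < 3" for c z
  proof -
    have s: "\<bar>1 - z\<bar> < 2" using z by auto
    have "((\<lambda>z. 1 - z) has_real_derivative - 1) (at z)" by (auto intro!: derivative_eq_intros)
    from DERIV_chain2[OF pow_series_deriv[OF c s] this]
    show ?thesis using pow_series_neg[OF summable_diffs[OF c s]] by simp
  qed
  have s0: "summable (\<lambda>k. c0 k * s ^ k)" if "\<bar>s\<bar> < 2" for s unfolding c0_def by (rule radial_coeff_summable(1)[OF that])
  have s1: "summable (\<lambda>k. c1 k * s ^ k)" if "\<bar>s\<bar> < 2" for s unfolding c1_def by (rule s_neg_diffs[OF s0 that])
  have s2: "summable (\<lambda>k. c2 k * s ^ k)" if "\<bar>s\<bar> < 2" for s unfolding c2_def by (rule s_neg_diffs[OF s1 that])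
  have "dirichlet_eigenvalue {x \<in> sphere 0 1. cos t < (axis i 1 :: real ^ 'n) \<bullet> x} = l"
  proof (rule dirichlet_eigenvalue_zonal[where P = P and f = "\<lambda>z. pow_series c0 (1 - z)" and f' = "\<lambda>z. pow_series c1 (1 - z)" and f'' = "\<lambda>z. pow_series c2 (1 - z)"])
    show "- 1 < cos t" using cos_gt_minus_one[of t] t by simp
    show "cos t < 1" using cos_monotone_0_pi[of 0 t] t by simp
    show "0 < l" by (rule l)
    show "\<exists>\<psi>'\<in>P. \<forall>z\<in>{-1<..<3}. (\<psi> has_real_derivative \<psi>' z) (at z)" if "\<psi> \<in> P" for \<psi>
    proof -
      obtain c where c: "\<psi> = (\<lambda>z. pow_series c (1 - z))" "\<And>s. \<bar>s\<bar> < 2 \<Longrightarrow> summable (\<lambda>k. c k * s ^ k)"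
        using \<open>\<psi> \<in> P\<close> by (auto simp: P_def)
      have "(\<lambda>z. pow_series (\<lambda>k. - diffs c k) (1 - z)) \<in> P" unfolding P_def using s_neg_diffs[OF c(2)] by blast
      then show ?thesis using der[OF c(2)] c(1) by (intro bexI[of _ "\<lambda>z. pow_series (\<lambda>k. - diffs c k) (1 - z)"]) auto
    qed
    show "(\<lambda>z. pow_series c0 (1 - z)) \<in> P" unfolding P_def using s0 by blast
    fix z :: real
    show "((\<lambda>z. pow_series c0 (1 - z)) has_real_derivative pow_series c1 (1 - z)) (at z)" if "- 1 < z" "z < 3"
      unfolding c1_def by (rule der[OF s0 that])
    show "((\<lambda>z. pow_series c1 (1 - z)) has_real_derivative pow_series c2 (1 - z)) (at z)" if "- 1 < z" "z < 3"
      unfolding c2_def by (rule der[OF s1 that])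
    show "isCont (\<lambda>z. pow_series c2 (1 - z)) z" if "- 1 < z" "z < 3"
      by (rule DERIV_isCont[OF der[OF s2 that]])
    show "(1 - z\<^sup>2) * pow_series c2 (1 - z) - real (CARD('n) - 1) * z * pow_series c1 (1 - z) = - l * pow_series c0 (1 - z)" if z: "- 1 < z" "z < 3"
    proof -
      have s: "\<bar>1 - z\<bar> < 2" using z by auto
      have "(1 - z) * (2 - (1 - z)) * pow_series (diffs (diffs c0)) (1 - z) + real (m + 1) * (1 - (1 - z)) * pow_series (diffs c0) (1 - z)
        + l * pow_series c0 (1 - z) + pow_series (\<lambda>k. 0) (1 - z) = 0"
        by (rule pow_series_ode) (use s radial_coeff_summable(1) in \<open>simp_all add: c0_def\<close>)
      moreover have "pow_series c1 (1 - z) = - pow_series (diffs c0) (1 - z)"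
        unfolding c1_def by (rule pow_series_neg[OF summable_diffs[OF s0 s]])
      moreover have "pow_series c2 (1 - z) = pow_series (diffs (diffs c0)) (1 - z)"
        unfolding c2_def c1_def by (simp add: diffs_def pow_series_def)
      moreover have "pow_series (\<lambda>k. 0) (1 - z) = 0" by (simp add: pow_series_def)
      ultimately show ?thesis unfolding mN by (simp add: algebra_simps power2_eq_square)
    qed
    have c0_cos: "pow_series c0 (1 - cos \<theta>) = radial m l \<theta>" for \<theta> by (simp add: radial_def colat_series_def c0_def)
    show "pow_series c0 (1 - cos t) = 0" using l(2) unfolding c0_cos by (simp add: first_zero_def)
    show "0 < pow_series c0 (1 - z)" if z: "cos t < z" "z \<le> 1"
    proof -
      have b: "- 1 \<le> z" "z \<le> 1" using z cos_ge_minus_one[of t] by linarith+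
      have "cos t < cos (arccos z)" using z b by (simp add: cos_arccos)
      then have "arccos z < t" using arccos_lbound[OF b] arccos_ubound[OF b] t by (simp add: cos_mono_less_eq)
      then have "0 < radial m l (arccos z)" using l(2) arccos_lbound[OF b] by (simp add: first_zero_def)
      then show ?thesis using c0_cos[of "arccos z"] b by (simp add: cos_arccos)
    qed
  qed
  then show ?thesis using spherical_cap_eq[OF _ t, of "axis i 1 :: real ^ 'n"] by (simp add: norm_axis_1 l_def m_def)
qed

theorem proposition4p1:
  fixes i :: "'n::finite"
    and p :: "real ^ 'n"
    and lam :: "real \<Rightarrow> real"
  assumes "CARD('n) \<ge> 3"
    and "p = axis i 1"
    and "\<And>\<theta>. \<theta> \<in> {0<..<pi} \<Longrightarrow> lam \<theta> = dirichlet_eigenvalue (spherical_cap p \<theta>)"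
  shows "(\<forall>\<theta>\<in>{0<..<pi}. lam differentiable (at \<theta>) \<and> deriv lam differentiable (at \<theta>))
    \<and> strict_antimono_on {0<..<pi} lam
    \<and> filterlim lam at_top (at_right 0)
    \<and> (CARD('n) \<ge> 5 \<longrightarrow> strictly_convex_on {0<..<pi} lam)"
proof -
  have lam: "lam t = cap_eigenvalue (CARD('n) - 2) t" if "0 < t" "t < pi" for t
    using assms that dirichlet_eigenvalue_spherical_cap[of t i] by simp
  note analysis = cap_eigenvalue_analysis[of lam "CARD('n) - 2", OF lam]
  have "strictly_convex_on {0<..<pi} lam" if "CARD('n) \<ge> 5"
    unfolding strictly_convex_on_def
  proof (intro conjI ballI allI impI)
    fix x y t :: real assume xy: "x \<in> {0<..<pi}" "y \<in> {0<..<pi}" "x \<noteq> y" and t: "0 < t" "t < 1"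
    have m: "3 \<le> CARD('n) - 2" using that by simp
    consider "x < y" | "y < x" using xy(3) by linarith
    then show "lam ((1 - t) *\<^sub>R x + t *\<^sub>R y) < (1 - t) * lam x + t * lam y"
    proof cases
      case 1
      then show ?thesis using analysis(4)[OF _ _ m _ 1 _ t] xy by simp
    next
      case 2
      then have "lam ((1 - (1 - t)) * y + (1 - t) * x) < (1 - (1 - t)) * lam y + (1 - t) * lam x"
        using analysis(4)[OF _ _ m _ 2 _, of "1 - t"] xy t by simp
      then show ?thesis by (simp add: add.commute)
    qed
  qed simp
  then show ?thesis using analysis(1-3) by simp
qed

end
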